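(* Let $m,n\in\mathbb{N}$ and let $f\in\mathcal{H}(\Lambda)^{m\times n}$ be a $\mathbb{C}^{m\times n}$-valued DA function. Then $f$ is rational if, and only if, the column space of $f$, that is, the space $\{z\mapsto f(z)w : w\in\mathbb{C}^n\}$ of $\mathbb{C}^m$-valued DA functions, is contained in a finite-dimensional vector space $\mathcal{M}$ of $\mathbb{C}^m$-valued DA functions that is $Z_-$-invariant (i.e. $Z_-\mathcal{M}\subset\mathcal{M}$).
   Context: **Lattice.** $\Lambda$ is a rhombic lattice in the complex plane $\mathbb{C}$: a monohedral (all tiles congruent), edge-to-edge tessellation of $\mathbb{C}$ with rhombi of side length $1$. $V(\Lambda)$, $E(\Lambda)$, $F(\Lambda)$ denote its sets of vertices, edges and faces; $(a,b)\in E(\Lambda)$ means that $a,b\in V(\Lambda)$ are adjacent, and edges are taken in both orientations, so $(a,b)\in E(\Lambda)$ iff $(b,a)\in E(\Lambda)$. A path in $\Lambda$ from $a$ to $b$ is a finite sequence $(z_0,\dots,z_N)$ of vertices with $z_0=a$, $z_N=b$ and $z_{n-1},z_n$ adjacent for $n=1,\dots,N$; it is closed if $a=b$. Standing assumptions on $\Lambda$: (i) $0\in V(\Lambda)$; (ii) for every $z\in V(\Lambda)$ there are $N\in\mathbb{N}$ and a path $(z_0,\dots,z_N)$ with $z_0=z$, $z_n-z_{n-1}\neq\pm1$ for $n=1,\dots,N-1$, and $z_N-z_{N-1}=1$. **Discrete analyticity.** For $f:V(\Lambda)\to\mathbb{C}$ and a path $\gamma=(z_0,\dots,z_N)$, $\int_\gamma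 f\,\delta z=\sum_{n=1}^N\frac{f(z_{n-1})+f(z_n)}{2}(z_n-z_{n-1})$. $f$ is discrete analytic (DA) if $\int_\gamma f\,\delta z=0$ for every closed path $\gamma$; then $\int_a^b f\,\delta z$ denotes $\int_\gamma f\,\delta z$ for any path $\gamma$ from $a$ to $b$. $\mathcal{H}(\Lambda)$ is the complex vector space of DA functions. **Shift operators.** $Z_+:\mathcal{H}(\Lambda)\to\mathcal{H}(\Lambda)$ is $(Z_+f)(z)=\frac{f(0)-f(z)}{2}+\int_0^z f\,\delta z$. It is injective with range $\{g\in\mathcal{H}(\Lambda):g(0)=0\}$, so one may define $Z_-:\mathcal{H}(\Lambda)\to\mathcal{H}(\Lambda)$ by letting $Z_-f$ be the unique element of $\mathcal{H}(\Lambda)$ with $(Z_+Z_-f)(z)=f(z)-f(0)$. **The set $S(\Lambda)$.** $S(\Lambda)=\{t\in\mathbb{C}: t(1+b-a)=-2\text{ for some }(a,b)\in E(\Lambda)\}$. Standing assumption: no element of $S(\Lambda)$ is an eigenvalue of $Z_-$ on $\mathcal{H}(\Lambda)$. **DA polynomials.** $z^{(0)}=1$ and $z^{(n)}=Z_+z^{(n-1)}$ for $n\ge1$ (so $z^{(1)}=z$). DA polynomials are finite linear combinations of the functions $z^{(n)}$. **Matrix-valued functions.** $\mathcal{H}(\Lambda)^{m\times n}$ is the space of $\mathbb{C}^{m\times n}$-valued functions on $V(\Lambda)$ with DA entries; integrals and $Z_\pm$ act entrywise. $\mathbb{C}^{m\times n}$-valued DA polynomials are sums $\sum_{n=0}^N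 A_nz^{(n)}$ with matrix coefficients. For such a polynomial $p=\sum_{n=0}^N A_nz^{(n)}$ and DA matrix-valued functions $f,g$ of suitable sizes, the convolution product is $(p\odot f)(z)=\sum_{n=0}^N A_n(Z_+^nf)(z)$ and $(g\odot p)(z)=\sum_{n=0}^N(Z_+^ng)(z)A_n$. **Rational DA functions.** For $A\in\mathbb{C}^{\ell\times\ell}$ with spectrum $\sigma(A)$ satisfying $S(\Lambda)\cap\sigma(A)=\emptyset$, the DA polynomial $I-zA$ has a unique two-sided $\odot$-inverse in $\mathcal{H}(\Lambda)^{\ell\times\ell}$, denoted $(I-zA)^{-\odot}$. A matrix-valued DA function $f$ is called rational if it can be written as $f(z)=D+C(I-zA)^{-\odot}\odot(zB)$, i.e. $f(z)=D+C\big(Z_+(I-zA)^{-\odot}\big)(z)B$, with complex matrices $A,B,C,D$ of suitable dimensions and $S(\Lambda)\cap\sigma(A)=\emptyset$; such a representation is called a realization of $f$. *)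

theory Defs
  imports
    "HOL-Analysis.Polytope"
    "Jordan_Normal_Form.VS_Connect"
    "Jordan_Normal_Form.Spectral_Radius"
begin

unbundle no vec_syntax

section \<open>Rhombic lattices\<close>

text \<open>A lattice is represented by its set of (closed) tiles.\<close>

definition unit_rhombus :: "complex set \<Rightarrow> bool" where
  "unit_rhombus T \<longleftrightarrow>
     (\<exists>a u v. norm u = 1 \<and> norm v = 1 \<and> u \<noteq> v \<and> u \<noteq> - v \<and>
        T = convex hull {a, a + u, a + u + v, a + v})"

definition congruent_tiles :: "complex set \<Rightarrow> complex set \<Rightarrow> bool" where
  "congruent_tiles S T \<longleftrightarrow>
     (\<exists>h. (\<forall>x y. dist (h x) (h y) = dist x y) \<and> h ` S = T)"

text \<open>The \<open>face_of\<close> clause is the edge-to-edge condition: two distinct tiles meet in the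
  empty set, in a common vertex or in a full common edge.\<close>

definition rhombic_tessellation :: "complex set set \<Rightarrow> bool" where
  "rhombic_tessellation \<Lambda> \<longleftrightarrow>
     (\<forall>T\<in>\<Lambda>. unit_rhombus T) \<and>
     \<Union>\<Lambda> = UNIV \<and>
     (\<forall>S\<in>\<Lambda>. \<forall>T\<in>\<Lambda>. S \<noteq> T \<longrightarrow> interior S \<inter> interior T = {}) \<and>
     (\<forall>S\<in>\<Lambda>. \<forall>T\<in>\<Lambda>. congruent_tiles S T) \<and>
     (\<forall>S\<in>\<Lambda>. \<forall>T\<in>\<Lambda>. S \<inter> T face_of S \<and> S \<inter> T face_of T)"

definition lverts :: "complex set set \<Rightarrow> complex set" where
  "lverts \<Lambda> = {v. \<exists>T\<in>\<Lambda>. v extreme_point_of T}"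

definition ledges :: "complex set set \<Rightarrow> (complex \<times> complex) set" where
  "ledges \<Lambda> = {(a, b). \<exists>T\<in>\<Lambda>. closed_segment a b edge_of T}"

definition lpath :: "complex set set \<Rightarrow> complex list \<Rightarrow> complex \<Rightarrow> complex \<Rightarrow> bool" where
  "lpath \<Lambda> p a b \<longleftrightarrow>
     p \<noteq> [] \<and> hd p = a \<and> last p = b \<and> set p \<subseteq> lverts \<Lambda> \<and>
     (\<forall>n. 1 \<le> n \<and> n < length p \<longrightarrow> (p ! (n - 1), p ! n) \<in> ledges \<Lambda>)"

definition rhombic_lattice :: "complex set set \<Rightarrow> bool" where
  "rhombic_lattice \<Lambda> \<longleftrightarrow>
     rhombic_tessellation \<Lambda> \<and>
     0 \<in> lverts \<Lambda> \<and>
     (\<forall>z\<in>lverts \<Lambda>. \<exists>N\<ge>1. \<exists>p w. lpath \<Lambda> p z w \<and> length p = N + 1 \<and>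
        (\<forall>n\<in>{1..N - 1}. p ! n - p ! (n - 1) \<noteq> 1 \<and> p ! n - p ! (n - 1) \<noteq> - 1) \<and>
        p ! N - p ! (N - 1) = 1)"

section \<open>Discrete analytic functions\<close>

text \<open>Functions on the vertex set are total functions that are \<open>undefined\<close> outside of it
  (\<open>extensional\<close>), so that equality of functions is equality on the vertex set.\<close>

definition path_integral :: "(complex \<Rightarrow> complex) \<Rightarrow> complex list \<Rightarrow> complex" where
  "path_integral f p =
     (\<Sum>n = 1..<length p. (f (p ! (n - 1)) + f (p ! n)) / 2 * (p ! n - p ! (n - 1)))"

definition DA :: "complex set set \<Rightarrow> (complex \<Rightarrow> complex) set" where
  "DA \<Lambda> = {f \<in> extensional (lverts \<Lambda>).
             \<forall>a p. lpath \<Lambda> p a a \<longrightarrow> path_integral f p = 0}"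

definition DA_integral ::
    "complex set set \<Rightarrow> (complex \<Rightarrow> complex) \<Rightarrow> complex \<Rightarrow> complex \<Rightarrow> complex" where
  "DA_integral \<Lambda> f a b = path_integral f (SOME p. lpath \<Lambda> p a b)"

definition Zplus :: "complex set set \<Rightarrow> (complex \<Rightarrow> complex) \<Rightarrow> complex \<Rightarrow> complex" where
  "Zplus \<Lambda> f = (\<lambda>z\<in>lverts \<Lambda>. (f 0 - f z) / 2 + DA_integral \<Lambda> f 0 z)"

definition Zminus :: "complex set set \<Rightarrow> (complex \<Rightarrow> complex) \<Rightarrow> complex \<Rightarrow> complex" where
  "Zminus \<Lambda> f = (THE g. g \<in> DA \<Lambda> \<and> Zplus \<Lambda> g = (\<lambda>z\<in>lverts \<Lambda>. f z - f 0))"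

definition Zminus_eigenvalue :: "complex set set \<Rightarrow> complex \<Rightarrow> bool" where
  "Zminus_eigenvalue \<Lambda> t \<longleftrightarrow>
     (\<exists>f\<in>DA \<Lambda>. f \<noteq> (\<lambda>z\<in>lverts \<Lambda>. 0) \<and> Zminus \<Lambda> f = (\<lambda>z\<in>lverts \<Lambda>. t * f z))"

definition S_set :: "complex set set \<Rightarrow> complex set" where
  "S_set \<Lambda> = {t. \<exists>(a, b)\<in>ledges \<Lambda>. t * (1 + b - a) = - 2}"

section \<open>Vector- and matrix-valued functions\<close>

definition DA_vec :: "complex set set \<Rightarrow> nat \<Rightarrow> (complex \<Rightarrow> complex vec) set" where
  "DA_vec \<Lambda> m = {f \<in> lverts \<Lambda> \<rightarrow>\<^sub>E carrier_vec m.
                   \<forall>i<m. (\<lambda>z\<in>lverts \<Lambda>. f z $ i) \<in> DA \<Lambda>}"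

definition DA_mat :: "complex set set \<Rightarrow> nat \<Rightarrow> nat \<Rightarrow> (complex \<Rightarrow> complex mat) set" where
  "DA_mat \<Lambda> m n = {f \<in> lverts \<Lambda> \<rightarrow>\<^sub>E carrier_mat m n.
                     \<forall>i<m. \<forall>j<n. (\<lambda>z\<in>lverts \<Lambda>. f z $$ (i, j)) \<in> DA \<Lambda>}"

definition Zminus_vec ::
    "complex set set \<Rightarrow> (complex \<Rightarrow> complex vec) \<Rightarrow> complex \<Rightarrow> complex vec" where
  "Zminus_vec \<Lambda> f =
     (\<lambda>z\<in>lverts \<Lambda>. vec (dim_vec (f z)) (\<lambda>i. Zminus \<Lambda> (\<lambda>w\<in>lverts \<Lambda>. f w $ i) z))"

definition Zplus_mat ::
    "complex set set \<Rightarrow> (complex \<Rightarrow> complex mat) \<Rightarrow> complex \<Rightarrow> complex mat" where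
  "Zplus_mat \<Lambda> f =
     (\<lambda>z\<in>lverts \<Lambda>. mat (dim_row (f z)) (dim_col (f z))
        (\<lambda>ij. Zplus \<Lambda> (\<lambda>w\<in>lverts \<Lambda>. f w $$ ij) z))"

text \<open>The complex vector space of \<open>\<complex>\<^sup>m\<close>-valued discrete analytic functions, as a module record
  (the ring operations of the record are irrelevant for a vector space).\<close>

definition DA_vec_space ::
    "complex set set \<Rightarrow> nat \<Rightarrow> (complex, complex \<Rightarrow> complex vec) module" where
  "DA_vec_space \<Lambda> m =
     \<lparr>carrier = DA_vec \<Lambda> m,
      mult = undefined,
      one = undefined,
      zero = (\<lambda>z\<in>lverts \<Lambda>. 0\<^sub>v m),
      add = (\<lambda>f g. \<lambda>z\<in>lverts \<Lambda>. f z + g z),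
      smult = (\<lambda>c f. \<lambda>z\<in>lverts \<Lambda>. c \<cdot>\<^sub>v f z)\<rparr>"

lemma path_integral_cong:
  assumes "\<And>z. z \<in> set p \<Longrightarrow> f z = g z"
  shows "path_integral f p = path_integral g p"
proof -
  have "f (p ! n) = g (p ! n)" "f (p ! (n - 1)) = g (p ! (n - 1))" if "n < length p" for n
    using assms that by simp_all
  then show ?thesis
    unfolding path_integral_def by (intro sum.cong) auto
qed

lemma path_integral_add:
  "path_integral (\<lambda>z. f z + g z) p = path_integral f p + path_integral g p"
  unfolding path_integral_def sum.distrib[symmetric]
  by (rule sum.cong) (simp_all add: field_simps)

lemma path_integral_cmult: "path_integral (\<lambda>z. c * f z) p = c * path_integral f p"
  unfolding path_integral_def sum_distrib_left
  by (rule sum.cong) (simp_all add: field_simps)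

lemma DA_combine:
  assumes "f \<in> DA \<Lambda>" "g \<in> DA \<Lambda>"
  shows "(\<lambda>z\<in>lverts \<Lambda>. c * f z + d * g z) \<in> DA \<Lambda>"
proof -
  have "path_integral (\<lambda>z\<in>lverts \<Lambda>. c * f z + d * g z) p =
          c * path_integral f p + d * path_integral g p" if "lpath \<Lambda> p a a" for a p
  proof -
    have "path_integral (\<lambda>z\<in>lverts \<Lambda>. c * f z + d * g z) p =
          path_integral (\<lambda>z. c * f z + d * g z) p"
      by (rule path_integral_cong) (use that in \<open>unfold lpath_def, fastforce\<close>)
    then show ?thesis
      by (simp add: path_integral_add path_integral_cmult)
  qed
  moreover have "path_integral f p = 0" "path_integral g p = 0" if "lpath \<Lambda> p a a" for a p
    using assms that unfolding DA_def by blast+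
  ultimately have "path_integral (\<lambda>z\<in>lverts \<Lambda>. c * f z + d * g z) p = 0"
    if "lpath \<Lambda> p a a" for a p
    using that by simp
  then show ?thesis
    unfolding DA_def by blast
qed

lemma DA_vec_combine:
  assumes "f \<in> DA_vec \<Lambda> m" "g \<in> DA_vec \<Lambda> m"
  shows "(\<lambda>z\<in>lverts \<Lambda>. c \<cdot>\<^sub>v f z + d \<cdot>\<^sub>v g z) \<in> DA_vec \<Lambda> m"
proof -
  have car: "f z \<in> carrier_vec m" "g z \<in> carrier_vec m" if "z \<in> lverts \<Lambda>" for z
    using assms that unfolding DA_vec_def PiE_def Pi_def by blast+
  have "(\<lambda>z\<in>lverts \<Lambda>. (\<lambda>z\<in>lverts \<Lambda>. c \<cdot>\<^sub>v f z + d \<cdot>\<^sub>v g z) z $ i) \<in> DA \<Lambda>" if "i < m" for i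
  proof -
    have "(\<lambda>z\<in>lverts \<Lambda>. (\<lambda>z\<in>lverts \<Lambda>. c \<cdot>\<^sub>v f z + d \<cdot>\<^sub>v g z) z $ i) =
          (\<lambda>z\<in>lverts \<Lambda>. c * (\<lambda>z\<in>lverts \<Lambda>. f z $ i) z + d * (\<lambda>z\<in>lverts \<Lambda>. g z $ i) z)"
    proof (rule restrict_ext)
      fix z assume z: "z \<in> lverts \<Lambda>"
      from car[OF z] that z
      show "(\<lambda>z\<in>lverts \<Lambda>. c \<cdot>\<^sub>v f z + d \<cdot>\<^sub>v g z) z $ i =
          c * (\<lambda>z\<in>lverts \<Lambda>. f z $ i) z + d * (\<lambda>z\<in>lverts \<Lambda>. g z $ i) z"
        by simp
    qed
    also have "\<dots> \<in> DA \<Lambda>"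
      using assms that unfolding DA_vec_def by (intro DA_combine) blast+
    finally show ?thesis .
  qed
  then show ?thesis
    using car unfolding DA_vec_def mem_Collect_eq restrict_PiE_iff
    by (intro conjI allI impI ballI add_carrier_vec smult_carrier_vec[THEN iffD2]) simp_all
qed

lemma DA_zero: "(\<lambda>z\<in>lverts \<Lambda>. 0) \<in> DA \<Lambda>"
proof -
  have "path_integral (\<lambda>z\<in>lverts \<Lambda>. 0) p = 0" if "lpath \<Lambda> p a a" for a p
  proof -
    have "path_integral (\<lambda>z\<in>lverts \<Lambda>. 0) p = path_integral (\<lambda>z. 0) p"
      by (rule path_integral_cong) (use that in \<open>unfold lpath_def, fastforce\<close>)
    then show ?thesis
      by (simp add: path_integral_def)
  qed
  then show ?thesis
    unfolding DA_def by blast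
qed

lemma DA_vec_zero: "(\<lambda>z\<in>lverts \<Lambda>. 0\<^sub>v m) \<in> DA_vec \<Lambda> m"
proof -
  have "(\<lambda>z\<in>lverts \<Lambda>. (\<lambda>z\<in>lverts \<Lambda>. 0\<^sub>v m) z $ i) = (\<lambda>z\<in>lverts \<Lambda>. 0 :: complex)" if "i < m" for i
    by (rule restrict_ext) (use that in auto)
  then have "(\<lambda>z\<in>lverts \<Lambda>. (\<lambda>z\<in>lverts \<Lambda>. 0\<^sub>v m) z $ i) \<in> DA \<Lambda>" if "i < m" for i
    using DA_zero[of \<Lambda>] that by metis
  then show ?thesis
    unfolding DA_vec_def mem_Collect_eq restrict_PiE_iff by simp
qed

lemma vectorspace_DA_vec_space: "vectorspace class_ring (DA_vec_space \<Lambda> m)"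
proof -
  let ?V = "DA_vec_space \<Lambda> m"
  let ?L = "lverts \<Lambda>"
  note V_simps = DA_vec_space_def partial_object.simps monoid.simps ring.simps module.simps
  have car: "f z \<in> carrier_vec m" if "f \<in> DA_vec \<Lambda> m" "z \<in> ?L" for f z
    using that unfolding DA_vec_def PiE_def Pi_def by blast
  have eq: "restrict f ?L = g" if "g \<in> DA_vec \<Lambda> m" "\<And>z. z \<in> ?L \<Longrightarrow> f z = g z" for f g
  proof (rule extensionalityI)
    show "g \<in> extensional ?L"
      using that(1) by (simp add: DA_vec_def PiE_def)
  qed (use that(2) in simp_all)
  have add: "(\<lambda>z\<in>?L. f z + g z) \<in> DA_vec \<Lambda> m" if "f \<in> DA_vec \<Lambda> m" "g \<in> DA_vec \<Lambda> m" for f g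
    using DA_vec_combine[OF that, of 1 1] by simp
  have smult: "(\<lambda>z\<in>?L. c \<cdot>\<^sub>v f z) \<in> DA_vec \<Lambda> m" if f: "f \<in> DA_vec \<Lambda> m" for c f
  proof -
    have "(\<lambda>z\<in>?L. c \<cdot>\<^sub>v f z + 0 \<cdot>\<^sub>v f z) = (\<lambda>z\<in>?L. c \<cdot>\<^sub>v f z)"
    proof (rule restrict_ext)
      fix z assume "z \<in> ?L"
      from car[OF f this] show "c \<cdot>\<^sub>v f z + 0 \<cdot>\<^sub>v f z = c \<cdot>\<^sub>v f z" by auto
    qed
    with DA_vec_combine[OF f f, of c 0] show ?thesis by simp
  qed
  have ag: "abelian_group ?V"
  proof (rule abelian_groupI, unfold V_simps)
    fix f assume f: "f \<in> DA_vec \<Lambda> m"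
    show "(\<lambda>z\<in>?L. (\<lambda>z\<in>?L. 0\<^sub>v m) z + f z) = f"
    proof (rule eq[OF f])
      fix z assume z: "z \<in> ?L"
      from car[OF f z] z show "(\<lambda>z\<in>?L. 0\<^sub>v m) z + f z = f z" by simp
    qed
    have "(\<lambda>z\<in>?L. (\<lambda>z\<in>?L. - 1 \<cdot>\<^sub>v f z) z + f z) = (\<lambda>z\<in>?L. 0\<^sub>v m)"
    proof (rule restrict_ext)
      fix z assume z: "z \<in> ?L"
      from car[OF f z] z show "(\<lambda>z\<in>?L. - 1 \<cdot>\<^sub>v f z) z + f z = 0\<^sub>v m"
        by (intro eq_vecI) simp_all
    qed
    then show "\<exists>g\<in>DA_vec \<Lambda> m. (\<lambda>z\<in>?L. g z + f z) = (\<lambda>z\<in>?L. 0\<^sub>v m)"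
      by (rule bexI[of _ "\<lambda>z\<in>?L. - 1 \<cdot>\<^sub>v f z"]) (rule smult[OF f])
  next
    fix f g h
    assume f: "f \<in> DA_vec \<Lambda> m" and g: "g \<in> DA_vec \<Lambda> m" and h: "h \<in> DA_vec \<Lambda> m"
    show "(\<lambda>z\<in>?L. (\<lambda>z\<in>?L. f z + g z) z + h z) = (\<lambda>z\<in>?L. f z + (\<lambda>z\<in>?L. g z + h z) z)"
    proof (rule restrict_ext)
      fix z assume z: "z \<in> ?L"
      from assoc_add_vec[OF car[OF f z] car[OF g z] car[OF h z]] z
      show "(\<lambda>z\<in>?L. f z + g z) z + h z = f z + (\<lambda>z\<in>?L. g z + h z) z" by simp
    qed
  next
    fix f g assume f: "f \<in> DA_vec \<Lambda> m" and g: "g \<in> DA_vec \<Lambda> m"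
    show "(\<lambda>z\<in>?L. f z + g z) = (\<lambda>z\<in>?L. g z + f z)"
      by (rule restrict_ext) (rule comm_add_vec[OF car[OF f] car[OF g]])
    show "(\<lambda>z\<in>?L. f z + g z) \<in> DA_vec \<Lambda> m"
      by (rule add[OF f g])
  qed (rule DA_vec_zero)
  have cr: "cring (class_ring :: complex ring)"
    using class_field[where ?'a = complex] by (simp add: class_field_def field_def domain_def)
  have "module class_ring ?V"
  proof (rule Module.moduleI[OF cr ag], unfold V_simps)
    fix c f assume f: "f \<in> DA_vec \<Lambda> m"
    show "(\<lambda>z\<in>?L. c \<cdot>\<^sub>v f z) \<in> DA_vec \<Lambda> m"
      by (rule smult[OF f])
    show "(\<lambda>z\<in>?L. 1 \<cdot>\<^sub>v f z) = f"
      by (rule eq[OF f]) simp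
    fix d
    show "(\<lambda>z\<in>?L. (c + d) \<cdot>\<^sub>v f z) = (\<lambda>z\<in>?L. (\<lambda>z\<in>?L. c \<cdot>\<^sub>v f z) z + (\<lambda>z\<in>?L. d \<cdot>\<^sub>v f z) z)"
      by (rule restrict_ext) (simp add: add_smult_distrib_vec)
    show "(\<lambda>z\<in>?L. (c * d) \<cdot>\<^sub>v f z) = (\<lambda>z\<in>?L. c \<cdot>\<^sub>v (\<lambda>z\<in>?L. d \<cdot>\<^sub>v f z) z)"
      by (rule restrict_ext) (simp add: smult_smult_assoc)
  next
    fix c f g assume f: "f \<in> DA_vec \<Lambda> m" and g: "g \<in> DA_vec \<Lambda> m"
    show "(\<lambda>z\<in>?L. c \<cdot>\<^sub>v (\<lambda>z\<in>?L. f z + g z) z) = (\<lambda>z\<in>?L. (\<lambda>z\<in>?L. c \<cdot>\<^sub>v f z) z + (\<lambda>z\<in>?L. c \<cdot>\<^sub>v g z) z)"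
    proof (rule restrict_ext)
      fix z assume z: "z \<in> ?L"
      from smult_add_distrib_vec[OF car[OF f z] car[OF g z]] z
      show "c \<cdot>\<^sub>v (\<lambda>z\<in>?L. f z + g z) z = (\<lambda>z\<in>?L. c \<cdot>\<^sub>v f z) z + (\<lambda>z\<in>?L. c \<cdot>\<^sub>v g z) z"
        by simp
    qed
  qed
  then show ?thesis
    unfolding vectorspace_def using class_field[where ?'a = complex] by (simp add: class_field_def)
qed

definition finite_dim_subspace ::
    "complex set set \<Rightarrow> nat \<Rightarrow> (complex \<Rightarrow> complex vec) set \<Rightarrow> bool" where
  "finite_dim_subspace \<Lambda> m M \<longleftrightarrow>
     VectorSpace.subspace class_ring M (DA_vec_space \<Lambda> m) \<and>
     vectorspace.fin_dim class_ring (DA_vec_space \<Lambda> m\<lparr>carrier := M\<rparr>)"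

definition column_space ::
    "complex set set \<Rightarrow> nat \<Rightarrow> (complex \<Rightarrow> complex mat) \<Rightarrow> (complex \<Rightarrow> complex vec) set" where
  "column_space \<Lambda> n f = {\<lambda>z\<in>lverts \<Lambda>. f z *\<^sub>v w | w. w \<in> carrier_vec n}"

section \<open>Convolution product and rational functions\<close>

text \<open>A \<open>k \<times> l\<close>-matrix-valued discrete analytic polynomial \<open>\<Sum>n\<le>N. A\<^sub>n z\<^sup>(\<^sup>n\<^sup>)\<close> is represented by
  its coefficient list \<open>[A\<^sub>0, \<dots>, A\<^sub>N]\<close>, since the convolution products are defined by the
  coefficients.  The sizes \<open>k\<close>, \<open>l\<close> are passed explicitly, as matrices carry their
  dimensions and there is no dimension-free zero matrix to sum from.\<close>

definition conv_poly_left :: "complex set set \<Rightarrow> nat \<Rightarrow> nat \<Rightarrow>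
    complex mat list \<Rightarrow> (complex \<Rightarrow> complex mat) \<Rightarrow> complex \<Rightarrow> complex mat" where
  "conv_poly_left \<Lambda> k l p f =
     (\<lambda>z\<in>lverts \<Lambda>. mat k l
        (\<lambda>ij. \<Sum>n<length p. (p ! n * (Zplus_mat \<Lambda> ^^ n) f z) $$ ij))"

definition conv_poly_right :: "complex set set \<Rightarrow> nat \<Rightarrow> nat \<Rightarrow>
    (complex \<Rightarrow> complex mat) \<Rightarrow> complex mat list \<Rightarrow> complex \<Rightarrow> complex mat" where
  "conv_poly_right \<Lambda> k l g p =
     (\<lambda>z\<in>lverts \<Lambda>. mat k l
        (\<lambda>ij. \<Sum>n<length p. ((Zplus_mat \<Lambda> ^^ n) g z * p ! n) $$ ij))"

text \<open>The two-sided convolution inverse of \<open>I - z A\<close>, where \<open>I - z A\<close> is the polynomial with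
  coefficients \<open>I\<close> and \<open>- A\<close> because \<open>z\<^sup>(\<^sup>0\<^sup>) = 1\<close> and \<open>z\<^sup>(\<^sup>1\<^sup>) = z\<close>.\<close>

definition DA_resolvent ::
    "complex set set \<Rightarrow> nat \<Rightarrow> complex mat \<Rightarrow> complex \<Rightarrow> complex mat" where
  "DA_resolvent \<Lambda> l A = (THE g. g \<in> DA_mat \<Lambda> l l \<and>
     conv_poly_left \<Lambda> l l [1\<^sub>m l, - A] g = (\<lambda>z\<in>lverts \<Lambda>. 1\<^sub>m l) \<and>
     conv_poly_right \<Lambda> l l g [1\<^sub>m l, - A] = (\<lambda>z\<in>lverts \<Lambda>. 1\<^sub>m l))"

definition rational_DA ::
    "complex set set \<Rightarrow> nat \<Rightarrow> nat \<Rightarrow> (complex \<Rightarrow> complex mat) \<Rightarrow> bool" where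
  "rational_DA \<Lambda> m n f \<longleftrightarrow>
     (\<exists>l A B C D.
        A \<in> carrier_mat l l \<and> B \<in> carrier_mat l n \<and>
        C \<in> carrier_mat m l \<and> D \<in> carrier_mat m n \<and>
        S_set \<Lambda> \<inter> spectrum A = {} \<and>
        (\<forall>z\<in>lverts \<Lambda>. f z = D + C * Zplus_mat \<Lambda> (DA_resolvent \<Lambda> l A) z * B))"

end

theory Submission
  imports Defs
begin

text \<open>For an edge \<open>(a, b)\<close> put \<open>d = b - a\<close>.  The relation \<open>Z\<^sub>+ f = h - h 0\<close> is equivalent to
  \<open>h b - h a = f b * (d - 1) / 2 + f a * (d + 1) / 2\<close> on all edges (\<open>shift_eq\<close>), and a function \<open>f\<close> that
  satisfies these equations for some \<open>h\<close> is automatically discrete analytic.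

  Let the columns of the matrix function \<open>H\<close> be a basis of a \<open>Z\<^sub>-\<close>-invariant space, so that \<open>Z\<^sub>- H = H A\<close>
  for a matrix \<open>A\<close>.  The edge equation turns this into
  \<open>H b * (1 - (d - 1) / 2 * A) = H a * (1 + (d + 1) / 2 * A)\<close>.  A factor in this law is singular only if
  an eigenvalue of \<open>A\<close> lies in \<open>S(\<Lambda>)\<close>; as eigenvectors of \<open>A\<close> yield eigenfunctions of \<open>Z\<^sub>-\<close>, this
  is excluded.  The resolvent \<open>R\<close> of \<open>A\<close> is the solution of the same law with \<open>R 0 = 1\<close>.  Hence
  \<open>H = H 0 * R\<close>, and \<open>R = 1 + Z\<^sub>+ R * A\<close> makes a realization out of \<open>f = H W\<close>
  (\<open>invariant_space_imp_rational\<close>).  Conversely, a realization of \<open>f\<close> gives \<open>Z\<^sub>- f = C R B\<close> and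
  \<open>Z\<^sub>- (C R) = C R A\<close>, so the columns of \<open>f\<close> and \<open>C R\<close> span an invariant space
  (\<open>rational_imp_invariant_space\<close>).

  The work lies in the existence of \<open>R\<close> and of \<open>Z\<^sub>- h\<close> for every discrete analytic \<open>h\<close>.  Both
  are sought by transport along edges, which is consistent around every rhombus and has to be consistent
  around every closed path.  This is the monodromy theorem for the simply connected plane
  (\<open>global_section\<close>, \<open>edge_section\<close>): sections over small rectangles exist and can be glued along straight
  cuts.  For \<open>R\<close> the transport factors are invertible and commute with each other, which is consistency
  around a rhombus (\<open>resolvent_exists\<close>).

  For \<open>Z\<^sub>- h\<close> the transport degenerates on the edges with \<open>d = 1\<close> or \<open>d = - 1\<close>, where the equation prescribes
  \<open>f\<close> at the left end and says nothing about the right end.  These edges are the rungs of strips of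
  rhombi, and a transport across them can be invented, one strip at a time (\<open>orbit_recursion\<close>).  What
  remains is that the values prescribed at the rungs are compatible when two rungs are joined by a path
  without horizontal steps.  Such rungs belong to the same strip (\<open>same_strip\<close>): every strip meets every
  height, since congruent rhombi cannot become arbitrarily flat, and the number of strips to the left of a point does not
  decrease when the point moves to the right (\<open>shift_eq_solvable\<close>).\<close>

section \<open>Unit rhombi\<close>

definition rh :: "complex \<Rightarrow> complex \<Rightarrow> complex \<Rightarrow> complex set" where
  "rh q u v = convex hull {q, q + u, q + u + v, q + v}"

definition nondeg :: "complex \<Rightarrow> complex \<Rightarrow> bool" where
  "nondeg u v \<longleftrightarrow> norm u = 1 \<and> norm v = 1 \<and> u \<noteq> v \<and> u \<noteq> - v"

text \<open>The oriented area of the parallelogram spanned by two vectors; its sign tells on which side of \<open>u\<close>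
  the vector \<open>v\<close> lies.\<close>

definition cross :: "complex \<Rightarrow> complex \<Rightarrow> real" where
  "cross u v = Im (cnj u * v)"

lemma cross_simps [simp]:
  "cross u (v + w) = cross u v + cross u w" "cross u (v - w) = cross u v - cross u w"
  "cross u u = 0" "cross u (of_real s * v) = s * cross u v" "cross u (- v) = - cross u v"
  "cross (- u) v = - cross u v" "cross u 0 = 0" "cross 1 v = Im v"
  by (simp_all add: cross_def algebra_simps)

lemma cross_commute: "cross v u = - cross u v"
  by (simp add: cross_def algebra_simps)

lemma cross_inner: "cross u x = inner (\<i> * u) x"
  by (simp add: cross_def inner_complex_def algebra_simps)

lemma nondeg_cross: assumes "nondeg u v" shows "cross u v \<noteq> 0"
proof
  assume "cross u v = 0"
  then have r: "cnj u * v = of_real (Re (cnj u * v))"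
    by (simp add: complex_eq_iff cross_def)
  have n: "norm (cnj u * v) = 1" using assms by (simp add: nondeg_def norm_mult)
  obtain w where w: "cnj u * v = of_real w" using r by blast
  have "abs w = 1" using n unfolding w by simp
  then have "w = 1 \<or> w = -1" by linarith
  then have "cnj u * v = 1 \<or> cnj u * v = -1"
    unfolding w by auto
  then have "u * (cnj u * v) = u \<or> u * (cnj u * v) = - u" by auto
  moreover have "u * cnj u = 1" using assms by (simp add: nondeg_def complex_norm_square[symmetric])
  ultimately have "v = u \<or> v = - u"
    by (metis mult.assoc mult_1)
  with assms show False by (auto simp: nondeg_def)
qed

lemma nondeg_minus: "nondeg u v \<Longrightarrow> nondeg (- u) v" "nondeg u v \<Longrightarrow> nondeg u (- v)"
  and nondeg_sym: "nondeg u v \<Longrightarrow> nondeg v u"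
  by (auto simp: nondeg_def minus_equation_iff)

lemma unit_rhombus_rh: "unit_rhombus T \<longleftrightarrow> (\<exists>q u v. nondeg u v \<and> T = rh q u v)"
  unfolding unit_rhombus_def rh_def nondeg_def by blast

text \<open>A rhombus determines neither its base corner nor the order of its directions.  These identities allow
  any corner and any side to play the part of the first one.\<close>

lemma rh_swap: "rh q u v = rh q v u"
  unfolding rh_def by (rule arg_cong[of _ _ "(hull) convex"]) (auto simp: add_ac)

lemma rh_corners:
  "rh q u v = rh (q + u) (- u) v" "rh q u v = rh (q + v) u (- v)" "rh q u v = rh (q + u + v) (- u) (- v)"
proof -
  have "{q, q + u, q + u + v, q + v} = {q + u, q + u + - u, q + u + - u + v, q + u + v}"
    "{q, q + u, q + u + v, q + v} = {q + v, q + v + u, q + v + u + - v, q + v + - v}"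
    "{q, q + u, q + u + v, q + v} = {q + u + v, q + u + v + - u, q + u + v + - u + - v, q + u + v + - v}"
    by auto
  then show "rh q u v = rh (q + u) (- u) v" "rh q u v = rh (q + v) u (- v)" "rh q u v = rh (q + u + v) (- u) (- v)"
    unfolding rh_def by simp_all
qed

lemma rh_param: "rh q u v = {q + of_real s * u + of_real t * v | s t. s \<in> {0..1} \<and> t \<in> {0..1}}"
  (is "_ = ?R")
proof (rule antisym)
  have "convex ?R"
  proof (rule convexI)
    fix x y :: complex and a b :: real
    assume x: "x \<in> ?R" and y: "y \<in> ?R" and ab: "0 \<le> a" "0 \<le> b" "a + b = 1"
    from x obtain s t where st: "x = q + of_real s * u + of_real t * v" "s \<in> {0..1}" "t \<in> {0..1}"
      by blast
    from y obtain s' t' where st': "y = q + of_real s' * u + of_real t' * v" "s' \<in> {0..1}" "t' \<in> {0..1}"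
      by blast
    have b: "b = 1 - a" using ab by simp
    have "a *\<^sub>R x + b *\<^sub>R y = q + of_real (a * s + b * s') * u + of_real (a * t + b * t') * v"
      unfolding st(1) st'(1) b by (simp add: scaleR_conv_of_real algebra_simps)
    moreover have "a * s + b * s' \<in> {0..1}" "a * t + b * t' \<in> {0..1}"
      using convexD[OF convex_real_interval(5)[of 0 1] st(2) st'(2) ab]
        convexD[OF convex_real_interval(5)[of 0 1] st(3) st'(3) ab] by simp_all
    ultimately show "a *\<^sub>R x + b *\<^sub>R y \<in> ?R" by blast
  qed
  moreover have "{q, q + u, q + u + v, q + v} \<subseteq> ?R"
  proof -
    have "q + of_real s * u + of_real t * v \<in> ?R" if "s \<in> {0..1}" "t \<in> {0..1}" for s t
      using that by blast
    from this[of 0 0] this[of 1 0] this[of 1 1] this[of 0 1] show ?thesis by simp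
  qed
  ultimately show "rh q u v \<subseteq> ?R"
    unfolding rh_def by (rule hull_minimal[rotated])
next
  show "?R \<subseteq> rh q u v"
  proof
    fix x assume "x \<in> ?R"
    then obtain s t where st: "x = q + of_real s * u + of_real t * v" "0 \<le> s" "s \<le> 1" "0 \<le> t" "t \<le> 1"
      by auto
    have c: "convex (rh q u v)" by (simp add: rh_def)
    have m: "q \<in> rh q u v" "q + u \<in> rh q u v" "q + u + v \<in> rh q u v" "q + v \<in> rh q u v"
      unfolding rh_def by (simp_all add: hull_inc)
    have 1: "(1 - s) *\<^sub>R q + s *\<^sub>R (q + u) \<in> rh q u v"
      by (rule convexD_alt[OF c m(1,2)]) (use st in auto)
    have 2: "(1 - s) *\<^sub>R (q + v) + s *\<^sub>R (q + u + v) \<in> rh q u v"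
      by (rule convexD_alt[OF c m(4,3)]) (use st in auto)
    have "(1 - t) *\<^sub>R ((1 - s) *\<^sub>R q + s *\<^sub>R (q + u)) + t *\<^sub>R ((1 - s) *\<^sub>R (q + v) + s *\<^sub>R (q + u + v)) \<in> rh q u v"
      by (rule convexD_alt[OF c 1 2]) (use st in auto)
    also have "(1 - t) *\<^sub>R ((1 - s) *\<^sub>R q + s *\<^sub>R (q + u)) + t *\<^sub>R ((1 - s) *\<^sub>R (q + v) + s *\<^sub>R (q + u + v)) = x"
      unfolding st by (simp add: scaleR_conv_of_real algebra_simps)
    finally show "x \<in> rh q u v" .
  qed
qed

lemma rh_memI: "0 \<le> s \<Longrightarrow> s \<le> 1 \<Longrightarrow> 0 \<le> t \<Longrightarrow> t \<le> 1 \<Longrightarrow> q + of_real s * u + of_real t * v \<in> rh q u v"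
  unfolding rh_param by auto

lemma rh_memE:
  assumes "x \<in> rh q u v"
  obtains s t where "x = q + of_real s * u + of_real t * v" "0 \<le> s" "s \<le> 1" "0 \<le> t" "t \<le> 1"
  using assms unfolding rh_param by auto

lemma convex_rh: "convex (rh q u v)" and compact_rh: "compact (rh q u v)"
  by (simp_all add: rh_def finite_imp_compact_convex_hull)

lemma cross_coords:
  assumes "cross u v \<noteq> 0"
  shows "x = q + of_real (cross (x - q) v / cross u v) * u + of_real (cross u (x - q) / cross u v) * v"
proof -
  have "of_real (cross u v) * (x - q) = of_real (cross (x - q) v) * u + of_real (cross u (x - q)) * v"
    by (simp add: complex_eq_iff cross_def algebra_simps)
  then have "x - q = (of_real (cross (x - q) v) * u + of_real (cross u (x - q)) * v) / of_real (cross u v)"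
    using assms by (simp add: eq_divide_eq mult.commute)
  then have "x = q + (of_real (cross (x - q) v) * u + of_real (cross u (x - q)) * v) / of_real (cross u v)"
    by (simp only: diff_eq_eq add.commute)
  then show ?thesis by (simp only: add_divide_distrib of_real_divide times_divide_eq_left add.assoc)
qed

lemma rh_interior:
  assumes "nondeg u v" "0 < s" "s < 1" "0 < t" "t < 1"
  shows "q + of_real s * u + of_real t * v \<in> interior (rh q u v)"
proof -
  let ?c = "cross u v"
  have c: "?c \<noteq> 0" by (rule nondeg_cross[OF assms(1)])
  let ?U = "{x. 0 < cross (x - q) v / ?c \<and> cross (x - q) v / ?c < 1 \<and> 0 < cross u (x - q) / ?c \<and> cross u (x - q) / ?c < 1}"
  have cont: "continuous_on UNIV (\<lambda>x. cross (x - q) v / ?c)" "continuous_on UNIV (\<lambda>x. cross u (x - q) / ?c)"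
    unfolding cross_def divide_inverse by (intro continuous_intros)+
  have oU: "open ?U"
    by (intro open_Collect_conj open_Collect_less cont continuous_on_const)
  have sU: "?U \<subseteq> rh q u v"
  proof
    fix x assume "x \<in> ?U"
    then show "x \<in> rh q u v"
      using rh_memI[of "cross (x - q) v / ?c" "cross u (x - q) / ?c" q u v] cross_coords[OF c, of x q]
      by simp
  qed
  have mU: "q + of_real s * u + of_real t * v \<in> ?U"
  proof -
    have "cross (of_real s * u + of_real t * v) v = s * ?c" "cross u (of_real s * u + of_real t * v) = t * ?c"
      by (simp_all add: cross_def algebra_simps)
    then show ?thesis using assms c by (simp add: add.assoc)
  qed
  show ?thesis by (rule interiorI[OF oU mU sU])
qed

abbreviation verts :: "complex set \<Rightarrow> complex set" where
  "verts T \<equiv> {v. v extreme_point_of T}"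

lemma rh_edge:
  assumes "nondeg u v"
  shows "closed_segment q (q + u) edge_of rh q u v"
proof -
  let ?c = "cross u v"
  have c: "?c \<noteq> 0" by (rule nondeg_cross[OF assms])
  have "rh q u v \<inter> {x. inner (\<i> * u) x = inner (\<i> * u) q} = closed_segment q (q + u)"
  proof (rule antisym)
    show "rh q u v \<inter> {x. inner (\<i> * u) x = inner (\<i> * u) q} \<subseteq> closed_segment q (q + u)"
    proof
      fix x assume x: "x \<in> rh q u v \<inter> {x. inner (\<i> * u) x = inner (\<i> * u) q}"
      then have "x \<in> rh q u v" by (rule IntD1)
      then obtain s t where st: "x = q + of_real s * u + of_real t * v" "0 \<le> s" "s \<le> 1" "0 \<le> t" "t \<le> 1"
        by (rule rh_memE)
      have "t * ?c = 0" using x unfolding cross_inner[symmetric] st(1) by simp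
      then have "x = (1 - s) *\<^sub>R q + s *\<^sub>R (q + u)" using c st(1) by (simp add: scaleR_conv_of_real algebra_simps)
      then show "x \<in> closed_segment q (q + u)" using st unfolding closed_segment_def by blast
    qed
    show "closed_segment q (q + u) \<subseteq> rh q u v \<inter> {x. inner (\<i> * u) x = inner (\<i> * u) q}"
    proof
      fix x assume "x \<in> closed_segment q (q + u)"
      then obtain s where s: "x = (1 - s) *\<^sub>R q + s *\<^sub>R (q + u)" "0 \<le> s" "s \<le> 1"
        unfolding closed_segment_def by auto
      have "x = q + of_real s * u + of_real 0 * v" using s by (simp add: scaleR_conv_of_real algebra_simps)
      then show "x \<in> rh q u v \<inter> {x. inner (\<i> * u) x = inner (\<i> * u) q}"
        using rh_memI[of s 0 q u v] s unfolding cross_inner[symmetric] by simp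
    qed
  qed
  moreover have "rh q u v \<inter> {x. inner (\<i> * u) x = inner (\<i> * u) q} face_of rh q u v"
  proof (cases "?c > 0")
    case True
    have "inner (\<i> * u) q \<le> inner (\<i> * u) x" if x: "x \<in> rh q u v" for x
    proof -
      obtain s t where st: "x = q + of_real s * u + of_real t * v" "0 \<le> t"
        using x by (rule rh_memE)
      show ?thesis using True st by (simp add: cross_inner[symmetric])
    qed
    then show ?thesis by (rule face_of_Int_supporting_hyperplane_ge[OF convex_rh])
  next
    case False
    have "inner (\<i> * u) x \<le> inner (\<i> * u) q" if x: "x \<in> rh q u v" for x
    proof -
      obtain s t where st: "x = q + of_real s * u + of_real t * v" "0 \<le> t"
        using x by (rule rh_memE)
      show ?thesis using False st by (simp add: cross_inner[symmetric] mult_nonneg_nonpos)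
    qed
    then show ?thesis by (rule face_of_Int_supporting_hyperplane_le[OF convex_rh])
  qed
  moreover have "aff_dim (closed_segment q (q + u)) = 1"
  proof -
    have "q \<noteq> q + u" using assms by (auto simp: nondeg_def)
    then show ?thesis by (simp add: segment_convex_hull aff_dim_convex_hull aff_dim_2)
  qed
  ultimately show ?thesis unfolding edge_of_def by simp
qed

lemma rh_vertex: assumes "nondeg u v" shows "q extreme_point_of rh q u v"
proof -
  have "closed_segment q (q + u) face_of rh q u v" using rh_edge[OF assms] by (simp add: edge_of_def)
  then have "q extreme_point_of closed_segment q (q + u) \<longleftrightarrow> q extreme_point_of rh q u v \<and> q \<in> closed_segment q (q + u)"
    by (rule extreme_point_of_face)
  moreover have "q extreme_point_of closed_segment q (q + u)"
    unfolding extreme_point_of_segment by (rule disjI1[OF refl])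
  ultimately show ?thesis by iprover
qed

lemma verts_rh: assumes "nondeg u v" shows "verts (rh q u v) = {q, q + u, q + u + v, q + v}"
proof (rule antisym)
  show "verts (rh q u v) \<subseteq> {q, q + u, q + u + v, q + v}"
    unfolding rh_def by (rule subsetI) (rule extreme_point_of_convex_hull, rule CollectD)
  have "q extreme_point_of rh q u v" by (rule rh_vertex[OF assms])
  moreover have "q + u extreme_point_of rh q u v"
    by (subst rh_corners(1)) (rule rh_vertex[OF nondeg_minus(1)[OF assms]])
  moreover have "q + v extreme_point_of rh q u v"
    by (subst rh_corners(2)) (rule rh_vertex[OF nondeg_minus(2)[OF assms]])
  moreover have "q + u + v extreme_point_of rh q u v"
    by (subst rh_corners(3)) (rule rh_vertex[OF nondeg_minus(1)[OF nondeg_minus(2)[OF assms]]])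
  ultimately show "{q, q + u, q + u + v, q + v} \<subseteq> verts (rh q u v)" by simp
qed

lemma rh_rebase:
  assumes "nondeg u v" "a \<in> verts (rh q u v)"
  obtains u' v' where "nondeg u' v'" "rh q u v = rh a u' v'"
proof -
  have "a = q \<or> a = q + u \<or> a = q + u + v \<or> a = q + v" using assms by (simp add: verts_rh)
  then show thesis
  proof (elim disjE)
    assume "a = q" then show thesis using that assms by blast
  next
    assume "a = q + u" then show thesis using that nondeg_minus(1)[OF assms(1)] rh_corners(1)[of q u v] by blast
  next
    assume "a = q + v" then show thesis using that nondeg_minus(2)[OF assms(1)] rh_corners(2)[of q u v] by blast
  next
    assume "a = q + u + v"
    then show thesis
      using that nondeg_minus(1)[OF nondeg_minus(2)[OF assms(1)]] rh_corners(3)[of q u v] by blast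
  qed
qed

definition side :: "complex set \<Rightarrow> complex \<Rightarrow> complex \<Rightarrow> bool" where
  "side T a b \<longleftrightarrow> (\<exists>v. nondeg (b - a) v \<and> T = rh a (b - a) v)"

lemma midpoint_interior:
  assumes "nondeg u v" shows "midpoint q (q + u + v) \<in> interior (rh q u v)"
proof -
  have "midpoint q (q + u + v) = q + of_real (1/2) * u + of_real (1/2) * v"
    by (simp add: midpoint_def scaleR_conv_of_real field_simps)
  then show ?thesis using rh_interior[OF assms, of "1/2" "1/2" q] by simp
qed

text \<open>Two distinct corners are adjacent or opposite, and the midpoint of opposite corners is the centre.
  The distance cannot separate the two cases, because the short diagonal of a rhombus with an angle of 60 degrees
  has length 1.\<close>

lemma verts_cases:
  assumes "nondeg u v" "a \<in> verts (rh q u v)" "b \<in> verts (rh q u v)"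
  shows "a = b \<or> side (rh q u v) a b \<or> midpoint a b \<in> interior (rh q u v)"
proof -
  obtain u' v' where n: "nondeg u' v'" and T: "rh q u v = rh a u' v'"
    using rh_rebase[OF assms(1,2)] .
  have "b = a \<or> b = a + u' \<or> b = a + u' + v' \<or> b = a + v'"
    using assms(3) unfolding T verts_rh[OF n] by simp
  then show ?thesis
  proof (elim disjE)
    assume "b = a + u'" then show ?thesis using n T unfolding side_def by auto
  next
    assume "b = a + v'" then show ?thesis using nondeg_sym[OF n] T unfolding side_def by (auto simp: rh_swap[of a u'])
  next
    assume "b = a + u' + v'" then show ?thesis using midpoint_interior[OF n] T by simp
  qed simp
qed

lemma side_edge: assumes "side T a b" shows "closed_segment a b edge_of T"
  using assms rh_edge[of "b - a" _ a] unfolding side_def by auto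

lemma side_not_interior:
  assumes "side T a b" "x \<in> closed_segment a b" shows "x \<notin> interior T"
proof -
  obtain v where v: "nondeg (b - a) v" "T = rh a (b - a) v" using assms by (auto simp: side_def)
  have f: "closed_segment a b face_of T" using side_edge[OF assms(1)] by (simp add: edge_of_def)
  have "a + v extreme_point_of T" using verts_rh[OF v(1), of a] v(2) by blast
  moreover have "\<not> a + v extreme_point_of closed_segment a b"
    using v(1) by (auto simp: extreme_point_of_segment nondeg_def)
  ultimately have "closed_segment a b \<noteq> T" by auto
  then show ?thesis using face_of_disjoint_interior[OF f] assms(2) by blast
qed

lemma side_sym: assumes "side T a b" shows "side T b a"
proof -
  obtain v where v: "nondeg (b - a) v" "T = rh a (b - a) v" using assms by (auto simp: side_def)
  then show ?thesis using nondeg_minus(1)[OF v(1)] rh_corners(1)[of a "b - a" v] unfolding side_def by auto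
qed

lemma side_verts: assumes "side T a b" shows "a \<in> verts T" "b \<in> verts T" "a \<noteq> b" "norm (b - a) = 1"
  using assms verts_rh[of "b - a" _ a] unfolding side_def nondeg_def by (force simp: nondeg_def)+

lemma side_cases:
  assumes "nondeg u v" "side (rh q u v) a b"
  shows "(a, b) \<in> {(q, q+u), (q+u, q), (q, q+v), (q+v, q), (q+u, q+u+v), (q+u+v, q+u), (q+v, q+u+v), (q+u+v, q+v)}"
proof -
  note sv = side_verts[OF assms(2)]
  have m: "midpoint a b \<notin> interior (rh q u v)" using side_not_interior[OF assms(2)] by simp
  have 1: "midpoint q (q+u+v) \<in> interior (rh q u v)" by (rule midpoint_interior[OF assms(1)])
  have "midpoint (q + u) (q + v) = midpoint q (q+u+v)" by (simp add: midpoint_def add_ac)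
  with 1 have 2: "midpoint (q + u) (q + v) \<in> interior (rh q u v)" by simp
  show ?thesis using sv(1-3) m 1 2 midpoint_sym[of a b] unfolding verts_rh[OF assms(1)] by auto
qed

lemma rh_sides:
  assumes "nondeg u v"
  shows "side (rh q u v) q (q + u)" "side (rh q u v) q (q + v)"
    "side (rh q u v) (q + u) (q + u + v)" "side (rh q u v) (q + v) (q + u + v)"
proof -
  have 1: "side (rh q u v) q (q + u)" if "nondeg u v" for q u v using that by (auto simp: side_def)
  show "side (rh q u v) q (q + u)" by (rule 1[OF assms])
  show 2: "side (rh q u v) q (q + v)" using 1[OF nondeg_sym[OF assms], of q] by (simp add: rh_swap[of q v u])
  show "side (rh q u v) (q + u) (q + u + v)"
    using 1[OF nondeg_sym[OF nondeg_minus(1)[OF assms]], of "q + u"] rh_corners(1)[of q u v] rh_swap[of "q + u" "- u" v]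
    by simp
  have "side (rh q u v) (q + v) (q + v + u)"
    using 1[OF nondeg_minus(2)[OF assms], of "q + v"] rh_corners(2)[of q u v] by simp
  then show "side (rh q u v) (q + v) (q + u + v)" by (simp add: add_ac)
qed

section \<open>Rhombic tessellations\<close>

locale rhombic_tiling =
  fixes \<Lambda> :: "complex set set"
  assumes tessellation: "rhombic_tessellation \<Lambda>"
begin

abbreviation vertex_set (\<open>\<V>\<close>) where "\<V> \<equiv> lverts \<Lambda>"

abbreviation edge_set (\<open>\<E>\<close>) where "\<E> \<equiv> ledges \<Lambda>"

lemma
  shows tile_unit_rhombus: "T \<in> \<Lambda> \<Longrightarrow> unit_rhombus T"
    and tiles_union: "\<Union>\<Lambda> = UNIV"
    and tiles_disjoint: "S \<in> \<Lambda> \<Longrightarrow> T \<in> \<Lambda> \<Longrightarrow> S \<noteq> T \<Longrightarrow> interior S \<inter> interior T = {}"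
    and tiles_congruent: "S \<in> \<Lambda> \<Longrightarrow> T \<in> \<Lambda> \<Longrightarrow> congruent_tiles S T"
    and tile_face: "S \<in> \<Lambda> \<Longrightarrow> T \<in> \<Lambda> \<Longrightarrow> S \<inter> T face_of S" "S \<in> \<Lambda> \<Longrightarrow> T \<in> \<Lambda> \<Longrightarrow> S \<inter> T face_of T"
  using tessellation by (simp_all add: rhombic_tessellation_def)

lemma tileE:
  assumes "T \<in> \<Lambda>"
  obtains q u v where "nondeg u v" "T = rh q u v"
  using tile_unit_rhombus[OF assms] unfolding unit_rhombus_rh by iprover

lemma tile_cover: obtains T where "T \<in> \<Lambda>" "x \<in> T"
  using tiles_union by (metis UNIV_I UnionE)

lemma tile_compact: "T \<in> \<Lambda> \<Longrightarrow> compact T" and tile_convex: "T \<in> \<Lambda> \<Longrightarrow> convex T"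
  by (auto elim!: tileE simp: compact_rh convex_rh)

text \<open>Otherwise \<open>S \<inter> T\<close> is a face of \<open>S\<close> through an interior point, hence all of \<open>S\<close>; then \<open>S\<close> is contained in
  \<open>T\<close> and the interiors overlap.\<close>

lemma tile_eqI:
  assumes "S \<in> \<Lambda>" "T \<in> \<Lambda>" "x \<in> interior S" "x \<in> T"
  shows "S = T"
proof (rule ccontr)
  assume ne: "S \<noteq> T"
  have "x \<in> S \<inter> T \<inter> interior S" using assms interior_subset by auto
  then have "S \<inter> T = S"
    using face_of_disjoint_interior[OF tile_face(1)[OF assms(1,2)]] by blast
  then have "interior S \<subseteq> interior T" by (metis inf.orderI interior_mono inf_commute)
  moreover have "interior S \<inter> interior T = {}"
    using tiles_disjoint ne assms by blast
  ultimately show False using assms by blast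
qed

text \<open>If \<open>a\<close> and \<open>b\<close> were opposite corners of \<open>S\<close>, then the convex tile \<open>T\<close> would contain the centre of \<open>S\<close>.\<close>

lemma common_verts:
  assumes "S \<in> \<Lambda>" "T \<in> \<Lambda>" "S \<noteq> T" "a \<in> verts S" "b \<in> verts S" "a \<in> T" "b \<in> T" "a \<noteq> b"
  shows "side S a b"
proof -
  have "midpoint a b \<in> T"
    using convexD[OF tile_convex[OF assms(2)] assms(6,7), of "1/2" "1/2"]
    by (simp add: midpoint_def scaleR_right_distrib)
  then have "midpoint a b \<notin> interior S" using tile_eqI assms by blast
  then show ?thesis using assms by (metis tileE verts_cases)
qed

lemma lverts_in_tile:
  assumes "v \<in> \<V>" "T \<in> \<Lambda>" "v \<in> T"
  shows "v \<in> verts T"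
proof -
  obtain S where S: "S \<in> \<Lambda>" "v extreme_point_of S" using assms by (auto simp: lverts_def)
  then have "v \<in> S \<inter> T" using assms by (auto simp: extreme_point_of_def)
  then show ?thesis
    using extreme_point_of_face[OF tile_face(1)[OF S(1) assms(2)]]
      extreme_point_of_face[OF tile_face(2)[OF S(1) assms(2)]] S by auto
qed

lemma verts_lverts: "T \<in> \<Lambda> \<Longrightarrow> v \<in> verts T \<Longrightarrow> v \<in> \<V>"
  by (auto simp: lverts_def)

lemma verts_subset: "v \<in> verts T \<Longrightarrow> v \<in> T"
  by (auto simp: extreme_point_of_def)

text \<open>A segment that is a face of a tile joins two corners.  If these were opposite, the face would contain the
  centre and be the whole tile, which has more than two corners.\<close>

lemma ledges_side: "(a, b) \<in> \<E> \<longleftrightarrow> (\<exists>T\<in>\<Lambda>. side T a b)"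
proof
  assume "(a, b) \<in> \<E>"
  then obtain T where T: "T \<in> \<Lambda>" "closed_segment a b edge_of T" by (auto simp: ledges_def)
  then have f: "closed_segment a b face_of T" and d: "aff_dim (closed_segment a b) = 1"
    by (auto simp: edge_of_def)
  have ab: "a \<noteq> b" using d by auto
  obtain q u v where n: "nondeg u v" "T = rh q u v" using T by (elim tileE)
  have v: "a \<in> verts T" "b \<in> verts T"
    using extreme_point_of_face[OF f] by (auto simp: extreme_point_of_segment)
  have "midpoint a b \<notin> interior T"
  proof
    assume "midpoint a b \<in> interior T"
    then have "closed_segment a b = T"
      using face_of_disjoint_interior[OF f] by (metis disjoint_iff midpoint_in_closed_segment)
    moreover have "verts (closed_segment a b) = {a, b}" by (auto simp: extreme_point_of_segment)
    ultimately have "verts T = {a, b}" by simp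
    then have "card {q, q + u, q + u + v, q + v} \<le> 2" unfolding n(2) verts_rh[OF n(1)] by (simp add: card_insert_if)
    moreover have "q \<noteq> q + u" "q \<noteq> q + v" "q + u \<noteq> q + v" using n(1) by (auto simp: nondeg_def)
    then have "card {q, q + u, q + v} = 3" by simp
    then have "3 \<le> card {q, q + u, q + u + v, q + v}" using card_mono[of "{q, q + u, q + u + v, q + v}" "{q, q + u, q + v}"] by auto
    ultimately show False by simp
  qed
  then show "\<exists>T\<in>\<Lambda>. side T a b" using verts_cases[OF n(1)] v ab T(1) n(2) by blast
next
  assume "\<exists>T\<in>\<Lambda>. side T a b"
  then show "(a, b) \<in> \<E>" using side_edge by (auto simp: ledges_def)
qed

lemma ledges_sym: "(a, b) \<in> \<E> \<Longrightarrow> (b, a) \<in> \<E>"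
  using side_sym by (auto simp: ledges_side)

lemma ledges_lverts: "(a, b) \<in> \<E> \<Longrightarrow> a \<in> \<V> \<and> b \<in> \<V>"
  by (auto simp: ledges_side lverts_def dest: side_verts)

lemma ledges_norm: "(a, b) \<in> \<E> \<Longrightarrow> norm (b - a) = 1"
  by (auto simp: ledges_side dest: side_verts)

lemma tile_edges:
  assumes "nondeg u v" "rh q u v \<in> \<Lambda>"
  shows "(q, q + u) \<in> \<E>" "(q, q + v) \<in> \<E>"
    "(q + u, q + u + v) \<in> \<E>" "(q + v, q + u + v) \<in> \<E>"
  unfolding ledges_side using rh_sides[OF assms(1), of q] assms(2) by metis+

text \<open>An isometry of the plane is surjective and so maps balls onto balls.  Congruence therefore carries a
  ball inside one tile into every other tile.\<close>

lemma inradius: obtains r where "r > 0" "\<And>T. T \<in> \<Lambda> \<Longrightarrow> \<exists>c. ball c r \<subseteq> T"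
proof -
  obtain T0 where T0: "T0 \<in> \<Lambda>" "0 \<in> T0" by (rule tile_cover)
  obtain q u v where n: "nondeg u v" "T0 = rh q u v" using T0 by (elim tileE)
  from midpoint_interior[OF n(1), of q] obtain r where r: "r > 0" "ball (midpoint q (q + u + v)) r \<subseteq> T0"
    unfolding n(2)[symmetric] mem_interior by blast
  define c where "c = midpoint q (q + u + v)"
  have "\<exists>c. ball c r \<subseteq> T" if T: "T \<in> \<Lambda>" for T
  proof -
    have "congruent_tiles T0 T" using tiles_congruent T T0 by blast
    then obtain h :: "complex \<Rightarrow> complex" where h: "\<And>x y. dist (h x) (h y) = dist x y" "h ` T0 = T"
      by (auto simp: congruent_tiles_def)
    define g where "g = (\<lambda>x. h (x + c) - h c)"
    have "dist (g x) (g y) = dist x y" for x y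
      using h(1)[of "x + c" "y + c"] by (simp add: g_def dist_norm)
    then have "orthogonal_transformation g"
      unfolding orthogonal_transformation_isometry by (simp add: g_def)
    then have s: "surj g" by (rule orthogonal_transformation_surj)
    have "ball (h c) r \<subseteq> T"
    proof
      fix y assume y: "y \<in> ball (h c) r"
      obtain x where x: "g x = y - h c" using s by (metis surjD)
      then have hx: "h (x + c) = y" by (simp add: g_def)
      have "dist c (x + c) < r" using y h(1)[of c "x + c"] hx by simp
      then have "x + c \<in> T0" using r(2) by (auto simp: c_def)
      then show "y \<in> T" using hx h(2) by blast
    qed
    then show ?thesis by blast
  qed
  then show thesis using that r(1) by blast
qed

lemma tile_diameter: assumes "T \<in> \<Lambda>" "x \<in> T" "y \<in> T" shows "dist x y \<le> 4"
proof -
  have *: "norm (x - q) \<le> 2" if n: "nondeg u v" and m: "x \<in> rh q u v" for x q u v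
  proof -
    obtain s t where st: "x = q + of_real s * u + of_real t * v" "0 \<le> s" "s \<le> 1" "0 \<le> t" "t \<le> 1"
      using m by (rule rh_memE)
    have "norm (x - q) \<le> norm (of_real s * u) + norm (of_real t * v)"
      unfolding st(1) using norm_triangle_ineq by (simp add: add.assoc)
    also have "\<dots> = s + t" using n st by (simp add: nondeg_def norm_mult)
    finally show ?thesis using st by simp
  qed
  obtain q u v where n: "nondeg u v" "T = rh q u v" using assms(1) by (elim tileE)
  show ?thesis using *[OF n(1), of x q] *[OF n(1), of y q] assms n(2) dist_triangle2[of x y q] by (simp add: dist_norm)
qed

text \<open>The centres of the balls of \<open>inradius\<close> have mutual distance at least \<open>r\<close>, since a centre closer
  than that to another one is interior to the other tile.\<close>

lemma tiles_locally_finite: "finite {T \<in> \<Lambda>. T \<inter> cball x R \<noteq> {}}" (is "finite ?F")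
proof (rule ccontr)
  assume inf: "infinite ?F"
  obtain r where r: "r > 0" "\<And>T. T \<in> \<Lambda> \<Longrightarrow> \<exists>c. ball c r \<subseteq> T" using inradius by blast
  then obtain c where c: "\<And>T. T \<in> \<Lambda> \<Longrightarrow> ball (c T) r \<subseteq> T" by metis
  have close: "S = T" if "S \<in> \<Lambda>" "T \<in> \<Lambda>" "dist (c S) (c T) < r" for S T
  proof -
    have "c T \<in> interior S" using interior_maximal[OF c[OF that(1)] open_ball] that(3) by auto
    moreover have "c T \<in> T" using c[OF that(2)] r by auto
    ultimately show ?thesis using tile_eqI that by blast
  qed
  have "inj_on c ?F"
    by (rule inj_onI, rule close) (use r(1) in auto)
  then have ic: "infinite (c ` ?F)" using inf finite_imageD by blast
  have sc: "c ` ?F \<subseteq> cball x (R + 4)"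
  proof (rule image_subsetI)
    fix T assume "T \<in> ?F"
    then have T: "T \<in> \<Lambda>" "T \<inter> cball x R \<noteq> {}" by auto
    then obtain y where y: "y \<in> T" "dist x y \<le> R" by (meson disjoint_iff mem_cball)
    have "c T \<in> T" using c[OF T(1)] r(1) by auto
    then show "c T \<in> cball x (R + 4)"
      using tile_diameter[OF T(1) y(1), of "c T"] y(2) dist_triangle[of x "c T" y] by simp
  qed
  obtain l where "l islimpt c ` ?F"
    using compact_cball[of x "R + 4", unfolded compact_eq_Bolzano_Weierstrass, rule_format, OF conjI[OF ic sc]]
    by (elim bexE)
  then have i: "infinite (c ` ?F \<inter> ball l (r/2))" using r(1) by (simp add: islimpt_eq_infinite_ball)
  obtain a where a: "a \<in> c ` ?F \<inter> ball l (r/2)" using infinite_imp_nonempty[OF i] by blast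
  have i': "infinite (c ` ?F \<inter> ball l (r/2) - {a})" using i by simp
  obtain b where b: "b \<in> c ` ?F \<inter> ball l (r/2) - {a}" using infinite_imp_nonempty[OF i'] by blast
  obtain S where S: "S \<in> \<Lambda>" "c S \<in> ball l (r/2)" "a = c S" using a by blast
  obtain T where T: "T \<in> \<Lambda>" "c T \<in> ball l (r/2)" "b = c T" using b by blast
  have "dist (c S) (c T) < r"
    using dist_triangle_half_r[of l "c S" r "c T"] S T by simp
  then show False using close[OF S(1) T(1)] S(3) T(3) b by simp
qed

lemma tiles_near:
  obtains e where "e > 0" "\<And>T y. T \<in> \<Lambda> \<Longrightarrow> y \<in> T \<Longrightarrow> dist x y < e \<Longrightarrow> x \<in> T"
proof -
  let ?F = "{T \<in> \<Lambda>. T \<inter> cball x 1 \<noteq> {} \<and> x \<notin> T}"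
  have "finite ?F" by (rule finite_subset[OF _ tiles_locally_finite[of x 1]]) auto
  then have "closed (\<Union>?F)" by (intro closed_Union) (auto intro: compact_imp_closed tile_compact)
  then have "open (- \<Union>?F)" by blast
  moreover have "x \<in> - \<Union>?F" by auto
  ultimately obtain e where e: "e > 0" "ball x e \<subseteq> - \<Union>?F" by (meson open_contains_ball)
  show thesis
  proof (rule that[of "min e 1"])
    fix T y assume "T \<in> \<Lambda>" "y \<in> T" "dist x y < min e 1"
    moreover then have "y \<in> T \<inter> cball x 1" "y \<in> ball x e" by auto
    ultimately show "x \<in> T" using e(2) by blast
  qed (use e in auto)
qed

text \<open>Every tile that comes close to a point of the segment contains this point (\<open>tiles_near\<close>), so that each point
  is related to the points of the segment nearby; compactness of the segment does the rest.\<close>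

lemma tile_chain:
  fixes p x :: complex
  defines "g \<equiv> \<lambda>r. p + of_real r * (x - p)"
  assumes trans: "\<And>a b c. Q a b \<Longrightarrow> Q b c \<Longrightarrow> Q a c"
    and tile: "\<And>T r r'. T \<in> \<Lambda> \<Longrightarrow> 0 \<le> r \<Longrightarrow> r \<le> r' \<Longrightarrow> r' \<le> 1 \<Longrightarrow> g r \<in> T \<Longrightarrow> g r' \<in> T \<Longrightarrow> Q (g r) (g r')"
  shows "Q p x"
proof -
  have "0 \<le> (0::real) \<and> (1::real) \<le> 1 \<longrightarrow> Q (g 0) (g 1)"
  proof (rule Bolzano[where P = "\<lambda>a b. 0 \<le> a \<and> b \<le> 1 \<longrightarrow> Q (g a) (g b)"])
    fix a b c :: real
    assume "0 \<le> a \<and> b \<le> 1 \<longrightarrow> Q (g a) (g b)" "0 \<le> b \<and> c \<le> 1 \<longrightarrow> Q (g b) (g c)" "a \<le> b" "b \<le> c"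
    then show "0 \<le> a \<and> c \<le> 1 \<longrightarrow> Q (g a) (g c)" using trans[of "g a" "g b" "g c"] by auto
  next
    fix r :: real
    obtain e where e: "e > 0" "\<And>T y. T \<in> \<Lambda> \<Longrightarrow> y \<in> T \<Longrightarrow> dist (g r) y < e \<Longrightarrow> g r \<in> T"
      using tiles_near[of "g r"] by blast
    have n: "norm (x - p) + 1 > 0" by (simp add: add_nonneg_pos)
    have near: "dist (g r) (g r') < e" if "\<bar>r' - r\<bar> < e / (norm (x - p) + 1)" for r'
    proof -
      have "dist (g r) (g r') = \<bar>r' - r\<bar> * norm (x - p)"
        unfolding dist_commute[of "g r"]
        by (simp add: dist_norm g_def left_diff_distrib[symmetric] of_real_diff[symmetric] norm_mult del: of_real_diff)
      also have "\<dots> \<le> \<bar>r' - r\<bar> * (norm (x - p) + 1)" by (intro mult_left_mono) auto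
      also have "\<dots> < e" using that n by (simp add: pos_less_divide_eq)
      finally show ?thesis .
    qed
    show "\<exists>d>0. \<forall>a b. a \<le> r \<and> r \<le> b \<and> b - a < d \<longrightarrow> 0 \<le> a \<and> b \<le> 1 \<longrightarrow> Q (g a) (g b)"
    proof (intro exI[of _ "e / (norm (x - p) + 1)"] conjI allI impI)
      show "0 < e / (norm (x - p) + 1)" using e(1) n by simp
      fix a b assume ab: "a \<le> r \<and> r \<le> b \<and> b - a < e / (norm (x - p) + 1)" "0 \<le> a \<and> b \<le> 1"
      obtain S where S: "S \<in> \<Lambda>" "g a \<in> S" by (rule tile_cover)
      obtain T where T: "T \<in> \<Lambda>" "g b \<in> T" by (rule tile_cover)
      have "g r \<in> S" "g r \<in> T" using e(2)[OF S near] e(2)[OF T near] ab by auto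
      then have "Q (g a) (g r)" "Q (g r) (g b)" using tile[OF S(1)] tile[OF T(1)] S T ab by auto
      then show "Q (g a) (g b)" by (rule trans)
    qed
  qed simp
  then show ?thesis by (simp add: g_def)
qed

text \<open>The tiles through \<open>x\<close> meet in a set that is a face of each of them.  An extreme point of this set is a corner
  of all of them.\<close>

lemma corner_exists: "\<exists>a. \<forall>T\<in>\<Lambda>. x \<in> T \<longrightarrow> a \<in> verts T"
proof -
  obtain T0 where T0: "T0 \<in> \<Lambda>" "x \<in> T0" by (rule tile_cover)
  let ?A = "{T \<in> \<Lambda>. x \<in> T}"
  let ?F = "\<Inter> ?A"
  have f: "?F face_of T" if T: "T \<in> ?A" for T
  proof -
    have "?F = \<Inter> ((\<lambda>S. S \<inter> T) ` ?A)" using T by auto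
    moreover have "\<Inter> ((\<lambda>S. S \<inter> T) ` ?A) face_of T"
      using T tile_face by (intro face_of_Inter) auto
    ultimately show ?thesis by simp
  qed
  have "compact ?F" using face_of_imp_compact[OF tile_convex tile_compact f] T0 by blast
  moreover have "convex ?F" by (intro convex_Inter) (auto intro: tile_convex)
  moreover have "?F \<noteq> {}" by auto
  ultimately obtain a where "a extreme_point_of ?F" using extreme_point_exists_convex by blast
  then have "a \<in> verts T" if "T \<in> ?A" for T
    using extreme_point_of_face[OF f[OF that]] by simp
  then show ?thesis by blast
qed

text \<open>Rounding to a corner makes functions on the vertices into functions on the plane, where convexity and
  connectedness can be used.  A vertex has to be rounded to itself, so it is treated separately.\<close>

definition corner :: "complex \<Rightarrow> complex" where
  "corner x = (if x \<in> \<V> then x else SOME a. \<forall>T\<in>\<Lambda>. x \<in> T \<longrightarrow> a \<in> verts T)"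

lemma corner_verts: assumes "T \<in> \<Lambda>" "x \<in> T" shows "corner x \<in> verts T"
proof (cases "x \<in> \<V>")
  case True then show ?thesis using lverts_in_tile[OF True assms] by (simp add: corner_def)
next
  case False then show ?thesis using someI_ex[OF corner_exists[of x]] assms by (simp add: corner_def)
qed

lemma corner_vertex: "x \<in> \<V> \<Longrightarrow> corner x = x"
  by (simp add: corner_def)

lemma corner_lverts: "corner x \<in> \<V>"
  by (metis corner_verts tile_cover verts_lverts)

end

section \<open>The monodromy theorem\<close>

text \<open>A locally constant sheaf on the tessellated plane, described by its sections over single tiles.  The value
  at one corner can be prescribed, and it determines a section on its tile and at the corners shared with any
  other tile.\<close>

locale tile_sections = rhombic_tiling +
  fixes Sec :: "complex set \<Rightarrow> (complex \<Rightarrow> 'y) set" and Y :: "'y set"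
  assumes Sec_values: "T \<in> \<Lambda> \<Longrightarrow> \<sigma> \<in> Sec T \<Longrightarrow> a \<in> verts T \<Longrightarrow> \<sigma> a \<in> Y"
    and Sec_exists: "T \<in> \<Lambda> \<Longrightarrow> a \<in> verts T \<Longrightarrow> y \<in> Y \<Longrightarrow> \<exists>\<sigma>\<in>Sec T. \<sigma> a = y"
    and Sec_agree: "S \<in> \<Lambda> \<Longrightarrow> T \<in> \<Lambda> \<Longrightarrow> \<sigma> \<in> Sec S \<Longrightarrow> \<tau> \<in> Sec T \<Longrightarrow>
      a \<in> verts S \<Longrightarrow> a \<in> verts T \<Longrightarrow> b \<in> verts S \<Longrightarrow> b \<in> verts T \<Longrightarrow> \<sigma> a = \<tau> a \<Longrightarrow> \<sigma> b = \<tau> b"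
begin

text \<open>Sections are considered on arbitrary sets of points rather than on unions of tiles, so that the plane can be
  cut along lines that run through the interior of tiles.\<close>

definition section_on :: "complex set \<Rightarrow> (complex \<Rightarrow> 'y) \<Rightarrow> bool" where
  "section_on U s \<longleftrightarrow>
     (\<forall>T\<in>\<Lambda>. U \<inter> T \<noteq> {} \<longrightarrow> (\<exists>\<sigma>\<in>Sec T. \<forall>x\<in>U \<inter> T. s x = \<sigma> (corner x)))"

lemma section_onD:
  assumes "section_on U s" "T \<in> \<Lambda>" "x \<in> U" "x \<in> T"
  obtains \<sigma> where "\<sigma> \<in> Sec T" "\<forall>y\<in>U \<inter> T. s y = \<sigma> (corner y)"
proof -
  have ne: "U \<inter> T \<noteq> {}" using assms(3,4) by blast
  obtain \<sigma> where "\<sigma> \<in> Sec T" "\<forall>x\<in>U \<inter> T. s x = \<sigma> (corner x)"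
    using assms(1)[unfolded section_on_def, THEN bspec, OF assms(2), THEN mp, OF ne] by (elim bexE)
  then show thesis by (rule that)
qed

lemma section_on_values: assumes "section_on U s" "x \<in> U" shows "s x \<in> Y"
proof -
  obtain T where T: "T \<in> \<Lambda>" "x \<in> T" by (rule tile_cover)
  obtain \<sigma> where "\<sigma> \<in> Sec T" "\<forall>y\<in>U \<inter> T. s y = \<sigma> (corner y)"
    by (rule section_onD[OF assms(1) T(1) assms(2) T(2)])
  then show ?thesis using Sec_values[OF T(1)] corner_verts[OF T] assms(2) T(2) by simp
qed

lemma section_on_subset: "section_on U s \<Longrightarrow> V \<subseteq> U \<Longrightarrow> section_on V s"
  unfolding section_on_def
proof (intro ballI impI)
  fix T assume a: "\<forall>T\<in>\<Lambda>. U \<inter> T \<noteq> {} \<longrightarrow> (\<exists>\<sigma>\<in>Sec T. \<forall>x\<in>U \<inter> T. s x = \<sigma> (corner x))"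
    and V: "V \<subseteq> U" and T: "T \<in> \<Lambda>" "V \<inter> T \<noteq> {}"
  have ne: "U \<inter> T \<noteq> {}" using V T by blast
  obtain \<sigma> where "\<sigma> \<in> Sec T" "\<forall>x\<in>U \<inter> T. s x = \<sigma> (corner x)"
    using a[THEN bspec, OF T(1), THEN mp, OF ne] by (elim bexE)
  then show "\<exists>\<sigma>\<in>Sec T. \<forall>x\<in>V \<inter> T. s x = \<sigma> (corner x)" using V by (intro bexI[of _ \<sigma>]) auto
qed

lemma section_agree_tile:
  assumes "section_on U s" "section_on V t" "T \<in> \<Lambda>" "x \<in> U" "x \<in> V" "x \<in> T" "s x = t x"
    "y \<in> U" "y \<in> V" "y \<in> T"
  shows "s y = t y"
proof -
  obtain \<sigma> where \<sigma>: "\<sigma> \<in> Sec T" "\<forall>y\<in>U \<inter> T. s y = \<sigma> (corner y)"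
    by (rule section_onD[OF assms(1,3,4,6)])
  obtain \<tau> where \<tau>: "\<tau> \<in> Sec T" "\<forall>y\<in>V \<inter> T. t y = \<tau> (corner y)"
    by (rule section_onD[OF assms(2,3,5,6)])
  have "\<sigma> (corner y) = \<tau> (corner y)"
    by (rule Sec_agree[OF assms(3,3) \<sigma>(1) \<tau>(1), of "corner x"])
      (use assms \<sigma>(2) \<tau>(2) corner_verts in auto)
  then show ?thesis using \<sigma>(2) \<tau>(2) assms by simp
qed

lemma section_unique:
  assumes s: "section_on U s" and t: "section_on U t" and U: "convex U" and p: "p \<in> U" and x: "x \<in> U"
    and eq: "s p = t p"
  shows "s x = t x"
proof -
  have gU: "p + of_real r * (x - p) \<in> U" if "0 \<le> r" "r \<le> 1" for r
    using convexD_alt[OF U p x that] by (simp add: scaleR_conv_of_real algebra_simps)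
  have "s p = t p \<longrightarrow> s x = t x"
  proof (rule tile_chain[where Q = "\<lambda>a b. s a = t a \<longrightarrow> s b = t b"])
    fix T and r r' :: real
    assume "T \<in> \<Lambda>" "0 \<le> r" "r \<le> r'" "r' \<le> 1" "p + of_real r * (x - p) \<in> T" "p + of_real r' * (x - p) \<in> T"
    then show "s (p + of_real r * (x - p)) = t (p + of_real r * (x - p)) \<longrightarrow>
        s (p + of_real r' * (x - p)) = t (p + of_real r' * (x - p))"
      by (intro impI) (rule section_agree_tile[OF s t _ gU gU _ _ gU gU], auto)
  qed blast
  then show ?thesis using eq by blast
qed

definition extendable :: "complex set \<Rightarrow> bool" where
  "extendable U \<longleftrightarrow> (\<forall>p\<in>U. \<forall>y\<in>Y. \<exists>s. section_on U s \<and> s p = y)"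

text \<open>All tiles involved contain \<open>x\<close>, so a section is obtained by transport from \<open>x\<close> inside each tile
  separately.\<close>

lemma extendable_near:
  assumes x: "x \<in> U" and near: "\<And>T y. T \<in> \<Lambda> \<Longrightarrow> y \<in> T \<Longrightarrow> y \<in> U \<Longrightarrow> x \<in> T"
  shows "extendable U"
  unfolding extendable_def
proof (intro ballI)
  have 1: "\<exists>s. section_on U s \<and> s x = y" if y: "y \<in> Y" for y
  proof -
    have "\<exists>\<sigma>\<in>Sec T. \<sigma> (corner x) = y" if "T \<in> \<Lambda>" "x \<in> T" for T
      using Sec_exists that corner_verts y by blast
    then obtain \<sigma> where \<sigma>: "\<And>T. T \<in> \<Lambda> \<Longrightarrow> x \<in> T \<Longrightarrow> \<sigma> T \<in> Sec T \<and> \<sigma> T (corner x) = y" by metis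
    define tl where "tl z = (SOME T. T \<in> \<Lambda> \<and> z \<in> T)" for z
    have tl: "tl z \<in> \<Lambda>" "z \<in> tl z" for z
      using someI_ex[of "\<lambda>T. T \<in> \<Lambda> \<and> z \<in> T"] tile_cover[of z] unfolding tl_def by blast+
    define s where "s z = \<sigma> (tl z) (corner z)" for z
    have st: "s z = \<sigma> T (corner z)" if "T \<in> \<Lambda>" "z \<in> T" "z \<in> U" for z T
    proof -
      have xT: "x \<in> T" "x \<in> tl z" using near tl that by blast+
      show ?thesis unfolding s_def
        by (rule Sec_agree[OF tl(1) that(1), of _ _ _ "corner x"])
          (use xT \<sigma> tl that corner_verts in auto)
    qed
    have "section_on U s"
      unfolding section_on_def
    proof (intro ballI impI)
      fix T assume T: "T \<in> \<Lambda>" "U \<inter> T \<noteq> {}"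
      then have "x \<in> T" using near by blast
      then show "\<exists>\<sigma>\<in>Sec T. \<forall>x\<in>U \<inter> T. s x = \<sigma> (corner x)"
        using \<sigma> T st by (intro bexI[of _ "\<sigma> T"]) auto
    qed
    moreover have "s x = y" using tl \<sigma> by (simp add: s_def)
    ultimately show ?thesis by blast
  qed
  fix p y assume p: "p \<in> U" and y: "y \<in> Y"
  obtain T where T: "T \<in> \<Lambda>" "p \<in> T" by (rule tile_cover)
  then have xT: "x \<in> T" using near p by blast
  obtain \<tau> where \<tau>: "\<tau> \<in> Sec T" "\<tau> (corner p) = y" using Sec_exists[OF T(1)] corner_verts[OF T] y by blast
  obtain s where s: "section_on U s" "s x = \<tau> (corner x)"
    using 1 Sec_values[OF T(1) \<tau>(1)] corner_verts[OF T(1) xT] by blast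
  obtain \<sigma> where \<sigma>: "\<sigma> \<in> Sec T" "\<forall>y\<in>U \<inter> T. s y = \<sigma> (corner y)"
    by (rule section_onD[OF s(1) T(1) p T(2)])
  have "\<sigma> (corner p) = \<tau> (corner p)"
    by (rule Sec_agree[OF T(1,1) \<sigma>(1) \<tau>(1), of "corner x"]) (use corner_verts T xT \<sigma>(2) x s in auto)
  then show "\<exists>s. section_on U s \<and> s p = y" using s(1) \<sigma>(2) p T \<tau> by auto
qed

text \<open>Sections over the two halves that agree at one point of the cut agree along the whole cut, which is convex.
  A tile that meets both halves also meets the cut, because its part in \<open>U\<close> is connected; hence the
  two sections restrict to the same tile section.\<close>

lemma extendable_glue:
  fixes U :: "complex set" and c :: complex and k :: real
  defines "A \<equiv> U \<inter> {x. inner c x \<le> k}" and "B \<equiv> U \<inter> {x. inner c x \<ge> k}"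
  assumes U: "convex U" and w: "w \<in> U" "inner c w = k" and gA: "extendable A" and gB: "extendable B"
  shows "extendable U"
  unfolding extendable_def
proof (intro ballI)
  fix p y assume p: "p \<in> U" and y: "y \<in> Y"
  have wA: "w \<in> A" "w \<in> B" using w by (auto simp: A_def B_def)
  have UAB: "U = A \<union> B" by (auto simp: A_def B_def)
  have "convex {x. inner c x \<le> k}" "convex {x. inner c x \<ge> k}"
    by (rule convex_halfspace_le convex_halfspace_ge)+
  then have cAB: "convex (A \<inter> B)" unfolding A_def B_def using U by (intro convex_Int)
  have "\<exists>s t. section_on A s \<and> section_on B t \<and> s w = t w \<and> (p \<in> A \<longrightarrow> s p = y) \<and> (p \<notin> A \<longrightarrow> t p = y)"
  proof (cases "p \<in> A")
    case True
    then obtain s where s: "section_on A s" "s p = y" using gA y unfolding extendable_def by blast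
    obtain t where "section_on B t" "t w = s w"
      using gB wA(2) section_on_values[OF s(1) wA(1)] unfolding extendable_def by blast
    then show ?thesis using s True by metis
  next
    case False
    then have "p \<in> B" using p UAB by blast
    then obtain t where t: "section_on B t" "t p = y" using gB y unfolding extendable_def by blast
    obtain s where "section_on A s" "s w = t w"
      using gA wA(1) section_on_values[OF t(1) wA(2)] unfolding extendable_def by blast
    then show ?thesis using t False by metis
  qed
  then obtain s t where s: "section_on A s" and t: "section_on B t" and st: "s w = t w"
    and py: "p \<in> A \<Longrightarrow> s p = y" "p \<notin> A \<Longrightarrow> t p = y" by blast
  have agree: "s x = t x" if "x \<in> A" "x \<in> B" for x
    by (rule section_unique[OF section_on_subset[OF s] section_on_subset[OF t] cAB _ _ st]) (use that wA in auto)
  define r where "r x = (if x \<in> A then s x else t x)" for x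
  have rB: "r x = t x" if "x \<in> B" for x using agree that by (auto simp: r_def)
  have "section_on U r"
    unfolding section_on_def
  proof (intro ballI impI)
    fix T assume T: "T \<in> \<Lambda>" "U \<inter> T \<noteq> {}"
    show "\<exists>\<sigma>\<in>Sec T. \<forall>x\<in>U \<inter> T. r x = \<sigma> (corner x)"
    proof (cases "A \<inter> T = {} \<or> B \<inter> T = {}")
      case True
      then consider "A \<inter> T = {}" "B \<inter> T \<noteq> {}" | "B \<inter> T = {}" "A \<inter> T \<noteq> {}" using T UAB by blast
      then show ?thesis
      proof cases
        case 1
        then obtain \<sigma> where "\<sigma> \<in> Sec T" "\<forall>x\<in>B \<inter> T. t x = \<sigma> (corner x)"
          using t[unfolded section_on_def, THEN bspec, OF T(1), THEN mp, OF 1(2)] by (elim bexE)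
        then show ?thesis using 1 UAB rB by (intro bexI[of _ \<sigma>]) auto
      next
        case 2
        then obtain \<sigma> where "\<sigma> \<in> Sec T" "\<forall>x\<in>A \<inter> T. s x = \<sigma> (corner x)"
          using s[unfolded section_on_def, THEN bspec, OF T(1), THEN mp, OF 2(2)] by (elim bexE)
        then show ?thesis using 2 UAB by (intro bexI[of _ \<sigma>]) (auto simp: r_def)
      qed
    next
      case False
      then obtain a b where a: "a \<in> A" "a \<in> T" and b: "b \<in> B" "b \<in> T" by blast
      obtain \<sigma> where \<sigma>: "\<sigma> \<in> Sec T" "\<forall>y\<in>A \<inter> T. s y = \<sigma> (corner y)"
        by (rule section_onD[OF s T(1) a])
      obtain \<tau> where \<tau>: "\<tau> \<in> Sec T" "\<forall>y\<in>B \<inter> T. t y = \<tau> (corner y)"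
        by (rule section_onD[OF t T(1) b])
      have "connected (U \<inter> T)" using U tile_convex[OF T(1)] by (intro convex_connected convex_Int)
      then have "\<exists>z\<in>U \<inter> T. inner c z = k"
        by (rule connected_ivt_hyperplane[where x = a and y = b]) (use a b in \<open>auto simp: A_def B_def\<close>)
      then obtain z where z: "z \<in> U" "z \<in> T" "inner c z = k" by blast
      then have zAB: "z \<in> A" "z \<in> B" by (auto simp: A_def B_def)
      have "s z = \<sigma> (corner z)" "t z = \<tau> (corner z)" using \<sigma>(2) \<tau>(2) zAB z(2) by simp_all
      then have "\<sigma> (corner z) = \<tau> (corner z)" using agree[OF zAB] by simp
      then have "\<sigma> (corner x) = \<tau> (corner x)" if "x \<in> T" for x
        using Sec_agree[OF T(1,1) \<sigma>(1) \<tau>(1), of "corner z" "corner x"] corner_verts T(1) z(2) that by blast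
      then have "\<forall>x\<in>U \<inter> T. r x = \<sigma> (corner x)" using \<sigma>(2) \<tau>(2) UAB by (auto simp: r_def)
      then show ?thesis using \<sigma>(1) by blast
    qed
  qed
  moreover have "r p = y" using py by (simp add: r_def)
  ultimately show "\<exists>s. section_on U s \<and> s p = y" by blast
qed

abbreviation rect :: "real \<Rightarrow> real \<Rightarrow> real \<Rightarrow> real \<Rightarrow> complex set" where
  "rect a b c d \<equiv> cbox (Complex a c) (Complex b d)"

text \<open>Rectangles below a uniform size (a Lebesgue number) are extendable by \<open>extendable_near\<close>.  They are stacked to narrow
  columns, and the columns are joined to the whole rectangle; both steps are instances of Bolzano's lemma.\<close>

lemma extendable_rect:
  assumes ab: "a \<le> b" and cd: "c \<le> d" shows "extendable (rect a b c d)"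
proof -
  have "\<exists>e. e > 0 \<and> (\<forall>T y. T \<in> \<Lambda> \<longrightarrow> y \<in> T \<longrightarrow> dist x y < e \<longrightarrow> x \<in> T)" for x
    using tiles_near[of x] by metis
  then obtain e where e: "\<And>x. e x > 0" "\<And>x T y. T \<in> \<Lambda> \<Longrightarrow> y \<in> T \<Longrightarrow> dist x y < e x \<Longrightarrow> x \<in> T"
    by metis
  have cov: "rect a b c d \<subseteq> \<Union> (range (\<lambda>x. ball x (e x / 2)))"
  proof
    fix x show "x \<in> \<Union> (range (\<lambda>x. ball x (e x / 2)))" using e(1)[of x] by (intro UN_I[of x]) auto
  qed
  obtain \<epsilon> where \<epsilon>: "\<epsilon> > 0" and leb: "\<And>x. x \<in> rect a b c d \<Longrightarrow> \<exists>G\<in>range (\<lambda>x. ball x (e x / 2)). ball x \<epsilon> \<subseteq> G"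
    by (rule Heine_Borel_lemma[of "rect a b c d" "range (\<lambda>x. ball x (e x / 2))"]) (use cov in auto)
  have small: "extendable (rect a' b' c' d')"
    if "a \<le> a'" "a' \<le> b'" "b' \<le> b" "c \<le> c'" "c' \<le> d'" "d' \<le> d" "b' - a' < \<epsilon> / 2" "d' - c' < \<epsilon> / 2" for a' b' c' d'
  proof -
    have "Complex a' c' \<in> rect a b c d" using that by (simp add: in_cbox_complex_iff)
    then obtain x where x: "ball (Complex a' c') \<epsilon> \<subseteq> ball x (e x / 2)" using leb by blast
    have sub: "z \<in> ball x (e x / 2)" if z: "z \<in> rect a' b' c' d'" for z
    proof -
      have "cmod (z - Complex a' c') \<le> \<bar>Re (z - Complex a' c')\<bar> + \<bar>Im (z - Complex a' c')\<bar>" by (rule cmod_le)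
      also have "\<dots> < \<epsilon>" using z \<open>b' - a' < \<epsilon> / 2\<close> \<open>d' - c' < \<epsilon> / 2\<close> by (simp add: in_cbox_complex_iff)
      finally have "z \<in> ball (Complex a' c') \<epsilon>" by (simp add: dist_norm norm_minus_commute)
      then show ?thesis using x by blast
    qed
    \<comment> \<open>The centre \<open>x\<close> of the ball need not belong to the small rectangle, so it is added.\<close>
    let ?U = "insert x (rect a' b' c' d')"
    have "extendable ?U"
    proof (rule extendable_near[of x])
      fix T y assume "T \<in> \<Lambda>" "y \<in> T" "y \<in> ?U"
      moreover then have "dist x y < e x" using sub[of y] e(1)[of x] by auto
      ultimately show "x \<in> T" using e(2) by blast
    qed simp
    then show ?thesis unfolding extendable_def by (meson insertCI section_on_subset subset_insertI)
  qed
  have split_Im: "extendable (rect a' b' c1 c3)"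
    if "a' \<le> b'" "c1 \<le> c2" "c2 \<le> c3" "extendable (rect a' b' c1 c2)" "extendable (rect a' b' c2 c3)" for a' b' c1 c2 c3
  proof (rule extendable_glue[of _ "Complex a' c2" \<i> c2])
    have "rect a' b' c1 c3 \<inter> {x. inner \<i> x \<le> c2} = rect a' b' c1 c2" "rect a' b' c1 c3 \<inter> {x. c2 \<le> inner \<i> x} = rect a' b' c2 c3"
      using that by (auto simp: in_cbox_complex_iff inner_complex_def)
    then show "extendable (rect a' b' c1 c3 \<inter> {x. inner \<i> x \<le> c2})" "extendable (rect a' b' c1 c3 \<inter> {x. c2 \<le> inner \<i> x})"
      using that by simp_all
  qed (use that in \<open>auto simp: in_cbox_complex_iff inner_complex_def convex_box\<close>)
  have split_Re: "extendable (rect a1 a3 c' d')"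
    if "c' \<le> d'" "a1 \<le> a2" "a2 \<le> a3" "extendable (rect a1 a2 c' d')" "extendable (rect a2 a3 c' d')" for a1 a2 a3 c' d'
  proof (rule extendable_glue[of _ "Complex a2 c'" 1 a2])
    have "rect a1 a3 c' d' \<inter> {x. inner 1 x \<le> a2} = rect a1 a2 c' d'" "rect a1 a3 c' d' \<inter> {x. a2 \<le> inner 1 x} = rect a2 a3 c' d'"
      using that by (auto simp: in_cbox_complex_iff inner_complex_def)
    then show "extendable (rect a1 a3 c' d' \<inter> {x. inner 1 x \<le> a2})" "extendable (rect a1 a3 c' d' \<inter> {x. a2 \<le> inner 1 x})"
      using that by simp_all
  qed (use that in \<open>auto simp: in_cbox_complex_iff inner_complex_def convex_box\<close>)
  have column: "extendable (rect a' b' c d)"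
    if "a \<le> a'" "a' \<le> b'" "b' \<le> b" "b' - a' < \<epsilon> / 2" for a' b'
  proof -
    have "c \<le> c \<and> d \<le> d \<longrightarrow> extendable (rect a' b' c d)"
    proof (rule Bolzano[where P = "\<lambda>c' d'. c \<le> c' \<and> d' \<le> d \<longrightarrow> extendable (rect a' b' c' d')", OF cd])
      fix c1 c2 c3 assume "c \<le> c1 \<and> c2 \<le> d \<longrightarrow> extendable (rect a' b' c1 c2)" "c \<le> c2 \<and> c3 \<le> d \<longrightarrow> extendable (rect a' b' c2 c3)"
        "c1 \<le> c2" "c2 \<le> c3"
      then show "c \<le> c1 \<and> c3 \<le> d \<longrightarrow> extendable (rect a' b' c1 c3)" using split_Im[of a' b' c1 c2 c3] that by auto
    next
      fix x show "\<exists>dd>0. \<forall>c' d'. c' \<le> x \<and> x \<le> d' \<and> d' - c' < dd \<longrightarrow> c \<le> c' \<and> d' \<le> d \<longrightarrow> extendable (rect a' b' c' d')"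
        using small that \<epsilon> by (intro exI[of _ "\<epsilon>/2"]) auto
    qed
    then show ?thesis by simp
  qed
  have "a \<le> a \<and> b \<le> b \<longrightarrow> extendable (rect a b c d)"
  proof (rule Bolzano[where P = "\<lambda>a' b'. a \<le> a' \<and> b' \<le> b \<longrightarrow> extendable (rect a' b' c d)", OF ab])
    fix a1 a2 a3 assume "a \<le> a1 \<and> a2 \<le> b \<longrightarrow> extendable (rect a1 a2 c d)" "a \<le> a2 \<and> a3 \<le> b \<longrightarrow> extendable (rect a2 a3 c d)"
      "a1 \<le> a2" "a2 \<le> a3"
    then show "a \<le> a1 \<and> a3 \<le> b \<longrightarrow> extendable (rect a1 a3 c d)" using split_Re[of c d a1 a2 a3] cd by auto
  next
    fix x show "\<exists>dd>0. \<forall>a' b'. a' \<le> x \<and> x \<le> b' \<and> b' - a' < dd \<longrightarrow> a \<le> a' \<and> b' \<le> b \<longrightarrow> extendable (rect a' b' c d)"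
      using column \<epsilon> by (intro exI[of _ "\<epsilon>/2"]) auto
  qed
  then show ?thesis by simp
qed

text \<open>Sections over growing squares with the same value at \<open>p\<close> extend each other.\<close>

lemma extendable_plane: "extendable UNIV"
  unfolding extendable_def
proof (intro ballI)
  fix p y assume y: "y \<in> Y"
  define Q where "Q n = rect (Re p - real n) (Re p + real n) (Im p - real n) (Im p + real n)" for n
  have pQ: "p \<in> Q n" for n by (simp add: Q_def in_cbox_complex_iff)
  have cQ: "convex (Q n)" for n unfolding Q_def by (rule convex_box)
  have mono: "Q n \<subseteq> Q m" if "n \<le> m" for n m using that by (auto simp: Q_def in_cbox_complex_iff)
  have "\<exists>s. section_on (Q n) s \<and> s p = y" for n
    using extendable_rect[of "Re p - real n" "Re p + real n" "Im p - real n" "Im p + real n"] pQ[of n] y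
    unfolding extendable_def Q_def by simp
  then obtain s where s: "\<And>n. section_on (Q n) (s n)" "\<And>n. s n p = y" by metis
  have agree: "s n x = s m x" if "n \<le> m" "x \<in> Q n" for n m x
    by (rule section_unique[OF s(1) section_on_subset[OF s(1) mono[OF that(1)]] cQ pQ that(2)]) (simp add: s(2))
  define N where "N x = nat \<lceil>cmod (x - p)\<rceil>" for x
  have N: "x \<in> Q (N x)" for x
  proof -
    have "cmod (x - p) \<le> real (N x)" unfolding N_def by linarith
    then have "\<bar>Re (x - p)\<bar> \<le> real (N x)" "\<bar>Im (x - p)\<bar> \<le> real (N x)"
      using abs_Re_le_cmod[of "x - p"] abs_Im_le_cmod[of "x - p"] by linarith+
    then show ?thesis by (auto simp: Q_def in_cbox_complex_iff)
  qed
  define r where "r x = s (N x) x" for x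
  have r: "r x = s n x" if "x \<in> Q n" for x n
  proof (cases "n \<le> N x")
    case True then show ?thesis using agree[OF True that] by (simp add: r_def)
  next
    case False then show ?thesis using agree[of "N x" n x] N by (simp add: r_def)
  qed
  have "section_on UNIV r"
    unfolding section_on_def
  proof (intro ballI impI)
    fix T assume T: "T \<in> \<Lambda>" "UNIV \<inter> T \<noteq> {}"
    then obtain x where x: "x \<in> T" by blast
    define n where "n = N x + 4"
    have TQ: "z \<in> Q n" if "z \<in> T" for z
    proof -
      have "dist x z \<le> 4" by (rule tile_diameter[OF T(1) x that])
      then have "\<bar>Re (z - x)\<bar> \<le> 4" "\<bar>Im (z - x)\<bar> \<le> 4"
        using abs_Re_le_cmod[of "z - x"] abs_Im_le_cmod[of "z - x"] by (simp_all add: dist_norm norm_minus_commute)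
      then show ?thesis using N[of x] by (auto simp: Q_def n_def in_cbox_complex_iff)
    qed
    obtain \<sigma> where "\<sigma> \<in> Sec T" "\<forall>y\<in>Q n \<inter> T. s n y = \<sigma> (corner y)"
      using section_onD[OF s(1) T(1) TQ[OF x] x] by blast
    then show "\<exists>\<sigma>\<in>Sec T. \<forall>x\<in>UNIV \<inter> T. r x = \<sigma> (corner x)" using TQ r[of _ n] by (intro bexI[of _ \<sigma>]) auto
  qed
  moreover have "r p = y" using r[OF pQ[of 0]] s(2) by simp
  ultimately show "\<exists>s. section_on UNIV s \<and> s p = y" by blast
qed

lemma global_section:
  assumes "p \<in> \<V>" "y \<in> Y"
  obtains s where "s p = y" "\<And>T. T \<in> \<Lambda> \<Longrightarrow> \<exists>\<sigma>\<in>Sec T. \<forall>a\<in>verts T. s a = \<sigma> a" "\<And>a. a \<in> \<V> \<Longrightarrow> s a \<in> Y"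
proof -
  obtain s where s: "section_on UNIV s" "s p = y" using extendable_plane assms(2) unfolding extendable_def by blast
  have "\<exists>\<sigma>\<in>Sec T. \<forall>a\<in>verts T. s a = \<sigma> a" if T: "T \<in> \<Lambda>" for T
  proof -
    obtain q u v where "nondeg u v" "T = rh q u v" using T by (elim tileE)
    then have qT: "q \<in> T" using rh_vertex verts_subset by blast
    obtain \<sigma> where "\<sigma> \<in> Sec T" "\<forall>y\<in>UNIV \<inter> T. s y = \<sigma> (corner y)"
      by (rule section_onD[OF s(1) T UNIV_I qT])
    then show ?thesis using corner_vertex verts_lverts[OF T] verts_subset by (intro bexI[of _ \<sigma>]) auto
  qed
  then show thesis using that s section_on_values[OF s(1)] by blast
qed

end

section \<open>Transport along edges and discrete primitives\<close>

context rhombic_tiling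
begin

lemma tile_verts_edges:
  assumes "T \<in> \<Lambda>" "a \<in> verts T" "b \<in> verts T"
  shows "a = b \<or> side T a b \<or> (\<exists>c. side T a c \<and> side T c b)"
proof -
  obtain q u v where n: "nondeg u v" "T = rh q u v" using assms(1) by (elim tileE)
  obtain u' v' where n': "nondeg u' v'" "T = rh a u' v'" using rh_rebase[OF n(1)] assms(2) n(2) by metis
  have "b = a \<or> b = a + u' \<or> b = a + u' + v' \<or> b = a + v'"
    using assms(3) unfolding n'(2) verts_rh[OF n'(1)] by simp
  then show ?thesis using rh_sides[OF n'(1), of a] unfolding n'(2)[symmetric] by metis
qed

text \<open>Monodromy for a transport \<open>e a b\<close> along edges with values in \<open>Y\<close>.  Consistency is required for one description of each
  tile only, because invertibility transfers it to the other corners and orientations.\<close>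

lemma edge_section:
  fixes e :: "complex \<Rightarrow> complex \<Rightarrow> 'y \<Rightarrow> 'y"
  assumes closed: "\<And>a b y. (a, b) \<in> \<E> \<Longrightarrow> y \<in> Y \<Longrightarrow> e a b y \<in> Y"
    and inv: "\<And>a b y. (a, b) \<in> \<E> \<Longrightarrow> y \<in> Y \<Longrightarrow> e b a (e a b y) = y"
    and face: "\<And>T. T \<in> \<Lambda> \<Longrightarrow> \<exists>q u v. nondeg u v \<and> T = rh q u v \<and>
      (\<forall>y\<in>Y. e (q + u) (q + u + v) (e q (q + u) y) = e (q + v) (q + u + v) (e q (q + v) y))"
    and p: "p \<in> \<V>" "y \<in> Y"
  obtains s where "s p = y" "\<And>a. a \<in> \<V> \<Longrightarrow> s a \<in> Y"
    "\<And>a b. (a, b) \<in> \<E> \<Longrightarrow> s b = e a b (s a)"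
proof -
  define Sec where "Sec T = {\<sigma>. (\<forall>a\<in>verts T. \<sigma> a \<in> Y) \<and> (\<forall>a b. side T a b \<longrightarrow> \<sigma> b = e a b (\<sigma> a))}" for T
  interpret tile_sections \<Lambda> Sec Y
  proof
    fix T \<sigma> a assume "\<sigma> \<in> Sec T" "a \<in> verts T"
    then show "\<sigma> a \<in> Y" by (simp add: Sec_def)
  next
    fix S T \<sigma> \<tau> a b
    assume ST: "S \<in> \<Lambda>" "T \<in> \<Lambda>" and \<sigma>: "\<sigma> \<in> Sec S" and \<tau>: "\<tau> \<in> Sec T"
      and a: "a \<in> verts S" "a \<in> verts T" and b: "b \<in> verts S" "b \<in> verts T" and eq: "\<sigma> a = \<tau> a"
    have \<sigma>e: "\<sigma> d = e c d (\<sigma> c)" if "side S c d" for c d using \<sigma> that by (simp add: Sec_def)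
    have \<tau>e: "\<tau> d = e c d (\<tau> c)" if "side T c d" for c d using \<tau> that by (simp add: Sec_def)
    show "\<sigma> b = \<tau> b"
    proof (cases "S = T")
      case True
      then show ?thesis using tile_verts_edges[OF ST(1) a(1) b(1)] \<sigma>e \<tau>e eq by metis
    next
      case False
      show ?thesis
      proof (cases "a = b")
        case True then show ?thesis using eq by simp
      next
        case ab: False
        have "side S a b" "side T a b"
          using common_verts[OF ST False a(1) b(1) verts_subset[OF a(2)] verts_subset[OF b(2)] ab]
            common_verts[OF ST(2,1) False[symmetric] a(2) b(2) verts_subset[OF a(1)] verts_subset[OF b(1)] ab] by blast+
        then show ?thesis using \<sigma>e \<tau>e eq by metis
      qed
    qed
  next
    fix T a y assume T: "T \<in> \<Lambda>" and a: "a \<in> verts T" and y: "y \<in> Y"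
    obtain q u v where n: "nondeg u v" "T = rh q u v"
      and f: "\<And>y. y \<in> Y \<Longrightarrow> e (q + u) (q + u + v) (e q (q + u) y) = e (q + v) (q + u + v) (e q (q + v) y)"
      using face[OF T] by blast
    note sides = tile_edges[OF n(1), of q, folded n(2), OF T]
    note sides' = sides[THEN ledges_sym]
    have dist: "q \<noteq> q + u" "q \<noteq> q + v" "q + u \<noteq> q + v" "q \<noteq> q + u + v" "q + u \<noteq> q + u + v" "q + v \<noteq> q + u + v"
      using n(1) by (auto simp: nondeg_def add.assoc add_eq_0_iff)
    have ex: "\<exists>\<sigma>\<in>Sec T. \<sigma> q = y0 \<and> \<sigma> (q + u) = e q (q + u) y0 \<and> \<sigma> (q + v) = e q (q + v) y0 \<and>
        \<sigma> (q + u + v) = e (q + u) (q + u + v) (e q (q + u) y0)" if y0: "y0 \<in> Y" for y0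
    proof -
      define \<sigma> where "\<sigma> = (\<lambda>x. if x = q then y0 else if x = q + u then e q (q + u) y0 else
        if x = q + v then e q (q + v) y0 else e (q + u) (q + u + v) (e q (q + u) y0))"
      have \<sigma>: "\<sigma> q = y0" "\<sigma> (q + u) = e q (q + u) y0" "\<sigma> (q + v) = e q (q + v) y0"
        "\<sigma> (q + u + v) = e (q + u) (q + u + v) (e q (q + u) y0)"
        unfolding \<sigma>_def using dist by (simp_all add: dist[symmetric])
      have Y: "e q (q + u) y0 \<in> Y" "e q (q + v) y0 \<in> Y" "e (q + u) (q + u + v) (e q (q + u) y0) \<in> Y"
        using closed sides y0 by blast+
      have "\<forall>a\<in>verts T. \<sigma> a \<in> Y" unfolding n(2) verts_rh[OF n(1)] using \<sigma> Y y0 by simp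
      moreover have "\<sigma> d = e c d (\<sigma> c)" if "side T c d" for c d
      proof -
        have 1: "\<sigma> (q + u) = e q (q + u) (\<sigma> q)" "\<sigma> (q + v) = e q (q + v) (\<sigma> q)"
          "\<sigma> (q + u + v) = e (q + u) (q + u + v) (\<sigma> (q + u))" "\<sigma> (q + u + v) = e (q + v) (q + u + v) (\<sigma> (q + v))"
          using \<sigma> f[OF y0] by simp_all
        have Y': "\<sigma> q \<in> Y" "\<sigma> (q + u) \<in> Y" "\<sigma> (q + v) \<in> Y" unfolding \<sigma> using Y y0 by simp_all
        have 2: "\<sigma> q = e (q + u) q (\<sigma> (q + u))" "\<sigma> q = e (q + v) q (\<sigma> (q + v))"
          "\<sigma> (q + u) = e (q + u + v) (q + u) (\<sigma> (q + u + v))" "\<sigma> (q + v) = e (q + u + v) (q + v) (\<sigma> (q + u + v))"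
          by (metis 1(1) inv sides(1) Y'(1), metis 1(2) inv sides(2) Y'(1),
              metis 1(3) inv sides(3) Y'(2), metis 1(4) inv sides(4) Y'(3))
        have "(c, d) \<in> {(q, q+u), (q+u, q), (q, q+v), (q+v, q), (q+u, q+u+v), (q+u+v, q+u), (q+v, q+u+v), (q+u+v, q+v)}"
          using side_cases[OF n(1), of q c d] that n(2) by simp
        then have "c = q \<and> d = q+u \<or> c = q+u \<and> d = q \<or> c = q \<and> d = q+v \<or> c = q+v \<and> d = q \<or>
            c = q+u \<and> d = q+u+v \<or> c = q+u+v \<and> d = q+u \<or> c = q+v \<and> d = q+u+v \<or> c = q+u+v \<and> d = q+v"
          by (simp only: insert_iff empty_iff prod.inject simp_thms)
        then show ?thesis by (elim disjE conjE; hypsubst) (rule 1 2)+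
      qed
      ultimately have "\<sigma> \<in> Sec T" by (simp add: Sec_def)
      then show ?thesis using \<sigma> by blast
    qed
    have "a = q \<or> a = q + u \<or> a = q + u + v \<or> a = q + v" using a unfolding n(2) verts_rh[OF n(1)] by simp
    then show "\<exists>\<sigma>\<in>Sec T. \<sigma> a = y"
    proof (elim disjE)
      assume "a = q" then show ?thesis using ex[OF y] by blast
    next
      assume "a = q + u"
      moreover have "e (q + u) q y \<in> Y" "e q (q + u) (e (q + u) q y) = y" using closed inv sides sides' y by blast+
      ultimately show ?thesis using ex[of "e (q + u) q y"] by metis
    next
      assume "a = q + v"
      moreover have "e (q + v) q y \<in> Y" "e q (q + v) (e (q + v) q y) = y" using closed inv sides sides' y by blast+
      ultimately show ?thesis using ex[of "e (q + v) q y"] by metis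
    next
      assume aa: "a = q + u + v"
      define y1 where "y1 = e (q + u + v) (q + u) y"
      have 1: "y1 \<in> Y" "e (q + u) (q + u + v) y1 = y" unfolding y1_def using closed inv sides sides' y by blast+
      have 2: "e (q + u) q y1 \<in> Y" "e q (q + u) (e (q + u) q y1) = y1" using closed inv sides sides' 1 by blast+
      show ?thesis using ex[OF 2(1)] 1 2 aa by metis
    qed
  qed
  obtain s where s: "s p = y" "\<And>T. T \<in> \<Lambda> \<Longrightarrow> \<exists>\<sigma>\<in>Sec T. \<forall>a\<in>verts T. s a = \<sigma> a" "\<And>a. a \<in> \<V> \<Longrightarrow> s a \<in> Y"
    using global_section[OF p] by blast
  have "s b = e a b (s a)" if ab: "(a, b) \<in> \<E>" for a b
  proof -
    obtain T where T: "T \<in> \<Lambda>" "side T a b" using ab by (auto simp: ledges_side)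
    obtain \<sigma> where \<sigma>: "\<sigma> \<in> Sec T" "\<forall>a\<in>verts T. s a = \<sigma> a" using s(2)[OF T(1)] by blast
    have "\<sigma> b = e a b (\<sigma> a)" using \<sigma>(1) T(2) by (simp add: Sec_def)
    then show ?thesis using \<sigma>(2) side_verts(1,2)[OF T(2)] by simp
  qed
  then show thesis using that s by blast
qed

text \<open>The Poincare lemma for 1-cochains: transport by translations.\<close>

lemma additive_potential:
  fixes \<omega> :: "complex \<Rightarrow> complex \<Rightarrow> 'g::ab_group_add"
  assumes antisym: "\<And>a b. (a, b) \<in> \<E> \<Longrightarrow> \<omega> b a = - \<omega> a b"
    and face: "\<And>q u v. nondeg u v \<Longrightarrow> rh q u v \<in> \<Lambda> \<Longrightarrow>
      \<omega> q (q + u) + \<omega> (q + u) (q + u + v) = \<omega> q (q + v) + \<omega> (q + v) (q + u + v)"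
  obtains F where "\<And>a b. (a, b) \<in> \<E> \<Longrightarrow> F b = F a + \<omega> a b"
proof -
  obtain p where p: "p \<in> \<V>" using corner_lverts by blast
  have "\<exists>F. \<forall>a b. (a, b) \<in> \<E> \<longrightarrow> F b = F a + \<omega> a b"
  proof (rule edge_section[where e = "\<lambda>a b y. y + \<omega> a b" and Y = UNIV and p = p and y = 0])
    fix T assume T: "T \<in> \<Lambda>"
    obtain q u v where n: "nondeg u v" "T = rh q u v" using T by (elim tileE)
    then show "\<exists>q u v. nondeg u v \<and> T = rh q u v \<and> (\<forall>y\<in>UNIV.
        y + \<omega> q (q + u) + \<omega> (q + u) (q + u + v) = y + \<omega> q (q + v) + \<omega> (q + v) (q + u + v))"
      using face[of u v q] T by (auto simp: add.assoc)
  qed (use antisym p in auto)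
  then show thesis using that by blast
qed

lemma ledges_connected:
  assumes p: "p \<in> \<V>" and x: "x \<in> \<V>"
  shows "(p, x) \<in> (\<E>)\<^sup>*"
proof -
  have "(corner p, corner x) \<in> (\<E>)\<^sup>*"
  proof (rule tile_chain[where Q = "\<lambda>a b. (corner a, corner b) \<in> (\<E>)\<^sup>*"])
    fix T and r r' :: real
    assume T: "T \<in> \<Lambda>" and ab: "p + of_real r * (x - p) \<in> T" "p + of_real r' * (x - p) \<in> T"
    have e: "(c, d) \<in> (\<E>)\<^sup>*" if "side T c d" for c d using that T ledges_side by (meson r_into_rtrancl)
    show "(corner (p + of_real r * (x - p)), corner (p + of_real r' * (x - p))) \<in> (\<E>)\<^sup>*"
      using tile_verts_edges[OF T corner_verts[OF T ab(1)] corner_verts[OF T ab(2)]] e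
      by (metis rtrancl.rtrancl_refl rtrancl_trans)
  qed (rule rtrancl_trans)
  then show ?thesis using p x by (simp add: corner_vertex)
qed

lemma lverts_induct:
  assumes "p \<in> \<V>" "x \<in> \<V>" "P p" "\<And>a b. (a, b) \<in> \<E> \<Longrightarrow> P a \<Longrightarrow> P b"
  shows "P x"
  using ledges_connected[OF assms(1,2)] by (induction rule: rtrancl_induct) (use assms(3,4) in auto)

lemma lpath_exists:
  assumes "a \<in> \<V>" "b \<in> \<V>" shows "\<exists>p. lpath \<Lambda> p a b"
proof (rule lverts_induct[OF assms])
  show "\<exists>p. lpath \<Lambda> p a a" using assms(1) by (intro exI[of _ "[a]"]) (simp add: lpath_def)
  fix x y assume xy: "(x, y) \<in> \<E>" and "\<exists>p. lpath \<Lambda> p a x"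
  then obtain p where p: "lpath \<Lambda> p a x" by blast
  have "lpath \<Lambda> (p @ [y]) a y"
    unfolding lpath_def
  proof (intro conjI allI impI)
    fix n assume n: "1 \<le> n \<and> n < length (p @ [y])"
    show "((p @ [y]) ! (n - 1), (p @ [y]) ! n) \<in> \<E>"
    proof (cases "n = length p")
      case True
      then have "(p @ [y]) ! (n - 1) = x" using p n last_conv_nth[of p] by (auto simp: lpath_def nth_append)
      then show ?thesis using True xy by simp
    next
      case False then show ?thesis using p n by (auto simp: lpath_def nth_append)
    qed
  qed (use p xy ledges_lverts[OF xy] in \<open>auto simp: lpath_def\<close>)
  then show "\<exists>p. lpath \<Lambda> p a y" by blast
qed

lemma path_integral_primitive:
  assumes F: "\<And>x y. (x, y) \<in> \<E> \<Longrightarrow> F y = F x + (f x + f y) / 2 * (y - x)" and p: "lpath \<Lambda> p a b"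
  shows "path_integral f p = F b - F a"
proof -
  have ne: "p \<noteq> []" using p by (simp add: lpath_def)
  have "path_integral f p = (\<Sum>n = 1..<length p. F (p ! n) - F (p ! (n - 1)))"
    unfolding path_integral_def
  proof (rule sum.cong[OF refl])
    fix n assume "n \<in> {1..<length p}"
    then have "(p ! (n - 1), p ! n) \<in> \<E>" using p by (simp add: lpath_def)
    from F[OF this] show "(f (p ! (n - 1)) + f (p ! n)) / 2 * (p ! n - p ! (n - 1)) = F (p ! n) - F (p ! (n - 1))" by simp
  qed
  also have "\<dots> = (\<Sum>n<length p - 1. F (p ! Suc n) - F (p ! n))"
    by (rule sum.reindex_bij_witness[of _ Suc "\<lambda>n. n - 1"]) auto
  also have "\<dots> = F (p ! (length p - 1)) - F (p ! 0)" by (rule sum_lessThan_telescope)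
  also have "\<dots> = F b - F a" using p ne by (simp add: lpath_def hd_conv_nth last_conv_nth)
  finally show ?thesis .
qed

text \<open>The discrete Cauchy-Riemann equation: the difference quotients along the two diagonals of a
  rhombus coincide.  The left-hand side is twice the integral around the rhombus.\<close>

definition face_analytic :: "(complex \<Rightarrow> complex) \<Rightarrow> bool" where
  "face_analytic f \<longleftrightarrow> (\<forall>q u v. nondeg u v \<longrightarrow> rh q u v \<in> \<Lambda> \<longrightarrow>
     (f q - f (q + u + v)) * (u - v) + (f (q + u) - f (q + v)) * (u + v) = 0)"

lemma DA_face_analytic: assumes f: "f \<in> DA \<Lambda>" shows "face_analytic f"
  unfolding face_analytic_def
proof (intro allI impI)
  fix q u v assume n: "nondeg u v" and T: "rh q u v \<in> \<Lambda>"
  let ?p = "[q, q + u, q + u + v, q + v, q]"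
  note sides = tile_edges[OF n T]
  note sides' = sides[THEN ledges_sym]
  have "lpath \<Lambda> ?p q q"
    unfolding lpath_def
  proof (intro conjI allI impI)
    show "set ?p \<subseteq> \<V>" using sides ledges_lverts by auto
    fix k assume "1 \<le> k \<and> k < length ?p"
    then have "k \<in> {1, 2, 3, 4}" by auto
    then show "(?p ! (k - 1), ?p ! k) \<in> \<E>" using sides sides' by (auto simp: numeral_eq_Suc)
  qed auto
  then have 0: "path_integral f ?p = 0" using f unfolding DA_def by blast
  have "{1..<length ?p} = {1, 2, 3, 4}" by auto
  then have "path_integral f ?p = (\<Sum>n\<in>{1, 2, 3, 4}. (f (?p ! (n - 1)) + f (?p ! n)) / 2 * (?p ! n - ?p ! (n - 1)))"
    by (simp only: path_integral_def)
  also have "\<dots> = (f q + f (q + u)) / 2 * u + (f (q + u) + f (q + u + v)) / 2 * v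
    + (f (q + u + v) + f (q + v)) / 2 * (- u) + (f (q + v) + f q) / 2 * (- v)"
    by (simp add: numeral_eq_Suc)
  also have "\<dots> = ((f q - f (q + u + v)) * (u - v) + (f (q + u) - f (q + v)) * (u + v)) / 2"
    by (simp add: field_simps)
  finally show "(f q - f (q + u + v)) * (u - v) + (f (q + u) - f (q + v)) * (u + v) = 0" using 0 by simp
qed

lemma face_analytic_primitive:
  assumes "face_analytic f"
  obtains F where "\<And>a b. (a, b) \<in> \<E> \<Longrightarrow> F b = F a + (f a + f b) / 2 * (b - a)"
proof (rule additive_potential[of "\<lambda>a b. (f a + f b) / 2 * (b - a)"])
  fix q u v assume "nondeg u v" "rh q u v \<in> \<Lambda>"
  then have "(f q - f (q + u + v)) * (u - v) + (f (q + u) - f (q + v)) * (u + v) = 0"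
    using assms by (simp add: face_analytic_def)
  then have "((f q - f (q + u + v)) * (u - v) + (f (q + u) - f (q + v)) * (u + v)) / 2 = 0" by simp
  moreover have "(f q + f (q + u)) / 2 * (q + u - q) + (f (q + u) + f (q + u + v)) / 2 * (q + u + v - (q + u)) -
      ((f q + f (q + v)) / 2 * (q + v - q) + (f (q + v) + f (q + u + v)) / 2 * (q + u + v - (q + v)))
    = ((f q - f (q + u + v)) * (u - v) + (f (q + u) - f (q + v)) * (u + v)) / 2"
    by (simp add: field_simps)
  ultimately show "(f q + f (q + u)) / 2 * (q + u - q) + (f (q + u) + f (q + u + v)) / 2 * (q + u + v - (q + u)) =
      (f q + f (q + v)) / 2 * (q + v - q) + (f (q + v) + f (q + u + v)) / 2 * (q + u + v - (q + v))"
    by simp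
qed (use that in \<open>auto simp: field_simps\<close>)

lemma DA_I:
  assumes "f \<in> extensional \<V>" "\<And>a b. (a, b) \<in> \<E> \<Longrightarrow> F b = F a + (f a + f b) / 2 * (b - a)"
  shows "f \<in> DA \<Lambda>"
  using path_integral_primitive[of F f, OF assms(2)] assms(1) by (auto simp: DA_def)

lemma DA_integral_primitive:
  assumes "\<And>a b. (a, b) \<in> \<E> \<Longrightarrow> F b = F a + (f a + f b) / 2 * (b - a)" "a \<in> \<V>" "b \<in> \<V>"
  shows "DA_integral \<Lambda> f a b = F b - F a"
  unfolding DA_integral_def
  by (rule path_integral_primitive[of F f, OF assms(1)]) (use someI_ex[OF lpath_exists[OF assms(2,3)]] in auto)

end

locale rhombic_plane_lattice =
  fixes \<Lambda> :: "complex set set"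
  assumes lattice: "rhombic_lattice \<Lambda>"
begin

sublocale rhombic_tiling \<Lambda>
  by standard (use lattice in \<open>simp add: rhombic_lattice_def\<close>)

lemma zero_lvert: "0 \<in> \<V>"
  using lattice by (simp add: rhombic_lattice_def)

text \<open>The edge form of \<open>Z\<^sub>+ f = h - h 0\<close>; see \<open>shift_eq_Zplus\<close> and \<open>shift_eq_DA\<close>.\<close>

definition shift_eq :: "(complex \<Rightarrow> complex) \<Rightarrow> (complex \<Rightarrow> complex) \<Rightarrow> bool" where
  "shift_eq h f \<longleftrightarrow> (\<forall>a b. (a, b) \<in> \<E> \<longrightarrow>
     h b - h a = f b * (b - a - 1) / 2 + f a * (b - a + 1) / 2)"

lemma shift_eqD: "shift_eq h f \<Longrightarrow> (a, b) \<in> \<E> \<Longrightarrow>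
     h b - h a = f b * (b - a - 1) / 2 + f a * (b - a + 1) / 2"
  by (simp add: shift_eq_def)

lemma shift_eqD': assumes "shift_eq h f" "(a, b) \<in> \<E>"
  shows "h b = h a + (f b * (b - a - 1) / 2 + f a * (b - a + 1) / 2)"
  using shift_eqD[OF assms] by (simp only: diff_eq_eq add.commute)

lemma shift_eq_Zplus: assumes "f \<in> DA \<Lambda>" shows "shift_eq (Zplus \<Lambda> f) f"
proof -
  obtain F where F: "\<And>a b. (a, b) \<in> \<E> \<Longrightarrow> F b = F a + (f a + f b) / 2 * (b - a)"
    using face_analytic_primitive[OF DA_face_analytic[OF assms]] by blast
  have Z: "Zplus \<Lambda> f z = (f 0 - f z) / 2 + (F z - F 0)" if "z \<in> \<V>" for z
    using DA_integral_primitive[OF F zero_lvert that] that by (simp add: Zplus_def)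
  show ?thesis
    unfolding shift_eq_def
  proof (intro allI impI)
    fix a b assume ab: "(a, b) \<in> \<E>"
    show "Zplus \<Lambda> f b - Zplus \<Lambda> f a = f b * (b - a - 1) / 2 + f a * (b - a + 1) / 2"
      using ledges_lverts[OF ab] by (simp add: Z F[OF ab]) (simp add: field_simps)
  qed
qed

text \<open>The equation states that \<open>h + f / 2\<close> is a primitive of \<open>f\<close>.\<close>

lemma shift_eq_DA:
  assumes f: "f \<in> extensional \<V>" and eq: "shift_eq h f"
  shows "f \<in> DA \<Lambda>" "Zplus \<Lambda> f = (\<lambda>z\<in>\<V>. h z - h 0)"
proof -
  let ?F = "\<lambda>z. h z + f z / 2"
  have F: "?F b = ?F a + (f a + f b) / 2 * (b - a)" if "(a, b) \<in> \<E>" for a b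
    by (simp add: shift_eqD'[OF eq that]) (simp add: field_simps)
  show "f \<in> DA \<Lambda>" by (rule DA_I[OF f F])
  show "Zplus \<Lambda> f = (\<lambda>z\<in>\<V>. h z - h 0)"
    unfolding Zplus_def
    by (rule restrict_ext) (simp add: DA_integral_primitive[OF F zero_lvert] field_simps)
qed

lemma Zplus_zero: assumes "f \<in> DA \<Lambda>" shows "Zplus \<Lambda> f 0 = 0"
proof -
  obtain F where F: "\<And>a b. (a, b) \<in> \<E> \<Longrightarrow> F b = F a + (f a + f b) / 2 * (b - a)"
    using face_analytic_primitive[OF DA_face_analytic[OF assms]] by blast
  show ?thesis using DA_integral_primitive[OF F zero_lvert zero_lvert] zero_lvert by (simp add: Zplus_def)
qed

lemma path_to_unit_step:
  assumes "z \<in> \<V>"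
  shows "\<exists>p. (z, p) \<in> {(a, b) \<in> \<E>. b - a \<noteq> 1 \<and> b - a \<noteq> - 1}\<^sup>* \<and> (p, p + 1) \<in> \<E>"
proof -
  obtain N p w where N: "1 \<le> N" "lpath \<Lambda> p z w" "length p = N + 1"
    "\<And>n. n \<in> {1..N - 1} \<Longrightarrow> p ! n - p ! (n - 1) \<noteq> 1 \<and> p ! n - p ! (n - 1) \<noteq> - 1" "p ! N - p ! (N - 1) = 1"
    using lattice assms unfolding rhombic_lattice_def by blast
  have e: "(p ! (n - 1), p ! n) \<in> \<E>" if "1 \<le> n" "n \<le> N" for n
    using N(2,3) that by (simp add: lpath_def)
  have "(z, p ! n) \<in> {(a, b) \<in> \<E>. b - a \<noteq> 1 \<and> b - a \<noteq> - 1}\<^sup>*" if "n \<le> N - 1" for n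
    using that
  proof (induction n)
    case 0
    have "z = p ! 0" using N(2) by (auto simp: lpath_def hd_conv_nth)
    then show ?case by simp
  next
    case (Suc n)
    then have "(p ! n, p ! Suc n) \<in> {(a, b) \<in> \<E>. b - a \<noteq> 1 \<and> b - a \<noteq> - 1}"
      using e[of "Suc n"] N(4)[of "Suc n"] by auto
    then show ?case using Suc by (meson Suc_leD rtrancl.rtrancl_into_rtrancl)
  qed
  moreover have "p ! N = p ! (N - 1) + 1" using N(5) by (simp add: algebra_simps)
  then have "(p ! (N - 1), p ! (N - 1) + 1) \<in> \<E>" using e[of N] N(1) by simp
  ultimately show ?thesis by blast
qed

text \<open>On a step of 1 the equation determines \<open>f\<close> at the left end, and on the other steps it carries this
  information back along the path that leads from \<open>z\<close> to such a step.\<close>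

lemma shift_eq_unique:
  assumes "shift_eq h f" "shift_eq h g" "z \<in> \<V>" shows "f z = g z"
proof -
  obtain p where p: "(z, p) \<in> {(a, b) \<in> \<E>. b - a \<noteq> 1 \<and> b - a \<noteq> - 1}\<^sup>*" "(p, p + 1) \<in> \<E>"
    using path_to_unit_step[OF assms(3)] by blast
  have "f p = g p" using shift_eqD[OF assms(1) p(2)] shift_eqD[OF assms(2) p(2)] by simp
  with p(1) show ?thesis
  proof (induction rule: converse_rtrancl_induct)
    case (step a b)
    then have ab: "(a, b) \<in> \<E>" "b - a + 1 \<noteq> 0" by (auto simp: add_eq_0_iff2)
    have "f a * (b - a + 1) = g a * (b - a + 1)"
      using shift_eqD[OF assms(1) ab(1)] shift_eqD[OF assms(2) ab(1)] step by auto
    then show ?case using ab(2) by simp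
  qed
qed

lemma Zminus_eqI:
  assumes f: "f \<in> extensional \<V>" and eq: "shift_eq h f"
  shows "Zminus \<Lambda> h = f"
  unfolding Zminus_def
proof (rule the_equality)
  show "f \<in> DA \<Lambda> \<and> Zplus \<Lambda> f = (\<lambda>z\<in>\<V>. h z - h 0)" using shift_eq_DA[OF assms] by simp
  fix g assume g: "g \<in> DA \<Lambda> \<and> Zplus \<Lambda> g = (\<lambda>z\<in>\<V>. h z - h 0)"
  have "shift_eq (\<lambda>z\<in>\<V>. h z - h 0) g" using shift_eq_Zplus[of g] g by simp
  then have "shift_eq h g" using ledges_lverts unfolding shift_eq_def by auto
  then have "g z = f z" if "z \<in> \<V>" for z using shift_eq_unique[OF _ eq that] by blast
  moreover have "g \<in> extensional \<V>" using g by (simp add: DA_def)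
  ultimately show "g = f" using f extensionalityI by blast
qed

end

section \<open>Strips of rhombi with horizontal sides\<close>

text \<open>Since \<open>\<eta>\<close> grows, every orbit of \<open>\<tau>\<close> is a copy of the integers and passes height 0 exactly once.  The last point
  of negative height receives an arbitrary value; from there \<open>c\<close> leads upwards and \<open>c'\<close> downwards.\<close>

lemma orbit_recursion:
  fixes \<eta> :: "'a \<Rightarrow> real" and c :: "'a \<Rightarrow> 'y \<Rightarrow> 'y"
  assumes bij: "bij_betw \<tau> P P" and \<delta>: "\<delta> > 0" and up: "\<And>q. q \<in> P \<Longrightarrow> \<eta> (\<tau> q) \<ge> \<eta> q + \<delta>"
    and inv: "\<And>q y. q \<in> P \<Longrightarrow> c q (c' q y) = y"
  shows "\<exists>\<sigma>. \<forall>q\<in>P. \<sigma> (\<tau> q) = c q (\<sigma> q)"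
proof -
  define \<tau>i where "\<tau>i = inv_into P \<tau>"
  have \<tau>P: "\<tau> q \<in> P" if "q \<in> P" for q using bij that by (rule bij_betwE[THEN bspec])
  have \<tau>iP: "\<tau>i q \<in> P" "\<tau> (\<tau>i q) = q" if "q \<in> P" for q
    using bij that unfolding \<tau>i_def bij_betw_def by (metis inv_into_into, metis f_inv_into_f)
  have \<tau>i\<tau>: "\<tau>i (\<tau> q) = q" if "q \<in> P" for q
    using bij that unfolding \<tau>i_def by (simp add: bij_betw_def)
  have iter: "(\<tau> ^^ n) q \<in> P \<and> \<eta> ((\<tau> ^^ n) q) \<ge> \<eta> q + real n * \<delta>" if "q \<in> P" for n q
  proof (induction n)
    case (Suc n)
    then show ?case using up[of "(\<tau> ^^ n) q"] \<tau>P by (auto simp: algebra_simps)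
  qed (use that in simp)
  have iteri: "(\<tau>i ^^ n) q \<in> P \<and> \<eta> ((\<tau>i ^^ n) q) \<le> \<eta> q - real n * \<delta>" if "q \<in> P" for n q
  proof (induction n)
    case (Suc n)
    then show ?case using up[of "\<tau>i ((\<tau>i ^^ n) q)"] \<tau>iP by (auto simp: algebra_simps)
  qed (use that in simp)
  define n where "n q = (LEAST k. \<eta> ((\<tau>i ^^ k) q) < 0)" for q
  define m where "m q = (LEAST k. \<eta> ((\<tau> ^^ k) q) \<ge> 0)" for q
  have exn: "\<exists>k. \<eta> ((\<tau>i ^^ k) q) < 0" if "q \<in> P" for q
  proof -
    obtain k where "real k * \<delta> > \<eta> q" using reals_Archimedean3[OF \<delta>] by blast
    then show ?thesis using iteri[OF that, of k] by (intro exI[of _ k]) linarith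
  qed
  have exm: "\<exists>k. \<eta> ((\<tau> ^^ k) q) \<ge> 0" if "q \<in> P" for q
  proof -
    obtain k where "real k * \<delta> > - \<eta> q" using reals_Archimedean3[OF \<delta>] by blast
    then show ?thesis using iter[OF that, of k] by (intro exI[of _ k]) linarith
  qed
  have nS: "n (\<tau> q) = Suc (n q)" if q: "q \<in> P" "\<eta> (\<tau> q) \<ge> 0" for q
  proof -
    obtain k where k: "\<eta> ((\<tau>i ^^ k) (\<tau> q)) < 0" using exn[OF \<tau>P[OF q(1)]] by blast
    have "n (\<tau> q) = Suc (LEAST k. \<eta> ((\<tau>i ^^ Suc k) (\<tau> q)) < 0)"
      unfolding n_def by (rule Least_Suc[where P = "\<lambda>k. \<eta> ((\<tau>i ^^ k) (\<tau> q)) < 0", OF k]) (use q(2) in simp)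
    also have "(\<lambda>k. \<eta> ((\<tau>i ^^ Suc k) (\<tau> q)) < 0) = (\<lambda>k. \<eta> ((\<tau>i ^^ k) q) < 0)"
      by (simp add: funpow_Suc_right \<tau>i\<tau>[OF q(1)] del: funpow.simps)
    finally show ?thesis by (simp add: n_def)
  qed
  have n0: "n q = 0" if "\<eta> q < 0" for q
    unfolding n_def by (rule Least_eq_0) (use that in simp)
  have mS: "m q = Suc (m (\<tau> q))" if q: "q \<in> P" "\<eta> q < 0" for q
  proof -
    obtain k where k: "\<eta> ((\<tau> ^^ k) q) \<ge> 0" using exm[OF q(1)] by blast
    have "m q = Suc (LEAST k. \<eta> ((\<tau> ^^ Suc k) q) \<ge> 0)"
      unfolding m_def by (rule Least_Suc[where P = "\<lambda>k. \<eta> ((\<tau> ^^ k) q) \<ge> 0", OF k]) (use q(2) in simp)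
    also have "(\<lambda>k. \<eta> ((\<tau> ^^ Suc k) q) \<ge> 0) = (\<lambda>k. \<eta> ((\<tau> ^^ k) (\<tau> q)) \<ge> 0)"
      by (simp add: funpow_Suc_right del: funpow.simps)
    finally show ?thesis by (simp add: m_def)
  qed
  have m0: "m q = 0" if "\<eta> q \<ge> 0" for q
    unfolding m_def by (rule Least_eq_0) (use that in simp)
  \<comment> \<open>The step counts \<open>n q\<close> and \<open>m q - 1\<close> vanish at the last point below 0, so \<open>undefined\<close> is the arbitrary value.\<close>
  define G where "G = rec_nat (\<lambda>q. undefined) (\<lambda>k g q. c (\<tau>i q) (g (\<tau>i q)))"
  define H where "H = rec_nat (\<lambda>q. undefined) (\<lambda>k g q. c' q (g (\<tau> q)))"
  have G: "G (Suc k) q = c (\<tau>i q) (G k (\<tau>i q))" "G 0 q = undefined" for k q by (simp_all add: G_def)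
  have H: "H (Suc k) q = c' q (H k (\<tau> q))" "H 0 q = undefined" for k q by (simp_all add: H_def)
  define \<sigma> where "\<sigma> q = (if \<eta> q \<ge> 0 then G (n q) q else H (m q - 1) q)" for q
  have "\<sigma> (\<tau> q) = c q (\<sigma> q)" if q: "q \<in> P" for q
  proof (cases "\<eta> (\<tau> q) \<ge> 0")
    case True
    show ?thesis
    proof (cases "\<eta> q \<ge> 0")
      case T: True
      then show ?thesis using True by (simp add: \<sigma>_def nS[OF q True] G \<tau>i\<tau>[OF q])
    next
      case F: False
      then show ?thesis using True by (simp add: \<sigma>_def nS[OF q True] n0 G \<tau>i\<tau>[OF q] mS[OF q] m0 H)
    qed
  next
    case False
    then have F: "\<eta> q < 0" using up[OF q] \<delta> by simp
    have "m q = Suc (Suc (m (\<tau> (\<tau> q))))" using mS[OF q F] mS[OF \<tau>P[OF q]] False by simp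
    then show ?thesis using False F mS[OF \<tau>P[OF q]] inv[OF q] by (simp add: \<sigma>_def H)
  qed
  then show ?thesis by blast
qed

context rhombic_tiling
begin

text \<open>A tile that contains a point a little to the left of the midpoint of the edge contains the midpoint by local
  finiteness, and then the whole edge, as tiles intersect in faces.\<close>

lemma tile_left_of_edge:
  assumes "(a, b) \<in> \<E>"
  shows "\<exists>v. nondeg (b - a) v \<and> rh a (b - a) v \<in> \<Lambda> \<and> cross (b - a) v > 0"
proof -
  obtain T1 where T1: "T1 \<in> \<Lambda>" "side T1 a b" using assms by (auto simp: ledges_side)
  define m where "m = midpoint a b"
  obtain e where e: "e > 0" "\<And>T y. T \<in> \<Lambda> \<Longrightarrow> y \<in> T \<Longrightarrow> dist m y < e \<Longrightarrow> m \<in> T"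
    using tiles_near[of m] by blast
  define x where "x = m + of_real (e / 2) * (\<i> * (b - a))"
  have "dist m x = e / 2"
    using ledges_norm[OF assms] e(1) by (simp add: x_def dist_norm norm_mult)
  obtain T where T: "T \<in> \<Lambda>" "x \<in> T" by (rule tile_cover)
  have mT: "m \<in> T" using e(2)[OF T] \<open>dist m x = e / 2\<close> e(1) by simp
  have ab: "a \<in> verts T1" "b \<in> verts T1" "a \<noteq> b" using side_verts[OF T1(2)] by auto
  have mo: "m \<in> open_segment a b" unfolding m_def using ab(3) by simp
  have aT1: "a \<in> T1" "b \<in> T1" using ab verts_subset by auto
  then have "m \<in> T1" using mo tile_convex[OF T1(1)] by (meson convex_contains_open_segment subsetD)
  then have "a \<in> T1 \<inter> T \<and> b \<in> T1 \<inter> T"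
    using face_ofD[OF tile_face(1)[OF T1(1) T(1)] mo] aT1 mT by auto
  then have abT: "a \<in> T" "b \<in> T" by auto
  have v: "a \<in> verts T" "b \<in> verts T" using lverts_in_tile[OF _ T(1)] abT ledges_lverts[OF assms] by blast+
  have "side T a b"
  proof (cases "T = T1")
    case False
    show ?thesis by (rule common_verts[OF T(1) T1(1) False v aT1 ab(3)])
  qed (use T1 in simp)
  then obtain v where v: "nondeg (b - a) v" "T = rh a (b - a) v" by (auto simp: side_def)
  obtain s t where st: "x = a + of_real s * (b - a) + of_real t * v" "0 \<le> t" using T(2) unfolding v(2) by (rule rh_memE)
  have "cross (b - a) (x - a) = t * cross (b - a) v"
    unfolding st(1) by (simp add: cross_def algebra_simps)
  moreover have "cross (b - a) (x - a) = e / 2"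
  proof -
    have "x - a = of_real (1/2) * (b - a) + of_real (e / 2) * (\<i> * (b - a))"
      by (simp add: x_def m_def midpoint_def scaleR_conv_of_real field_simps)
    then have "cross (b - a) (x - a) = e / 2 * cross (b - a) (\<i> * (b - a))"
      by (simp only: cross_simps)
    also have "cross (b - a) (\<i> * (b - a)) = (cmod (b - a))\<^sup>2"
      unfolding cmod_power2 by (simp add: cross_def algebra_simps power2_eq_square)
    finally show ?thesis using ledges_norm[OF assms] by simp
  qed
  ultimately have "cross (b - a) v > 0" using e(1) st(2)
    by (metis half_gt_zero mult_nonneg_nonpos not_le)
  then show ?thesis using v T(1) by blast
qed

text \<open>The rhombi with horizontal sides, given by the left end of the lower side and the direction that leads
  upwards.  Stacked along their horizontal sides, they form strips.\<close>

definition up :: "complex \<Rightarrow> complex \<Rightarrow> bool" where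
  "up q v \<longleftrightarrow> norm v = 1 \<and> Im v > 0 \<and> rh q 1 v \<in> \<Lambda>"

lemma up_nondeg: "up q v \<Longrightarrow> nondeg 1 v" and up_neq: "up q v \<Longrightarrow> v \<noteq> 1 \<and> v \<noteq> - 1"
  by (auto simp: up_def nondeg_def complex_eq_iff)

lemma up_exists: assumes "(q, q + 1) \<in> \<E>" obtains v where "up q v"
  using tile_left_of_edge[OF assms] by (auto simp: up_def nondeg_def)

lemma down_exists: assumes "(q, q + 1) \<in> \<E>" obtains r v where "up r v" "r + v = q"
proof -
  obtain v where v: "nondeg (-1) v" "rh (q + 1) (-1) v \<in> \<Lambda>" "cross (-1) v > 0"
    using tile_left_of_edge[OF ledges_sym[OF assms]] by auto
  have "rh q 1 v = rh (q + v) 1 (- v)" "rh q 1 v = rh (q + 1) (- 1) v" by (rule rh_corners)+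
  then have "up (q + v) (- v)" using v by (simp add: up_def nondeg_def)
  then show thesis using that by simp
qed

lemma up_edges:
  assumes "up q v" shows "(q, q + 1) \<in> \<E>" "(q + v, q + v + 1) \<in> \<E>" "(q, q + v) \<in> \<E>"
    "(q + 1, q + 1 + v) \<in> \<E>"
proof -
  have "rh q 1 v \<in> \<Lambda>" using assms by (simp add: up_def)
  moreover have "q + v + 1 = q + 1 + v" by simp
  ultimately show "(q, q + 1) \<in> \<E>" "(q + v, q + v + 1) \<in> \<E>" "(q, q + v) \<in> \<E>"
    "(q + 1, q + 1 + v) \<in> \<E>"
    using tile_edges[OF up_nondeg[OF assms]] by metis+
qed

text \<open>A point close to the middle of the common side, on the side of the line to which both rhombi extend, is
  interior to both of them.\<close>

lemma same_side_unique:
  assumes "nondeg 1 v" "nondeg 1 w" "rh p 1 v \<in> \<Lambda>" "rh p 1 w \<in> \<Lambda>" "Im v * Im w > 0"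
  shows "v = w"
proof -
  \<comment> \<open>At a quarter of the smaller height the sides have drifted by at most a quarter, so the middle stays inside.\<close>
  define h where "h = sgn (Im v) * (min \<bar>Im v\<bar> \<bar>Im w\<bar> / 4)"
  have nz: "Im v \<noteq> 0" "Im w \<noteq> 0" using assms(5) by auto
  have sg: "sgn (Im v) = sgn (Im w)" using assms(5) by (auto simp: sgn_if zero_less_mult_iff)
  have int: "p + 1 / 2 + \<i> * of_real h \<in> interior (rh p 1 x)"
    if x: "nondeg 1 x" "Im x \<noteq> 0" "sgn (Im x) = sgn (Im v)" "min \<bar>Im v\<bar> \<bar>Im w\<bar> \<le> \<bar>Im x\<bar>" for x
  proof -
    define t where "t = h / Im x"
    have t: "t = (min \<bar>Im v\<bar> \<bar>Im w\<bar> / 4) / \<bar>Im x\<bar>"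
      unfolding t_def h_def x(3)[symmetric] using x(2) by (simp add: sgn_if)
    have t0: "0 < t" "t \<le> 1/4" unfolding t using x nz by (simp_all add: field_simps)
    define s where "s = 1/2 - t * Re x"
    have "\<bar>t * Re x\<bar> \<le> 1/4 * 1" unfolding abs_mult
      using t0 abs_Re_le_cmod[of x] x(1) by (intro mult_mono) (auto simp: nondeg_def)
    then have s: "0 < s" "s < 1" unfolding s_def by (auto simp: abs_le_iff)
    have "p + 1 / 2 + \<i> * of_real h = p + of_real s * 1 + of_real t * x"
      using x(2) by (simp add: complex_eq_iff s_def t_def)
    moreover have "p + of_real s * 1 + of_real t * x \<in> interior (rh p 1 x)"
      by (rule rh_interior[OF x(1) s]) (use t0 in auto)
    ultimately show ?thesis by (simp only:)
  qed
  have "p + 1 / 2 + \<i> * of_real h \<in> interior (rh p 1 v)" by (rule int) (use assms nz in auto)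
  moreover have "p + 1 / 2 + \<i> * of_real h \<in> interior (rh p 1 w)" by (rule int) (use assms nz sg in auto)
  ultimately have eq: "rh p 1 v = rh p 1 w" using tile_eqI[OF assms(3,4)] interior_subset by blast
  have "{p, p + 1, p + 1 + v, p + v} = {p, p + 1, p + 1 + w, p + w}"
    using verts_rh[OF assms(1), of p] verts_rh[OF assms(2), of p] eq by simp
  then have m: "p + v \<in> {p, p + 1, p + 1 + w, p + w}" "p + w \<in> {p, p + 1, p + 1 + v, p + v}" by blast+
  have "v = 1 + w \<or> v = w" using m(1) nz by (auto simp: add.assoc)
  moreover have "w = 1 + v \<or> w = v" using m(2) nz by (auto simp: add.assoc)
  ultimately show ?thesis by auto
qed

lemma up_unique: assumes "up q v" "up q w" shows "v = w"
  by (rule same_side_unique[of v w q]) (use assms up_nondeg in \<open>auto simp: up_def\<close>)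

lemma down_unique: assumes "up q v" "up r w" "q + v = r + w" shows "q = r"
proof -
  have "rh q 1 v = rh (q + v) 1 (- v)" "rh r 1 w = rh (r + w) 1 (- w)" by (rule rh_corners)+
  then have "rh (q + v) 1 (- v) \<in> \<Lambda>" "rh (q + v) 1 (- w) \<in> \<Lambda>" using assms by (simp_all add: up_def)
  moreover have "nondeg 1 (- v)" "nondeg 1 (- w)" using assms up_nondeg nondeg_minus(2) by blast+
  ultimately have "- v = - w"
    using same_side_unique[of "- v" "- w" "q + v"] assms by (simp add: up_def)
  then show ?thesis using assms(3) by simp
qed

text \<open>The rhombi cannot be arbitrarily flat, since each of them contains a ball of a fixed radius.\<close>

lemma up_height: obtains \<delta> where "\<delta> > 0" "\<And>q v. up q v \<Longrightarrow> Im v \<ge> \<delta>"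
proof -
  obtain r where r: "r > 0" "\<And>T. T \<in> \<Lambda> \<Longrightarrow> \<exists>c. ball c r \<subseteq> T" using inradius by blast
  have "r / 2 \<le> Im v" if u: "up q v" for q v
  proof -
    have "rh q 1 v \<in> \<Lambda>" using u by (simp add: up_def)
    then obtain c where c: "ball c r \<subseteq> rh q 1 v" using r(2) by blast
    have m: "c \<in> rh q 1 v" "c + \<i> * of_real (r / 2) \<in> rh q 1 v" using c r(1) by (auto simp: dist_norm norm_mult)
    have h: "Im q \<le> Im x \<and> Im x \<le> Im q + Im v" if x: "x \<in> rh q 1 v" for x
    proof -
      obtain s t where "x = q + of_real s * 1 + of_real t * v" "0 \<le> t" "t \<le> 1" using x by (rule rh_memE)
      then show ?thesis using u by (simp add: up_def mult_left_le_one_le)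
    qed
    show ?thesis using h[OF m(1)] h[OF m(2)] by simp
  qed
  then show thesis using that[of "r / 2"] r(1) by auto
qed

lemma tile_up_cases:
  assumes "T \<in> \<Lambda>"
  shows "(\<exists>q v. up q v \<and> T = rh q 1 v) \<or>
    (\<exists>q u v. nondeg u v \<and> T = rh q u v \<and> u \<noteq> 1 \<and> u \<noteq> - 1 \<and> v \<noteq> 1 \<and> v \<noteq> - 1)"
proof -
  have A: "\<exists>q v. up q v \<and> T = rh q 1 v" if n: "nondeg 1 v" "T = rh q 1 v" for q v
  proof (cases "Im v > 0")
    case True then show ?thesis using n assms by (auto simp: up_def nondeg_def)
  next
    case False
    have "Im v \<noteq> 0" using nondeg_cross[OF n(1)] by simp
    moreover have "T = rh (q + v) 1 (- v)" unfolding n(2) by (rule rh_corners)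
    ultimately have "up (q + v) (- v)" using False n assms by (simp add: up_def nondeg_def)
    then show ?thesis using \<open>T = rh (q + v) 1 (- v)\<close> by blast
  qed
  have B: "\<exists>q v. up q v \<and> T = rh q 1 v" if n: "nondeg u v" "T = rh q u v" "u = 1 \<or> u = -1" for q u v
  proof -
    have "T = rh (q + u) (- u) v" unfolding n(2) by (rule rh_corners)
    then show ?thesis using A[of v q] A[of v "q + u"] n nondeg_minus(1)[OF n(1)] by auto
  qed
  obtain q u v where n: "nondeg u v" "T = rh q u v" using assms by (elim tileE)
  show ?thesis using B[OF n] B[OF nondeg_sym[OF n(1)], of q] n rh_swap[of q u v] by metis
qed

text \<open>Each rhombus of a strip contributes at least \<open>\<delta>\<close> to the height, so the strip is unbounded in both
  directions.\<close>

lemma orbit_meets_height: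
  assumes q: "q \<in> Q" and QP: "\<And>r. r \<in> Q \<Longrightarrow> (r, r + 1) \<in> \<E>"
    and Qup: "\<And>r v. up r v \<Longrightarrow> r \<in> Q \<longleftrightarrow> r + v \<in> Q"
  obtains r v where "r \<in> Q" "up r v" "Im r \<le> y" "y < Im r + Im v"
proof -
  obtain \<delta> where \<delta>: "\<delta> > 0" "\<And>q v. up q v \<Longrightarrow> Im v \<ge> \<delta>" using up_height by blast
  have "\<exists>r v. r \<in> Q \<and> up r v \<and> Im r \<le> y \<and> y < Im r + Im v"
  proof (rule ccontr)
    assume no: "\<nexists>r v. r \<in> Q \<and> up r v \<and> Im r \<le> y \<and> y < Im r + Im v"
    show False
    proof (cases "Im q \<le> y")
      case True
      have "\<exists>r\<in>Q. Im r \<le> y \<and> Im q + real n * \<delta> \<le> Im r" for n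
      proof (induction n)
        case (Suc n)
        then obtain r where r: "r \<in> Q" "Im r \<le> y" "Im q + real n * \<delta> \<le> Im r" by blast
        obtain v where v: "up r v" using up_exists[OF QP[OF r(1)]] by blast
        have "Im (r + v) \<le> y" using no r v by fastforce
        then show ?case using Qup[OF v] r \<delta>(2)[OF v] by (intro bexI[of _ "r + v"]) (auto simp: algebra_simps)
      qed (use True q in auto)
      moreover obtain n where "real n * \<delta> > y - Im q" using reals_Archimedean3[OF \<delta>(1)] by blast
      ultimately show False by (metis add.commute diff_less_eq linorder_not_less order_trans)
    next
      case False
      have "\<exists>r\<in>Q. y < Im r \<and> Im r \<le> Im q - real n * \<delta>" for n
      proof (induction n)
        case (Suc n)
        then obtain r where r: "r \<in> Q" "y < Im r" "Im r \<le> Im q - real n * \<delta>" by blast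
        obtain r' v where v: "up r' v" "r' + v = r" using down_exists[OF QP[OF r(1)]] by blast
        have r': "r' \<in> Q" using Qup[OF v(1)] v(2) r(1) by simp
        have "Im r = Im r' + Im v" using v(2) by auto
        then have "y < Im r'" using no r' v(1) r(2) by force
        then show ?case using r' r \<delta>(2)[OF v(1)] \<open>Im r = Im r' + Im v\<close> by (intro bexI[of _ r']) (auto simp: algebra_simps)
      qed (use False q in \<open>auto intro!: bexI[of _ q]\<close>)
      moreover obtain n where "real n * \<delta> > Im q - y" using reals_Archimedean3[OF \<delta>(1)] by blast
      ultimately show False by (metis diff_less_eq add.commute less_le_not_le less_le_trans order_less_le)
    qed
  qed
  then show thesis using that by blast
qed

end

section \<open>Surjectivity of the forward shift\<close>

context rhombic_tiling
begin

definition unit_steps :: "complex \<Rightarrow> complex \<Rightarrow> real" where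
  "unit_steps a b = (if b - a = 1 then 1 else if b - a = - 1 then - 1 else 0)"

text \<open>Opposite sides of a rhombus contribute opposite terms, so counting the steps \<open>1\<close> and \<open>- 1\<close> along a path is a
  closed cochain.  Its potential numbers the regions between the strips from left to right.\<close>

lemma strip_index_exists:
  obtains K where "\<And>a b. (a, b) \<in> \<E> \<Longrightarrow> K b = K a + unit_steps a b"
proof (rule additive_potential[of unit_steps])
  fix a b :: complex show "unit_steps b a = - unit_steps a b"
    by (auto simp: unit_steps_def algebra_simps)
qed (use that in \<open>auto simp: unit_steps_def\<close>)

context
  fixes K :: "complex \<Rightarrow> real"
  assumes K: "\<And>a b. (a, b) \<in> \<E> \<Longrightarrow> K b = K a + unit_steps a b"
begin

lemma strip_index_tile:
  assumes "nondeg u v" "rh q u v \<in> \<Lambda>"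
  shows "K (q + u) = K q + unit_steps 0 u" "K (q + v) = K q + unit_steps 0 v"
    "K (q + u + v) = K q + unit_steps 0 u + unit_steps 0 v"
proof -
  note sides = tile_edges[OF assms, THEN K]
  show "K (q + u) = K q + unit_steps 0 u" "K (q + v) = K q + unit_steps 0 v"
    "K (q + u + v) = K q + unit_steps 0 u + unit_steps 0 v"
    using sides by (simp_all add: unit_steps_def)
qed

text \<open>At the corners of a tile the potential is an affine function of the position.  Its horizontal slope is 1
  if the tile has horizontal sides and 0 otherwise.\<close>

lemma strip_index_affine:
  assumes T: "T \<in> \<Lambda>"
  shows "\<exists>c w. (\<forall>b\<in>verts T. K b = c + inner w b) \<and> Re w \<ge> 0"
proof -
  obtain q u v where n: "nondeg u v" "T = rh q u v" using T by (elim tileE)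
  let ?c = "cross u v"
  have c: "?c \<noteq> 0" by (rule nondeg_cross[OF n(1)])
  note Kt = strip_index_tile[OF n(1), of q, folded n(2), OF T]
  define \<alpha> where "\<alpha> = unit_steps 0 u"
  define \<beta> where "\<beta> = unit_steps 0 v"
  \<comment> \<open>The vector with inner products \<open>\<alpha>\<close> with \<open>u\<close> and \<open>\<beta>\<close> with \<open>v\<close>, by Cramer's rule.\<close>
  define w where "w = (\<beta> / ?c) *\<^sub>R (\<i> * u) - (\<alpha> / ?c) *\<^sub>R (\<i> * v)"
  have w: "inner w x = (\<beta> * cross u x - \<alpha> * cross v x) / ?c" for x
    unfolding w_def inner_diff_left inner_scaleR_left cross_inner[symmetric] by (simp add: diff_divide_distrib)
  have wu: "inner w u = \<alpha>" "inner w v = \<beta>" unfolding w using c cross_commute[of v u] by simp_all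
  have "K b = (K q - inner w q) + inner w b" if "b \<in> verts T" for b
    using that Kt unfolding n(2) verts_rh[OF n(1)] by (auto simp: inner_add_right wu \<alpha>_def \<beta>_def)
  moreover have "Re w \<ge> 0"
  proof -
    show ?thesis
    proof (cases "u = 1 \<or> u = - 1")
      case True
      then show ?thesis using wu(1) by (auto simp: inner_complex_def \<alpha>_def unit_steps_def)
    next
      case u: False
      show ?thesis
      proof (cases "v = 1 \<or> v = - 1")
        case True
        then show ?thesis using wu(2) by (auto simp: inner_complex_def \<beta>_def unit_steps_def)
      next
        case False
        then show ?thesis using u by (simp add: w_def \<alpha>_def \<beta>_def unit_steps_def)
      qed
    qed
  qed
  ultimately show ?thesis by blast
qed

lemma tiles_inter_hull:
  assumes "S \<in> \<Lambda>" "T \<in> \<Lambda>" "x \<in> S" "x \<in> T"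
  shows "x \<in> convex hull (verts S \<inter> verts T)"
proof -
  have "compact (S \<inter> T)" "convex (S \<inter> T)"
    using assms tile_compact tile_convex by (auto intro: compact_Int convex_Int)
  then have "S \<inter> T = convex hull {v. v extreme_point_of (S \<inter> T)}" by (rule Krein_Milman_Minkowski)
  moreover have "{v. v extreme_point_of (S \<inter> T)} \<subseteq> verts S \<inter> verts T"
    using extreme_point_of_face[OF tile_face(1)[OF assms(1,2)]] extreme_point_of_face[OF tile_face(2)[OF assms(1,2)]]
    by auto
  ultimately show ?thesis using hull_mono[of "{v. v extreme_point_of (S \<inter> T)}" "verts S \<inter> verts T" convex] assms(3,4)
    by (metis IntI subsetD)
qed

text \<open>The affine functions of two tiles agree at the common corners and therefore on the intersection of the
  tiles, which is the convex hull of these corners.  The function \<open>k\<close> glued from them does not decrease along a horizontal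
  line, because it does not do so inside a tile.\<close>

lemma strip_index_monotone:
  obtains k :: "complex \<Rightarrow> real" where
    "\<And>a. a \<in> \<V> \<Longrightarrow> k a = K a"
    "\<And>x d. d \<ge> 0 \<Longrightarrow> k x \<le> k (x + of_real d)"
    "\<And>q v s t. up q v \<Longrightarrow> 0 \<le> s \<Longrightarrow> s \<le> 1 \<Longrightarrow> 0 \<le> t \<Longrightarrow> t \<le> 1 \<Longrightarrow> k (q + of_real s + of_real t * v) = K q + s"
proof -
  obtain c w where cw: "\<And>T. T \<in> \<Lambda> \<Longrightarrow> (\<forall>b\<in>verts T. K b = c T + inner (w T) b) \<and> Re (w T) \<ge> 0"
    using strip_index_affine by metis
  define tl where "tl z = (SOME T. T \<in> \<Lambda> \<and> z \<in> T)" for z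
  have tl: "tl z \<in> \<Lambda>" "z \<in> tl z" for z
    using someI_ex[of "\<lambda>T. T \<in> \<Lambda> \<and> z \<in> T"] tile_cover[of z] unfolding tl_def by blast+
  define k where "k x = c (tl x) + inner (w (tl x)) x" for x
  have k: "k x = c T + inner (w T) x" if T: "T \<in> \<Lambda>" "x \<in> T" for x T
  proof -
    let ?H = "{y. inner (w (tl x) - w T) y = c T - c (tl x)}"
    have "verts (tl x) \<inter> verts T \<subseteq> ?H"
    proof
      fix b assume "b \<in> verts (tl x) \<inter> verts T"
      then have "K b = c (tl x) + inner (w (tl x)) b" "K b = c T + inner (w T) b" using cw[OF tl(1)] cw[OF T(1)] by auto
      then show "b \<in> ?H" by (simp add: inner_diff_left)
    qed
    then have "convex hull (verts (tl x) \<inter> verts T) \<subseteq> ?H" using hull_minimal[of _ ?H convex] convex_hyperplane by blast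
    then have "x \<in> ?H" using tiles_inter_hull[OF tl(1) T(1) tl(2) T(2)] by blast
    then show ?thesis by (simp add: k_def inner_diff_left)
  qed
  have kv: "k b = K b" if "T \<in> \<Lambda>" "b \<in> verts T" for b T
    using k[OF that(1) verts_subset[OF that(2)]] cw[OF that(1)] that(2) by simp
  have in_tile: "k x \<le> k (x + of_real d)" if "T \<in> \<Lambda>" "x \<in> T" "x + of_real d \<in> T" "d \<ge> 0" for x d T
  proof -
    have "k (x + of_real d) - k x = d * Re (w T)"
      using k[OF that(1,2)] k[OF that(1,3)] by (simp add: inner_add_right) (simp add: inner_complex_def)
    also have "\<dots> \<ge> 0" using cw[OF that(1)] that(4) by simp
    finally show ?thesis by simp
  qed
  show thesis
  proof (rule that[of k])
    fix a assume a: "a \<in> \<V>"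
    obtain T where "T \<in> \<Lambda>" "a \<in> T" by (rule tile_cover)
    then show "k a = K a" using kv lverts_in_tile[OF a] by blast
  next
    fix x :: complex and d :: real assume d: "d \<ge> 0"
    show "k x \<le> k (x + of_real d)"
    proof (rule tile_chain[where Q = "\<lambda>a b. k a \<le> k b"])
      fix T and r r' :: real
      assume T: "T \<in> \<Lambda>" and r: "r \<le> r'" and "x + of_real r * (x + of_real d - x) \<in> T" "x + of_real r' * (x + of_real d - x) \<in> T"
      moreover have "x + of_real r' * (x + of_real d - x) = x + of_real r * (x + of_real d - x) + of_real ((r' - r) * d)"
        by (simp add: algebra_simps)
      moreover have "(r' - r) * d \<ge> 0" using r d by simp
      ultimately show "k (x + of_real r * (x + of_real d - x)) \<le> k (x + of_real r' * (x + of_real d - x))"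
        using in_tile[OF T] by metis
    qed (rule order_trans)
  next
    fix q v and s t :: real assume u: "up q v" and st: "0 \<le> s" "s \<le> 1" "0 \<le> t" "t \<le> 1"
    let ?T = "rh q 1 v"
    have T: "?T \<in> \<Lambda>" using u by (simp add: up_def)
    note n = up_nondeg[OF u]
    note Kt = strip_index_tile[OF n T]
    have "K q = c ?T + inner (w ?T) q" "K (q + 1) = c ?T + inner (w ?T) (q + 1)" "K (q + v) = c ?T + inner (w ?T) (q + v)"
      using cw[OF T] verts_rh[OF n, of q] by auto
    then have w: "inner (w ?T) 1 = 1" "inner (w ?T) v = 0" "K q = c ?T + inner (w ?T) q"
      using Kt up_neq[OF u] by (simp_all add: inner_add_right unit_steps_def)
    have "q + of_real s + of_real t * v = q + s *\<^sub>R 1 + t *\<^sub>R v" by (simp add: scaleR_conv_of_real)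
    moreover have "q + s *\<^sub>R 1 + t *\<^sub>R v \<in> ?T" using rh_memI[OF st, of q 1 v] by (simp add: scaleR_conv_of_real)
    ultimately show "k (q + of_real s + of_real t * v) = K q + s"
      using k[OF T] w by (simp only: inner_add_right inner_scaleR_right)
  qed
qed

lemma in_open_unit_segment:
  fixes a b :: complex
  assumes "Im a = Im b" "Re b < Re a" "Re a < Re b + 1"
  shows "a \<in> open_segment b (b + 1)"
proof -
  have "a = (1 - (Re a - Re b)) *\<^sub>R b + (Re a - Re b) *\<^sub>R (b + 1)"
    using assms(1) by (simp add: complex_eq_iff algebra_simps)
  moreover have "0 < Re a - Re b" "Re a - Re b < 1" using assms by auto
  ultimately have "\<exists>u>0. u < 1 \<and> a = (1 - u) *\<^sub>R b + u *\<^sub>R (b + 1)" by blast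
  then show ?thesis unfolding in_segment by simp
qed

text \<open>At the height of \<open>q\<close> the rhombus over \<open>r\<close> contains a horizontal segment of length 1 on which \<open>k\<close> grows from
  \<open>K r\<close> to \<open>K r + 1\<close>, and \<open>k\<close> does the same on the edge at \<open>q\<close>.  Monotonicity forces the two segments to overlap.
  As an edge does not enter the interior of a tile, the first segment is the lower side of the rhombus,
  and then it coincides with the edge.\<close>

lemma same_strip:
  assumes q: "(q, q + 1) \<in> \<E>" and r: "up r v" and K_eq: "K q = K r"
    and h: "Im r \<le> Im q" "Im q < Im r + Im v"
  shows "r = q"
proof -
  obtain k where kK: "\<And>a. a \<in> \<V> \<Longrightarrow> k a = K a"
    and mono: "\<And>x d. d \<ge> 0 \<Longrightarrow> k x \<le> k (x + of_real d)"
    and kr: "\<And>s t. 0 \<le> s \<Longrightarrow> s \<le> 1 \<Longrightarrow> 0 \<le> t \<Longrightarrow> t \<le> 1 \<Longrightarrow> k (r + of_real s + of_real t * v) = K r + s"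
    using strip_index_monotone r by metis
  define t where "t = (Im q - Im r) / Im v"
  have v: "Im v > 0" using r by (simp add: up_def)
  have t: "0 \<le> t" "t < 1" using h v by (simp_all add: t_def)
  define z where "z = r + of_real t * v"
  have z: "Im z = Im q" using v by (simp add: z_def t_def)
  have kz: "k z = K r" "k (z + 1) = K r + 1" using kr[of 0 t] kr[of 1 t] t by (simp_all add: z_def add_ac)
  have kq: "k q = K q" "k (q + 1) = K q + 1"
    using kK ledges_lverts[OF q] K[OF q] by (auto simp: unit_steps_def)
  have "\<not> Re q \<ge> Re z + 1"
  proof
    assume a: "Re q \<ge> Re z + 1"
    have "q = (z + 1) + of_real (Re q - Re z - 1)" using z by (simp add: complex_eq_iff)
    then show False using mono[of "Re q - Re z - 1" "z + 1"] a kz kq K_eq by simp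
  qed
  moreover have "\<not> Re z \<ge> Re q + 1"
  proof
    assume a: "Re z \<ge> Re q + 1"
    have "z = (q + 1) + of_real (Re z - Re q - 1)" using z by (simp add: complex_eq_iff)
    then show False using mono[of "Re z - Re q - 1" "q + 1"] a kz kq K_eq by simp
  qed
  ultimately have close: "\<bar>Re q - Re z\<bar> < 1" by linarith
  obtain T where T: "T \<in> \<Lambda>" "side T q (q + 1)" using q by (auto simp: ledges_side)
  have Tr: "rh r 1 v \<in> \<Lambda>" using r by (simp add: up_def)
  note n = up_nondeg[OF r]
  have qT: "q \<in> T" "q + 1 \<in> T" using side_verts[OF T(2)] verts_subset by auto
  show "r = q"
  proof (cases "t = 0")
    case False
    define s where "s = (1 + Re q - Re z) / 2"
    have s: "0 < s" "s < 1" using close by (auto simp: s_def)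
    let ?w = "r + of_real s * 1 + of_real t * v"
    have int: "?w \<in> interior (rh r 1 v)" using rh_interior[OF n s, of t r] t False by simp
    have "?w = (1 - (s + Re z - Re q)) *\<^sub>R q + (s + Re z - Re q) *\<^sub>R (q + 1)"
    proof -
      have "?w = z + of_real s" by (simp add: z_def)
      also have "\<dots> = q + of_real (s + Re z - Re q)" using z by (simp add: complex_eq_iff)
      also have "\<dots> = (1 - (s + Re z - Re q)) *\<^sub>R q + (s + Re z - Re q) *\<^sub>R (q + 1)"
        by (simp add: scaleR_conv_of_real algebra_simps)
      finally show ?thesis .
    qed
    moreover have "0 \<le> s + Re z - Re q" "s + Re z - Re q \<le> 1" using close by (auto simp: s_def field_simps)
    ultimately have "?w \<in> closed_segment q (q + 1)" unfolding closed_segment_def by blast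
    moreover then have "?w \<in> T" using closed_segment_subset[OF qT tile_convex[OF T(1)]] by blast
    ultimately show ?thesis using side_not_interior[OF T(2)] tile_eqI[OF Tr T(1) int] int by blast
  next
    case True
    then have zr: "z = r" by (simp add: z_def)
    have no: "False" if ext: "a \<in> verts S" and S: "b \<in> S" "b + 1 \<in> S" and ab: "Im a = Im b" "Re b < Re a" "Re a < Re b + 1" for a b S
    proof -
      have "a \<in> open_segment b (b + 1)" by (rule in_open_unit_segment[OF ab])
      then show False using ext S by (auto simp: extreme_point_of_def)
    qed
    have rv: "r \<in> verts (rh r 1 v)" "r + 1 \<in> verts (rh r 1 v)" using verts_rh[OF n, of r] by auto
    note rS = rv[THEN verts_subset]
    show ?thesis
    proof (rule ccontr)
      assume "r \<noteq> q"
      then have "Re r \<noteq> Re q" using z zr by (auto simp: complex_eq_iff)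
      then consider "Re r < Re q" | "Re q < Re r" by linarith
      then show False
      proof cases
        case 1
        have "q \<in> open_segment r (r + 1)"
          by (rule in_open_unit_segment) (use z zr close 1 in auto)
        then have "q \<in> rh r 1 v" using convex_contains_open_segment[THEN iffD1, OF convex_rh] rS by blast
        then have "q \<in> verts (rh r 1 v)" using lverts_in_tile[OF _ Tr] ledges_lverts[OF q] by blast
        then show False using no[of q _ r] rS 1 z zr close by auto
      next
        case 2
        have "r \<in> open_segment q (q + 1)"
          by (rule in_open_unit_segment) (use z zr close 2 in auto)
        then have "r \<in> T" using convex_contains_open_segment[THEN iffD1, OF tile_convex[OF T(1)]] qT by blast
        then have "r \<in> verts T" using lverts_in_tile[OF _ T(1)] verts_lverts[OF Tr rv(1)] by blast
        then show False using no[of r T q] qT 2 z zr close by auto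
      qed
    qed
  qed
qed

end

end

context rhombic_plane_lattice
begin

text \<open>Solutions of the equations on the non-horizontal edges are sections for a transport \<open>e\<close>, which is extended
  across the edges of direction 1 by translations \<open>g\<close>.  The equation on such an edge \<open>(p, p + 1)\<close> prescribes the value
  \<open>h (p + 1) - h p\<close> at \<open>p\<close>, and the discrete Cauchy-Riemann
  equation makes it compatible with transport along the strip of \<open>p\<close>.  A section with the right value at \<open>p\<close> thus has the right
  value along this strip, which by \<open>same_strip\<close> covers all edges of direction 1 that start in the region of \<open>p\<close>.
  So the value of \<open>f\<close> at \<open>z\<close> is taken from the section that belongs to a point \<open>\<pi> z\<close> of this kind
  in the region of \<open>z\<close>.\<close>

lemma shift_eq_solvable:
  assumes "face_analytic h"
  obtains f where "f \<in> extensional \<V>" "shift_eq h f"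
proof -
  have fa: "(h q - h (q + u + v)) * (u - v) + (h (q + u) - h (q + v)) * (u + v) = 0"
    if "nondeg u v" "rh q u v \<in> \<Lambda>" for q u v
    using assms that unfolding face_analytic_def by blast
  define P where "P = {q. (q, q + 1) \<in> \<E>}"
  define vv where "vv q = (SOME v. up q v)" for q
  have vv: "up q (vv q)" if "q \<in> P" for q
    using up_exists[of q] that someI_ex[of "up q"] unfolding P_def vv_def by blast
  have vvI: "vv q = v" if "up q v" for q v
    using that up_unique[OF _ that] vv[of q] up_edges(1)[OF that] by (simp add: P_def)
  define \<tau> where "\<tau> q = q + vv q" for q
  have "bij_betw \<tau> P P"
  proof (rule bij_betwI')
    fix q r assume "q \<in> P" "r \<in> P"
    then show "\<tau> q = \<tau> r \<longleftrightarrow> q = r" using down_unique[OF vv vv, of q r] by (auto simp: \<tau>_def)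
  next
    fix q assume "q \<in> P" then show "\<tau> q \<in> P" using up_edges(2)[OF vv] by (simp add: \<tau>_def P_def)
  next
    fix q assume "q \<in> P"
    then obtain r v where "up r v" "r + v = q" using down_exists[of q] by (auto simp: P_def)
    then show "\<exists>r\<in>P. q = \<tau> r" using vvI up_edges(1) by (intro bexI[of _ r]) (auto simp: \<tau>_def P_def)
  qed
  moreover obtain \<delta> where \<delta>: "\<delta> > 0" "\<And>q v. up q v \<Longrightarrow> Im v \<ge> \<delta>" using up_height by blast
  moreover have "Im (\<tau> q) \<ge> Im q + \<delta>" if "q \<in> P" for q using \<delta>(2)[OF vv[OF that]] by (simp add: \<tau>_def)
  \<comment> \<open>The recursion for \<open>g\<close> is consistency of \<open>e\<close> around a rhombus with horizontal sides.  Translations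
    suffice as transport across these sides, since both slanted sides act with the same linear part.\<close>
  define \<Delta> where "\<Delta> q v = 2 * (h (q + 1 + v) - h (q + 1) - h (q + v) + h q)" for q v
  define c where "c q y = (\<Delta> q (vv q) - y * (vv q + 1)) / (vv q - 1)" for q y
  define c' where "c' q y = (\<Delta> q (vv q) - y * (vv q - 1)) / (vv q + 1)" for q y
  have vn: "vv q - 1 \<noteq> 0" "vv q + 1 \<noteq> 0" if "q \<in> P" for q
    using up_neq[OF vv[OF that]] by (auto simp: add_eq_0_iff2)
  have "c q (c' q y) = y" if "q \<in> P" for q y
    using vn[OF that] by (simp add: c_def c'_def)
  ultimately obtain g where g: "\<And>q. q \<in> P \<Longrightarrow> g (\<tau> q) = c q (g q)"
    using orbit_recursion[of \<tau> P \<delta> Im c c'] \<open>\<And>q. q \<in> P \<Longrightarrow> Im q + \<delta> \<le> Im (\<tau> q)\<close> by blast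
  have gup: "g (q + v) * (v - 1) = \<Delta> q v - g q * (v + 1)" if "up q v" for q v
  proof -
    have q: "q \<in> P" using up_edges(1)[OF that] by (simp add: P_def)
    show ?thesis using g[OF q] vn[OF q] vvI[OF that] by (simp add: \<tau>_def c_def)
  qed
  define e where "e a b y = (if b - a = 1 then y + g a else if b - a = - 1 then y - g b
     else (2 * (h b - h a) - y * (b - a + 1)) / (b - a - 1))" for a b y
  have e_eq: "e a b y * (b - a - 1) = 2 * (h b - h a) - y * (b - a + 1)" if "b - a \<noteq> 1" "b - a \<noteq> -1" for a b y
    using that by (simp add: e_def)
  have e_uniq: "e a b y = x" if "b - a \<noteq> 1" "b - a \<noteq> -1" "x * (b - a - 1) = 2 * (h b - h a) - y * (b - a + 1)" for a b y x
    using that by (simp add: e_def field_simps)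
  have local_lift: "\<exists>s. s p = y \<and> (\<forall>a b. (a, b) \<in> \<E> \<longrightarrow> s b = e a b (s a))" if p: "p \<in> \<V>" for p y
  proof (rule edge_section[where e = e and Y = UNIV and p = p and y = y])
    fix a b y
    show "e b a (e a b y) = y"
    proof (cases "b - a = 1 \<or> b - a = -1")
      case True
      then have "a - b = -1 \<or> a - b = 1" by (auto simp: algebra_simps)
      with True show ?thesis by (auto simp: e_def algebra_simps)
    next
      case False
      have n: "a - b \<noteq> 1" "a - b \<noteq> -1" using False by (auto simp: algebra_simps)
      show ?thesis
        by (rule e_uniq[OF n]) (use e_eq[of b a y] False in \<open>simp add: algebra_simps\<close>)
    qed
  next
    fix T assume T: "T \<in> \<Lambda>"
    from tile_up_cases[OF T]
    show "\<exists>q u v. nondeg u v \<and> T = rh q u v \<and>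
      (\<forall>y\<in>UNIV. e (q + u) (q + u + v) (e q (q + u) y) = e (q + v) (q + u + v) (e q (q + v) y))"
    proof (elim disjE exE conjE)
      fix q v assume u: "up q v" and Tq: "T = rh q 1 v"
      have v: "v \<noteq> 1" "v \<noteq> -1" using up_neq[OF u] by auto
      have "e (q + 1) (q + 1 + v) (e q (q + 1) y) = e (q + v) (q + 1 + v) (e q (q + v) y)" for y
      proof (rule e_uniq)
        have "q + 1 + v - (q + v) = 1" by simp
        then have 1: "e (q + v) (q + 1 + v) x = x + g (q + v)" for x unfolding e_def by simp
        have 2: "e q (q + 1) y = y + g q" by (simp add: e_def)
        have 3: "e q (q + v) y * (v - 1) = 2 * (h (q + v) - h q) - y * (v + 1)"
          using e_eq[of "q + v" q y] v by simp
        show "e (q + v) (q + 1 + v) (e q (q + v) y) * (q + 1 + v - (q + 1) - 1) =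
            2 * (h (q + 1 + v) - h (q + 1)) - e q (q + 1) y * (q + 1 + v - (q + 1) + 1)"
        proof -
          have "e (q + v) (q + 1 + v) (e q (q + v) y) * (q + 1 + v - (q + 1) - 1)
              = e q (q + v) y * (v - 1) + g (q + v) * (v - 1)"
            unfolding 1 by (simp add: algebra_simps)
          also have "\<dots> = 2 * (h (q + 1 + v) - h (q + 1)) - e q (q + 1) y * (q + 1 + v - (q + 1) + 1)"
            unfolding 2 3 gup[OF u] \<Delta>_def by (simp add: algebra_simps)
          finally show ?thesis .
        qed
      qed (use v in simp_all)
      then show ?thesis using up_nondeg[OF u] Tq by blast
    next
      fix q u v assume n: "nondeg u v" "T = rh q u v" "u \<noteq> 1" "u \<noteq> - 1" "v \<noteq> 1" "v \<noteq> - 1"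
      have "e (q + u) (q + u + v) (e q (q + u) y) = e (q + v) (q + u + v) (e q (q + v) y)" for y
      proof (rule e_uniq)
        define y1 where "y1 = e q (q + u) y"
        define y2 where "y2 = e q (q + v) y"
        define y3 where "y3 = e (q + v) (q + u + v) y2"
        have 1: "y1 * (u - 1) = 2 * (h (q + u) - h q) - y * (u + 1)" unfolding y1_def using e_eq[of "q + u" q y] n by simp
        have 2: "y2 * (v - 1) = 2 * (h (q + v) - h q) - y * (v + 1)" unfolding y2_def using e_eq[of "q + v" q y] n by simp
        have d: "q + u + v - (q + v) = u" by simp
        have 3: "y3 * (u - 1) = 2 * (h (q + u + v) - h (q + v)) - y2 * (u + 1)"
          unfolding y3_def using e_eq[of "q + u + v" "q + v" y2] n by (simp add: d)
        have F: "(h q - h (q + u + v)) * (u - v) + (h (q + u) - h (q + v)) * (u + v) = 0" using fa[OF n(1)] n(2) T by simp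
        have nz: "u - 1 \<noteq> 0" using n by simp
        have "(y3 * (u - 1)) * (v - 1) = 2 * (h (q + u + v) - h (q + v)) * (v - 1) - (y2 * (v - 1)) * (u + 1)"
          unfolding 3 by (simp add: algebra_simps)
        also have "\<dots> = 2 * (h (q + u + v) - h (q + u)) * (u - 1) - (y1 * (u - 1)) * (v + 1)
            + 2 * ((h q - h (q + u + v)) * (u - v) + (h (q + u) - h (q + v)) * (u + v))"
          unfolding 1 2 by (simp add: algebra_simps)
        also have "\<dots> = (2 * (h (q + u + v) - h (q + u)) - y1 * (v + 1)) * (u - 1)"
          unfolding F by (simp add: algebra_simps)
        finally have "y3 * (v - 1) * (u - 1) = (2 * (h (q + u + v) - h (q + u)) - y1 * (v + 1)) * (u - 1)"
          by (simp add: mult_ac)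
        then have "y3 * (v - 1) = 2 * (h (q + u + v) - h (q + u)) - y1 * (v + 1)" using nz by simp
        then show "e (q + v) (q + u + v) (e q (q + v) y) * (q + u + v - (q + u) - 1) =
            2 * (h (q + u + v) - h (q + u)) - e q (q + u) y * (q + u + v - (q + u) + 1)"
          unfolding y1_def y2_def y3_def by simp
      qed (use n in simp_all)
      then show ?thesis using n by blast
    qed
  qed (use p in auto)
  define N where "N = {(a, b) \<in> \<E>. b - a \<noteq> 1 \<and> b - a \<noteq> - 1}"
  have symN: "sym N" unfolding N_def sym_def using ledges_sym by (auto simp: algebra_simps)
  have revN: "(b, a) \<in> N\<^sup>*" if "(a, b) \<in> N\<^sup>*" for a b using that sym_rtrancl[OF symN] by (auto dest: symD)
  obtain K where K: "\<And>a b. (a, b) \<in> \<E> \<Longrightarrow> K b = K a + unit_steps a b" using strip_index_exists by blast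
  have KN: "K a = K b" if "(a, b) \<in> N\<^sup>*" for a b
    using that by induction (use K in \<open>auto simp: N_def unit_steps_def\<close>)
  define S where "S p s \<longleftrightarrow> s p = h (p + 1) - h p \<and> (\<forall>a b. (a, b) \<in> \<E> \<longrightarrow> s b = e a b (s a))" for p s
  have S_strip: "s p' = h (p' + 1) - h p'" if S: "S p s" and p: "p \<in> P" "p' \<in> P" "(p, p') \<in> N\<^sup>*" for p p' s
  proof -
    \<comment> \<open>The property in question propagates up and down the strip, which must contain \<open>p'\<close>.\<close>
    define Q where "Q = {r \<in> P. K r = K p \<and> s r = h (r + 1) - h r}"
    have Qup: "r \<in> Q \<longleftrightarrow> r + v \<in> Q" if u: "up r v" for r v
    proof -
      have rP: "r \<in> P" "r + v \<in> P" using up_edges[OF u] by (auto simp: P_def)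
      have "K (r + v) = K r" using K[OF up_edges(3)[OF u]] up_neq[OF u] by (simp add: unit_steps_def)
      moreover have "s r = h (r + 1) - h r \<longleftrightarrow> s (r + v) = h (r + v + 1) - h (r + v)"
      proof -
        have se: "s (r + v) = e r (r + v) (s r)" using S up_edges(3)[OF u] by (simp add: S_def)
        have 1: "s (r + v) * (v - 1) = 2 * (h (r + v) - h r) - s r * (v + 1)"
          unfolding se using e_eq[of "r + v" r "s r"] up_neq[OF u] by simp
        have "(h r - h (r + 1 + v)) * (1 - v) + (h (r + 1) - h (r + v)) * (1 + v) = 0"
          using fa[OF up_nondeg[OF u]] u by (simp add: up_def)
        then have 2: "(h (r + v + 1) - h (r + v)) * (v - 1) = 2 * (h (r + v) - h r) - (h (r + 1) - h r) * (v + 1)"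
          by (simp add: algebra_simps)
        have nz: "v - 1 \<noteq> 0" "v + 1 \<noteq> 0" using up_neq[OF u] by (auto simp: add_eq_0_iff2)
        have "s r = h (r + 1) - h r \<longleftrightarrow> s r * (v + 1) = (h (r + 1) - h r) * (v + 1)" using nz by simp
        also have "\<dots> \<longleftrightarrow> s (r + v) * (v - 1) = (h (r + v + 1) - h (r + v)) * (v - 1)" unfolding 1 2 by simp
        also have "\<dots> \<longleftrightarrow> s (r + v) = h (r + v + 1) - h (r + v)" using nz by simp
        finally show ?thesis .
      qed
      ultimately show ?thesis using rP by (simp add: Q_def)
    qed
    have pQ: "p \<in> Q" using S p(1) by (simp add: Q_def S_def)
    have QP: "(r, r + 1) \<in> \<E>" if "r \<in> Q" for r using that by (simp add: Q_def P_def)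
    obtain r v where r: "r \<in> Q" "up r v" "Im r \<le> Im p'" "Im p' < Im r + Im v"
      by (rule orbit_meets_height[OF pQ QP Qup])
    have "r = p'"
      by (rule same_strip[OF K _ r(2) _ r(3,4)]) (use p KN[OF p(3)] r(1) in \<open>auto simp: P_def Q_def\<close>)
    then show ?thesis using r(1) by (simp add: Q_def)
  qed
  have "\<exists>p. (z, p) \<in> N\<^sup>* \<and> p \<in> P" if "z \<in> \<V>" for z
    using path_to_unit_step[OF that] unfolding N_def P_def by blast
  then obtain \<pi> where \<pi>: "\<And>z. z \<in> \<V> \<Longrightarrow> (z, \<pi> z) \<in> N\<^sup>* \<and> \<pi> z \<in> P" by metis
  have "\<exists>s. S p s" if "p \<in> P" for p
    using local_lift[of p "h (p + 1) - h p"] that ledges_lverts unfolding S_def P_def by blast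
  then obtain s where s: "\<And>p. p \<in> P \<Longrightarrow> S p (s p)" by metis
  define f where "f = (\<lambda>z\<in>\<V>. s (\<pi> z) z)"
  have f: "f z = s (\<pi> z) z" if "z \<in> \<V>" for z using that by (simp add: f_def)
  have f_left: "f a = h (a + 1) - h a" if "(a, a + 1) \<in> \<E>" for a
  proof -
    have a: "a \<in> \<V>" "a \<in> P" using ledges_lverts[OF that] that by (auto simp: P_def)
    show ?thesis unfolding f[OF a(1)]
      by (rule S_strip[OF s _ a(2)]) (use \<pi>[OF a(1)] revN in blast)+
  qed
  have f_N: "f b = e a b (f a)" if ab: "(a, b) \<in> N" for a b
  proof -
    have L: "a \<in> \<V>" "b \<in> \<V>" using ab ledges_lverts by (auto simp: N_def)
    note \<pi>a = \<pi>[OF L(1)] and \<pi>b = \<pi>[OF L(2)]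
    have "(\<pi> a, \<pi> b) \<in> N\<^sup>*" using revN \<pi>a \<pi>b ab by (meson r_into_rtrancl rtrancl_trans)
    then have "s (\<pi> a) (\<pi> b) = h (\<pi> b + 1) - h (\<pi> b)" using S_strip[OF s] \<pi>a \<pi>b by blast
    then have eq: "s (\<pi> a) (\<pi> b) = s (\<pi> b) (\<pi> b)" using s[of "\<pi> b"] \<pi>b by (simp add: S_def)
    have "s (\<pi> a) w = s (\<pi> b) w" if "(\<pi> b, w) \<in> N\<^sup>*" for w
      using that
    proof (induction rule: rtrancl_induct)
      case base
      show ?case by (rule eq)
    next
      case (step y z)
      then have "(y, z) \<in> \<E>" by (simp add: N_def)
      then have "s (\<pi> a) z = e y z (s (\<pi> a) y)" "s (\<pi> b) z = e y z (s (\<pi> b) y)"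
        using s[of "\<pi> a"] s[of "\<pi> b"] \<pi>a \<pi>b unfolding S_def by blast+
      then show ?case using step.IH by simp
    qed
    then have "s (\<pi> a) b = s (\<pi> b) b" using revN \<pi>b by blast
    moreover have "s (\<pi> a) b = e a b (s (\<pi> a) a)" using s[of "\<pi> a"] \<pi>a ab by (auto simp: S_def N_def)
    ultimately show ?thesis using f L by simp
  qed
  have "shift_eq h f"
    unfolding shift_eq_def
  proof (intro allI impI)
    fix a b assume ab: "(a, b) \<in> \<E>"
    consider "b = a + 1" | "a = b + 1" | "b - a \<noteq> 1" "b - a \<noteq> - 1" by (auto simp: algebra_simps)
    then show "h b - h a = f b * (b - a - 1) / 2 + f a * (b - a + 1) / 2"
    proof cases
      case 1 then show ?thesis using f_left[of a] ab by simp
    next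
      case 2 then show ?thesis using f_left[of b] ledges_sym[OF ab] by simp
    next
      case 3
      then have "f b = e a b (f a)" using f_N ab by (simp add: N_def)
      then have "f b * (b - a - 1) = 2 * (h b - h a) - f a * (b - a + 1)" using e_eq[OF 3] by simp
      then show ?thesis by (simp add: add_divide_distrib[symmetric])
    qed
  qed
  then show thesis by (rule that[rotated]) (simp add: f_def)
qed

end

section \<open>The edge equation for matrix functions\<close>

lemma mat_mult_entry:
  assumes "X \<in> carrier_mat a l" "Y \<in> carrier_mat l c" "i < a" "j < c"
  shows "(X * Y) $$ (i, j) = (\<Sum>k\<in>{0..<l}. X $$ (i, k) * Y $$ (k, j))"
  using assms by (simp add: scalar_prod_def)

lemma mult_mat_vec_entry:
  assumes "X \<in> carrier_mat a l" "w \<in> carrier_vec l" "i < a"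
  shows "(X *\<^sub>v w) $ i = (\<Sum>k\<in>{0..<l}. X $$ (i, k) * w $ k)"
  using assms by (simp add: scalar_prod_def)

text \<open>For an eigenvalue \<open>t\<close> of \<open>A\<close> the corresponding eigenvalue is \<open>1 + (d + 1) / 2 * t\<close>, which vanishes if and only if
  \<open>t * (1 + d) = - 2\<close>.  This is the origin of the set \<open>S(\<Lambda>)\<close>.\<close>

definition affine_mat :: "nat \<Rightarrow> complex mat \<Rightarrow> complex \<Rightarrow> complex mat" where
  "affine_mat l A d = 1\<^sub>m l + ((d + 1) / 2) \<cdot>\<^sub>m A"

lemma affine_mat_carrier [simp]: "A \<in> carrier_mat l l \<Longrightarrow> affine_mat l A d \<in> carrier_mat l l"
  by (simp add: affine_mat_def)

lemma mult_affine_mat: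
  assumes "A \<in> carrier_mat l l" "X \<in> carrier_mat m l"
  shows "X * affine_mat l A d = X + ((d + 1) / 2) \<cdot>\<^sub>m (X * A)"
  unfolding affine_mat_def using assms
  by (subst mult_add_distrib_mat[of X m l _ l]) (auto simp: mult_smult_distrib)

lemma affine_mat_mult:
  assumes "A \<in> carrier_mat l l" "X \<in> carrier_mat l l"
  shows "affine_mat l A d * X = X + ((d + 1) / 2) \<cdot>\<^sub>m (A * X)"
  unfolding affine_mat_def using assms
  by (subst add_mult_distrib_mat[of _ l l _ _ l]) auto

lemma affine_mat_prod:
  assumes "A \<in> carrier_mat l l"
  shows "affine_mat l A x * affine_mat l A y =
    1\<^sub>m l + ((x + y + 2) / 2) \<cdot>\<^sub>m A + ((x + 1) * (y + 1) / 4) \<cdot>\<^sub>m (A * A)"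
proof -
  have "affine_mat l A x * A = A + ((x + 1) / 2) \<cdot>\<^sub>m (A * A)" by (rule affine_mat_mult[OF assms assms])
  then have "affine_mat l A x * affine_mat l A y =
      affine_mat l A x + ((y + 1) / 2) \<cdot>\<^sub>m (A + ((x + 1) / 2) \<cdot>\<^sub>m (A * A))"
    using mult_affine_mat[OF assms affine_mat_carrier[OF assms]] by simp
  also have "\<dots> = 1\<^sub>m l + ((x + y + 2) / 2) \<cdot>\<^sub>m A + ((x + 1) * (y + 1) / 4) \<cdot>\<^sub>m (A * A)"
  proof (rule eq_matI)
    fix i j assume "i < dim_row (1\<^sub>m l + ((x + y + 2) / 2) \<cdot>\<^sub>m A + ((x + 1) * (y + 1) / 4) \<cdot>\<^sub>m (A * A))"
      "j < dim_col (1\<^sub>m l + ((x + y + 2) / 2) \<cdot>\<^sub>m A + ((x + 1) * (y + 1) / 4) \<cdot>\<^sub>m (A * A))"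
    then have ij: "i < l" "j < l" using assms by auto
    define o2 where "o2 = (A * A) $$ (i, j)"
    have AA: "A * A \<in> carrier_mat l l" using assms by simp
    show "(affine_mat l A x + ((y + 1) / 2) \<cdot>\<^sub>m (A + ((x + 1) / 2) \<cdot>\<^sub>m (A * A))) $$ (i, j) =
      (1\<^sub>m l + ((x + y + 2) / 2) \<cdot>\<^sub>m A + ((x + 1) * (y + 1) / 4) \<cdot>\<^sub>m (A * A)) $$ (i, j)"
      using ij assms AA carrier_matD[OF AA] carrier_matD[OF assms]
      by (simp add: affine_mat_def o2_def[symmetric] del: index_mult_mat) (simp add: field_simps)
  qed (use assms in \<open>auto simp: affine_mat_def\<close>)
  finally show ?thesis .
qed

lemma mat_inverse_exists:
  fixes X :: "complex mat"
  assumes "X \<in> carrier_mat l l" "\<And>w. w \<in> carrier_vec l \<Longrightarrow> X *\<^sub>v w = 0\<^sub>v l \<Longrightarrow> w = 0\<^sub>v l"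
  obtains J where "J \<in> carrier_mat l l" "J * X = 1\<^sub>m l" "X * J = 1\<^sub>m l"
proof -
  have "det X \<noteq> 0" using det_0_iff_vec_prod_zero[OF assms(1)] assms(2) by blast
  then have "X \<in> Units (ring_mat TYPE(complex) l ())" by (rule det_non_zero_imp_unit[OF assms(1)])
  then show thesis using that unfolding Units_def by (auto simp: ring_mat_def)
qed

lemma smult_mat_mult_vec:
  assumes "A \<in> carrier_mat m l" "w \<in> carrier_vec l"
  shows "(c \<cdot>\<^sub>m A) *\<^sub>v w = c \<cdot>\<^sub>v (A *\<^sub>v w)"
proof (rule eq_vecI)
  fix i assume "i < dim_vec (c \<cdot>\<^sub>v (A *\<^sub>v w))"
  then have i: "i < m" using assms by simp
  have cA: "c \<cdot>\<^sub>m A \<in> carrier_mat m l" using assms by simp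
  show "((c \<cdot>\<^sub>m A) *\<^sub>v w) $ i = (c \<cdot>\<^sub>v (A *\<^sub>v w)) $ i"
    using i assms mult_mat_vec_entry[OF cA assms(2) i] mult_mat_vec_entry[OF assms i]
    by (simp add: sum_distrib_left mult.assoc del: index_mult_mat_vec)
qed (use assms in simp)

lemma affine_mat_inverse:
  assumes A: "A \<in> carrier_mat l l" and t: "\<And>t. t * (1 + d) = - 2 \<Longrightarrow> t \<notin> spectrum A"
  obtains J where "J \<in> carrier_mat l l" "J * affine_mat l A d = 1\<^sub>m l" "affine_mat l A d * J = 1\<^sub>m l"
proof (rule mat_inverse_exists[OF affine_mat_carrier[OF A], of d])
  fix w assume w: "w \<in> carrier_vec l" and 0: "affine_mat l A d *\<^sub>v w = 0\<^sub>v l"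
  have eq: "w $ i + (d + 1) / 2 * (A *\<^sub>v w) $ i = 0" if "i < l" for i
  proof -
    have X: "affine_mat l A d *\<^sub>v w = w + ((d + 1) / 2) \<cdot>\<^sub>v (A *\<^sub>v w)"
      unfolding affine_mat_def using A w
      by (subst add_mult_distrib_mat_vec[of _ l l]) (simp_all add: smult_mat_mult_vec[OF A w])
    have "(w + ((d + 1) / 2) \<cdot>\<^sub>v (A *\<^sub>v w)) $ i = 0"
      unfolding X[symmetric] 0 using that by simp
    moreover have "i < dim_vec (A *\<^sub>v w)" using that A by simp
    ultimately show ?thesis using that by (simp del: index_mult_mat_vec)
  qed
  show "w = 0\<^sub>v l"
  proof (rule ccontr)
    assume w0: "w \<noteq> 0\<^sub>v l"
    have d: "d + 1 \<noteq> 0"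
    proof
      assume "d + 1 = 0"
      then have "w = 0\<^sub>v l" using eq w by (intro eq_vecI) auto
      with w0 show False ..
    qed
    have "A *\<^sub>v w = (- 2 / (1 + d)) \<cdot>\<^sub>v w"
    proof (rule eq_vecI)
      fix i assume "i < dim_vec ((- 2 / (1 + d)) \<cdot>\<^sub>v w)"
      then have i: "i < l" using w by simp
      have "(A *\<^sub>v w) $ i = - 2 / (1 + d) * w $ i"
      proof -
        have "(d + 1) * (A *\<^sub>v w) $ i = - 2 * w $ i"
        proof -
          have "(d + 1) / 2 * (A *\<^sub>v w) $ i = - w $ i"
            using eq[OF i] by (simp only: eq_neg_iff_add_eq_0 add.commute)
          then have "2 * ((d + 1) / 2 * (A *\<^sub>v w) $ i) = 2 * (- w $ i)" by (simp only:)
          then show ?thesis by (simp del: index_mult_mat_vec)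
        qed
        then have "(A *\<^sub>v w) $ i = (- 2 * w $ i) / (d + 1)" using d by (metis nonzero_mult_div_cancel_left)
        then show ?thesis by (simp add: add.commute del: index_mult_mat_vec)
      qed
      then show "(A *\<^sub>v w) $ i = ((- 2 / (1 + d)) \<cdot>\<^sub>v w) $ i" using i w by simp
    qed (use A w in auto)
    then have "- 2 / (1 + d) \<in> spectrum A"
      using A w w0 unfolding spectrum_def eigenvalue_def eigenvector_def by (auto intro!: exI[of _ w])
    moreover have "1 + d \<noteq> 0" using d by (simp add: add.commute)
    moreover have "x / y * y = x" if "y \<noteq> 0" for x y :: complex using that by simp
    ultimately have "- 2 / (1 + d) \<in> spectrum A \<and> - 2 / (1 + d) * (1 + d) = - 2" by blast
    then show False using t by blast
  qed
qed (rule that)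

context rhombic_plane_lattice
begin

lemma shift_eq_cmult: "shift_eq h f \<Longrightarrow> shift_eq (\<lambda>z. c * h z) (\<lambda>z. c * f z)"
  unfolding shift_eq_def
proof (intro allI impI)
  fix a b assume *: "\<forall>a b. (a, b) \<in> \<E> \<longrightarrow> h b - h a = f b * (b - a - 1) / 2 + f a * (b - a + 1) / 2"
    and "(a, b) \<in> \<E>"
  then have "c * (h b - h a) = c * (f b * (b - a - 1) / 2 + f a * (b - a + 1) / 2)" by simp
  then show "c * h b - c * h a = c * f b * (b - a - 1) / 2 + c * f a * (b - a + 1) / 2"
    by (simp add: right_diff_distrib distrib_left mult.assoc)
qed

lemma shift_eq_add:
  assumes "shift_eq h f" "shift_eq k g"
  shows "shift_eq (\<lambda>z. h z + k z) (\<lambda>z. f z + g z)"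
  unfolding shift_eq_def
proof (intro allI impI)
  fix a b assume ab: "(a, b) \<in> \<E>"
  show "h b + k b - (h a + k a) = (f b + g b) * (b - a - 1) / 2 + (f a + g a) * (b - a + 1) / 2"
    unfolding shift_eqD'[OF assms(1) ab] shift_eqD'[OF assms(2) ab]
    by (simp add: distrib_right add_divide_distrib)
qed

lemma shift_eq_sum:
  assumes "\<And>k. k \<in> I \<Longrightarrow> shift_eq (h k) (f k)"
  shows "shift_eq (\<lambda>z. \<Sum>k\<in>I. h k z) (\<lambda>z. \<Sum>k\<in>I. f k z)"
  using assms
proof (induction I rule: infinite_finite_induct)
  case (insert k I)
  then show ?case using shift_eq_add[of "h k" "f k" "\<lambda>z. \<Sum>k\<in>I. h k z" "\<lambda>z. \<Sum>k\<in>I. f k z"] by simp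
qed (simp_all add: shift_eq_def)

lemma shift_eq_cong:
  assumes "\<And>z. z \<in> \<V> \<Longrightarrow> h z = h' z" "\<And>z. z \<in> \<V> \<Longrightarrow> f z = f' z"
  shows "shift_eq h f \<longleftrightarrow> shift_eq h' f'"
  unfolding shift_eq_def using assms ledges_lverts by (metis (no_types, lifting))

lemma shift_eq_same_increment:
  assumes "shift_eq h f" "shift_eq k f" "z \<in> \<V>"
  shows "h z - h 0 = k z - k 0"
proof (rule lverts_induct[OF zero_lvert assms(3)])
  fix a b assume "(a, b) \<in> \<E>" "h a - h 0 = k a - k 0"
  then show "h b - h 0 = k b - k 0"
    using shift_eqD[OF assms(1), of a b] shift_eqD[OF assms(2), of a b] by (simp add: algebra_simps)
qed simp

definition mat_shift :: "nat \<Rightarrow> nat \<Rightarrow> (complex \<Rightarrow> complex mat) \<Rightarrow> (complex \<Rightarrow> complex mat) \<Rightarrow> bool" where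
  "mat_shift m n H G \<longleftrightarrow> (\<forall>i<m. \<forall>j<n. shift_eq (\<lambda>z. H z $$ (i, j)) (\<lambda>z. G z $$ (i, j)))"

lemma mat_shift_mult_right:
  assumes "mat_shift m l H G" "\<And>z. z \<in> \<V> \<Longrightarrow> H z \<in> carrier_mat m l"
    "\<And>z. z \<in> \<V> \<Longrightarrow> G z \<in> carrier_mat m l" "B \<in> carrier_mat l n"
  shows "mat_shift m n (\<lambda>z. H z * B) (\<lambda>z. G z * B)"
  unfolding mat_shift_def
proof (intro allI impI)
  fix i j assume ij: "i < m" "j < n"
  have "shift_eq (\<lambda>z. \<Sum>k\<in>{0..<l}. B $$ (k, j) * H z $$ (i, k)) (\<lambda>z. \<Sum>k\<in>{0..<l}. B $$ (k, j) * G z $$ (i, k))"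
    by (intro shift_eq_sum shift_eq_cmult) (use assms(1) ij in \<open>auto simp: mat_shift_def\<close>)
  then show "shift_eq (\<lambda>z. (H z * B) $$ (i, j)) (\<lambda>z. (G z * B) $$ (i, j))"
    by (rule shift_eq_cong[THEN iffD1, rotated 2])
      (simp_all add: mat_mult_entry[OF assms(2,4) ij] mat_mult_entry[OF assms(3,4) ij] mult.commute)
qed

lemma mat_shift_mult_left:
  assumes "mat_shift l n H G" "\<And>z. z \<in> \<V> \<Longrightarrow> H z \<in> carrier_mat l n"
    "\<And>z. z \<in> \<V> \<Longrightarrow> G z \<in> carrier_mat l n" "C \<in> carrier_mat m l"
  shows "mat_shift m n (\<lambda>z. C * H z) (\<lambda>z. C * G z)"
  unfolding mat_shift_def
proof (intro allI impI)
  fix i j assume ij: "i < m" "j < n"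
  have "shift_eq (\<lambda>z. \<Sum>k\<in>{0..<l}. C $$ (i, k) * H z $$ (k, j)) (\<lambda>z. \<Sum>k\<in>{0..<l}. C $$ (i, k) * G z $$ (k, j))"
    by (intro shift_eq_sum shift_eq_cmult) (use assms(1) ij in \<open>auto simp: mat_shift_def\<close>)
  then show "shift_eq (\<lambda>z. (C * H z) $$ (i, j)) (\<lambda>z. (C * G z) $$ (i, j))"
    by (rule shift_eq_cong[THEN iffD1, rotated 2])
      (simp_all add: mat_mult_entry[OF assms(4) assms(2) ij] mat_mult_entry[OF assms(4) assms(3) ij])
qed

lemma DA_mat_carrier: "f \<in> DA_mat \<Lambda> m n \<Longrightarrow> z \<in> \<V> \<Longrightarrow> f z \<in> carrier_mat m n"
  and DA_mat_entry: "f \<in> DA_mat \<Lambda> m n \<Longrightarrow> i < m \<Longrightarrow> j < n \<Longrightarrow> (\<lambda>z\<in>\<V>. f z $$ (i, j)) \<in> DA \<Lambda>"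
  and DA_mat_extensional: "f \<in> DA_mat \<Lambda> m n \<Longrightarrow> f \<in> extensional \<V>"
  by (auto simp: DA_mat_def PiE_def)

lemma Zplus_mat_carrier:
  "f \<in> DA_mat \<Lambda> m n \<Longrightarrow> z \<in> \<V> \<Longrightarrow> Zplus_mat \<Lambda> f z \<in> carrier_mat m n"
  using DA_mat_carrier[of f m n z] by (simp add: Zplus_mat_def)

lemma Zplus_mat_entry:
  assumes "f \<in> DA_mat \<Lambda> m n" "z \<in> \<V>" "i < m" "j < n"
  shows "Zplus_mat \<Lambda> f z $$ (i, j) = Zplus \<Lambda> (\<lambda>w\<in>\<V>. f w $$ (i, j)) z"
  using DA_mat_carrier[OF assms(1,2)] assms by (simp add: Zplus_mat_def)

lemma mat_shift_Zplus:
  assumes f: "f \<in> DA_mat \<Lambda> m n" shows "mat_shift m n (Zplus_mat \<Lambda> f) f"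
  unfolding mat_shift_def
proof (intro allI impI)
  fix i j assume ij: "i < m" "j < n"
  have "shift_eq (Zplus \<Lambda> (\<lambda>w\<in>\<V>. f w $$ (i, j))) (\<lambda>w\<in>\<V>. f w $$ (i, j))"
    by (rule shift_eq_Zplus[OF DA_mat_entry[OF f ij]])
  then show "shift_eq (\<lambda>z. Zplus_mat \<Lambda> f z $$ (i, j)) (\<lambda>z. f z $$ (i, j))"
    by (rule shift_eq_cong[THEN iffD1, rotated 2]) (use Zplus_mat_entry[OF f _ ij] in auto)
qed

lemma Zplus_mat_zero:
  assumes f: "f \<in> DA_mat \<Lambda> m n" shows "Zplus_mat \<Lambda> f 0 = 0\<^sub>m m n"
proof (rule eq_matI)
  fix i j assume "i < dim_row (0\<^sub>m m n)" "j < dim_col (0\<^sub>m m n)"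
  then have ij: "i < m" "j < n" by auto
  then show "Zplus_mat \<Lambda> f 0 $$ (i, j) = 0\<^sub>m m n $$ (i, j)"
    using Zplus_mat_entry[OF f zero_lvert ij] Zplus_zero[OF DA_mat_entry[OF f ij]] by simp
qed (use Zplus_mat_carrier[OF f zero_lvert] in auto)

lemma mat_shift_same_increment:
  assumes "mat_shift m n H F" "mat_shift m n G F" "z \<in> \<V>"
    "\<And>z. z \<in> \<V> \<Longrightarrow> H z \<in> carrier_mat m n" "\<And>z. z \<in> \<V> \<Longrightarrow> G z \<in> carrier_mat m n"
  shows "H z - H 0 = G z - G 0"
proof (rule eq_matI)
  note c = assms(4)[OF assms(3)] assms(4)[OF zero_lvert] assms(5)[OF assms(3)] assms(5)[OF zero_lvert]
  fix i j assume "i < dim_row (G z - G 0)" "j < dim_col (G z - G 0)"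
  then have ij: "i < m" "j < n" using c by auto
  then show "(H z - H 0) $$ (i, j) = (G z - G 0) $$ (i, j)"
    using shift_eq_same_increment[of "\<lambda>z. H z $$ (i, j)" "\<lambda>z. F z $$ (i, j)" "\<lambda>z. G z $$ (i, j)" z] assms(1-3) c
    by (simp add: mat_shift_def)
qed (use assms(4)[OF zero_lvert] assms(5)[OF zero_lvert] in auto)

text \<open>For \<open>Z\<^sub>- E = E A\<close> the edge equation becomes a transport law along edges.\<close>

lemma mat_shift_affine:
  assumes A: "A \<in> carrier_mat l l" and E: "\<And>z. z \<in> \<V> \<Longrightarrow> E z \<in> carrier_mat m l"
  shows "mat_shift m l E (\<lambda>z. E z * A) \<longleftrightarrow>
    (\<forall>a b. (a, b) \<in> \<E> \<longrightarrow> E b * affine_mat l A (a - b) = E a * affine_mat l A (b - a))"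
    (is "?L \<longleftrightarrow> ?R")
proof -
  have entry: "(E b * affine_mat l A (a - b)) $$ (i, j) = (E a * affine_mat l A (b - a)) $$ (i, j) \<longleftrightarrow>
      E b $$ (i, j) - E a $$ (i, j) = (E b * A) $$ (i, j) * (b - a - 1) / 2 + (E a * A) $$ (i, j) * (b - a + 1) / 2"
    if ab: "a \<in> \<V>" "b \<in> \<V>" and ij: "i < m" "j < l" for a b i j
  proof -
    have c: "E a * A \<in> carrier_mat m l" "E b * A \<in> carrier_mat m l" using mult_carrier_mat[OF E[OF ab(1)] A] mult_carrier_mat[OF E[OF ab(2)] A] by auto
    have "(E b * affine_mat l A (a - b)) $$ (i, j) = E b $$ (i, j) + (a - b + 1) / 2 * (E b * A) $$ (i, j)"
      "(E a * affine_mat l A (b - a)) $$ (i, j) = E a $$ (i, j) + (b - a + 1) / 2 * (E a * A) $$ (i, j)"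
      using mult_affine_mat[OF A E[OF ab(2)], of "a - b"] mult_affine_mat[OF A E[OF ab(1)], of "b - a"] c E ab ij carrier_matD[OF c(1)] carrier_matD[OF c(2)]
      by (simp_all del: index_mult_mat)
    moreover have "x + (a - b + 1) / 2 * p = y + (b - a + 1) / 2 * q \<longleftrightarrow> x - y = p * (b - a - 1) / 2 + q * (b - a + 1) / 2"
      for x y p q :: complex
    proof -
      have "x + (a - b + 1) / 2 * p - (y + (b - a + 1) / 2 * q) = x - y - (p * (b - a - 1) / 2 + q * (b - a + 1) / 2)"
        by (simp add: field_simps)
      then show ?thesis by (metis eq_iff_diff_eq_0)
    qed
    ultimately show ?thesis by simp
  qed
  show ?thesis
  proof
    assume L: ?L
    show ?R
    proof (intro allI impI)
      fix a b assume e: "(a, b) \<in> \<E>"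
      then have ab: "a \<in> \<V>" "b \<in> \<V>" using ledges_lverts by blast+
      note c = mult_carrier_mat[OF E[OF ab(2)] affine_mat_carrier[OF A]] mult_carrier_mat[OF E[OF ab(1)] affine_mat_carrier[OF A]]
      show "E b * affine_mat l A (a - b) = E a * affine_mat l A (b - a)"
      proof (rule eq_matI)
        fix i j assume "i < dim_row (E a * affine_mat l A (b - a))" "j < dim_col (E a * affine_mat l A (b - a))"
        then have ij: "i < m" "j < l" using carrier_matD[OF c(2)] by auto
        show "(E b * affine_mat l A (a - b)) $$ (i, j) = (E a * affine_mat l A (b - a)) $$ (i, j)"
          unfolding entry[OF ab ij] using L ij shift_eqD[OF _ e] unfolding mat_shift_def by blast
      qed (use carrier_matD[OF c(1)] carrier_matD[OF c(2)] in \<open>simp_all del: index_mult_mat\<close>)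
    qed
  next
    assume R: ?R
    show ?L unfolding mat_shift_def shift_eq_def
    proof (intro allI impI)
      fix i j a b assume ij: "i < m" "j < l" and e: "(a, b) \<in> \<E>"
      show "E b $$ (i, j) - E a $$ (i, j) = (E b * A) $$ (i, j) * (b - a - 1) / 2 + (E a * A) $$ (i, j) * (b - a + 1) / 2"
        using entry[of a b i j] ledges_lverts[OF e] R e ij by auto
    qed
  qed
qed

end

section \<open>The convolution resolvent\<close>

lemma commute_mult_mat:
  fixes X P Q :: "complex mat"
  assumes "X \<in> carrier_mat l l" "P \<in> carrier_mat l l" "Q \<in> carrier_mat l l" "X * P = P * X" "X * Q = Q * X"
  shows "X * (P * Q) = (P * Q) * X"
proof -
  have "X * (P * Q) = (X * P) * Q" by (rule assoc_mult_mat[OF assms(1,2,3), symmetric])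
  also have "\<dots> = (P * X) * Q" by (simp only: assms(4))
  also have "\<dots> = P * (X * Q)" by (rule assoc_mult_mat[OF assms(2,1,3)])
  also have "\<dots> = P * (Q * X)" by (simp only: assms(5))
  also have "\<dots> = (P * Q) * X" by (rule assoc_mult_mat[OF assms(2,3,1), symmetric])
  finally show ?thesis .
qed

lemma commute_inverse_mat:
  fixes X N J :: "complex mat"
  assumes c: "X \<in> carrier_mat l l" "N \<in> carrier_mat l l" "J \<in> carrier_mat l l"
    and "X * N = N * X" "J * N = 1\<^sub>m l" "N * J = 1\<^sub>m l"
  shows "X * J = J * X"
proof -
  have "X * J = (J * N) * (X * J)" unfolding assms(5) using c by simp
  also have "\<dots> = J * (N * (X * J))" using c by (simp add: assoc_mult_mat[of J l l N l "X * J" l])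
  also have "N * (X * J) = (X * N) * J" unfolding assms(4) using c by (simp add: assoc_mult_mat[of N l l X l J l])
  also have "\<dots> = X" using c assms(6) by (simp add: assoc_mult_mat[of X l l N l J l])
  finally show ?thesis .
qed

context rhombic_plane_lattice
begin

lemma face_analytic_DA:
  assumes "face_analytic f" shows "(\<lambda>z\<in>\<V>. f z) \<in> DA \<Lambda>"
proof -
  obtain F where F: "\<And>a b. (a, b) \<in> \<E> \<Longrightarrow> F b = F a + (f a + f b) / 2 * (b - a)"
    using face_analytic_primitive[OF assms] by blast
  show ?thesis by (rule DA_I[where F = F]) (use F ledges_lverts in auto)
qed

lemma edge_affine_inverse:
  assumes "A \<in> carrier_mat l l" "S_set \<Lambda> \<inter> spectrum A = {}" "(a, b) \<in> \<E>"
  obtains J where "J \<in> carrier_mat l l" "J * affine_mat l A (b - a) = 1\<^sub>m l" "affine_mat l A (b - a) * J = 1\<^sub>m l"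
proof (rule affine_mat_inverse[OF assms(1), of "b - a"])
  fix t assume "t * (1 + (b - a)) = - 2"
  then have "t * (1 + b - a) = - 2" by (simp only: add_diff_eq)
  then have "t \<in> S_set \<Lambda>" using assms(3) by (auto simp: S_set_def)
  then show "t \<notin> spectrum A" using assms(2) by blast
qed (rule that)

lemma mat_shift_unique:
  assumes A: "A \<in> carrier_mat l l" and S: "S_set \<Lambda> \<inter> spectrum A = {}"
    and E: "\<And>z. z \<in> \<V> \<Longrightarrow> E z \<in> carrier_mat m l" "mat_shift m l E (\<lambda>z. E z * A)"
    and G: "\<And>z. z \<in> \<V> \<Longrightarrow> G z \<in> carrier_mat m l" "mat_shift m l G (\<lambda>z. G z * A)"
    and 0: "E 0 = G 0" and z: "z \<in> \<V>"
  shows "E z = G z"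
proof (rule lverts_induct[OF zero_lvert z])
  fix a b assume ab: "(a, b) \<in> \<E>" and eq: "E a = G a"
  have L: "b \<in> \<V>" using ledges_lverts[OF ab] by blast
  obtain J where J: "J \<in> carrier_mat l l" "affine_mat l A (a - b) * J = 1\<^sub>m l"
    using edge_affine_inverse[OF A S ledges_sym[OF ab]] by metis
  have "E b * affine_mat l A (a - b) = G b * affine_mat l A (a - b)"
    using mat_shift_affine[OF A E(1), THEN iffD1, OF _ E(2), rule_format, OF _ ab]
      mat_shift_affine[OF A G(1), THEN iffD1, OF _ G(2), rule_format, OF _ ab] eq by simp
  then have "E b * affine_mat l A (a - b) * J = G b * affine_mat l A (a - b) * J" by simp
  then show "E b = G b"
    using assoc_mult_mat[OF E(1)[OF L] affine_mat_carrier[OF A] J(1)] assoc_mult_mat[OF G(1)[OF L] affine_mat_carrier[OF A] J(1)]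
      J(2) E(1)[OF L] G(1)[OF L] by simp
qed (rule 0)

text \<open>The solution with \<open>R 0 = 1\<close> of the law in \<open>mat_shift_affine\<close>.  Consistency around a rhombus holds because the transport
  factors \<open>\<phi> d\<close> are rational functions of \<open>A\<close> and so commute.  The same commutativity shows that
  \<open>R\<close> satisfies the discrete Cauchy-Riemann equation, and that it commutes with \<open>A\<close>, which makes it a
  two-sided inverse.\<close>

lemma resolvent_exists:
  assumes A: "A \<in> carrier_mat l l" and S: "S_set \<Lambda> \<inter> spectrum A = {}"
  obtains R where "R \<in> DA_mat \<Lambda> l l" "R 0 = 1\<^sub>m l" "mat_shift l l R (\<lambda>z. R z * A)"
    "\<And>z. z \<in> \<V> \<Longrightarrow> R z * A = A * R z"
proof -
  let ?C = "carrier_mat l l :: complex mat set"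
  let ?N = "affine_mat l A"
  define D where "D = {b - a | a b. (a, b) \<in> \<E>}"
  have Dneg: "- d \<in> D" if d: "d \<in> D" for d
  proof -
    obtain a b where "d = b - a" "(a, b) \<in> \<E>" using d unfolding D_def by blast
    then have "- d = a - b" "(b, a) \<in> \<E>" using ledges_sym by auto
    then show ?thesis unfolding D_def by blast
  qed
  have N: "?N d \<in> ?C" for d using A by simp
  have "\<exists>J. J \<in> ?C \<and> J * ?N d = 1\<^sub>m l \<and> ?N d * J = 1\<^sub>m l" if d: "d \<in> D" for d
  proof -
    obtain a b where ab: "d = b - a" "(a, b) \<in> \<E>" using d unfolding D_def by blast
    show ?thesis unfolding ab(1) by (rule edge_affine_inverse[OF A S ab(2)]) blast
  qed
  then obtain J where J: "\<And>d. d \<in> D \<Longrightarrow> J d \<in> ?C" "\<And>d. d \<in> D \<Longrightarrow> J d * ?N d = 1\<^sub>m l" "\<And>d. d \<in> D \<Longrightarrow> ?N d * J d = 1\<^sub>m l"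
    by metis
  have cN: "X * ?N d = ?N d * X" if "X \<in> ?C" "X * A = A * X" for X d
    using mult_affine_mat[OF A that(1)] affine_mat_mult[OF A that(1)] that(2) by simp
  have cJ: "X * J d = J d * X" if X: "X \<in> ?C" "X * A = A * X" and d: "d \<in> D" for X d
    by (rule commute_inverse_mat[OF X(1) N J(1)[OF d] cN[OF X] J(2,3)[OF d]])
  have NA: "?N d * A = A * ?N d" for d using cN[OF A refl, of d] by simp
  have JA: "J d * A = A * J d" if "d \<in> D" for d using cJ[OF A refl that] by simp
  define \<phi> where "\<phi> d = ?N d * J (- d)" for d
  have \<phi>C: "\<phi> d \<in> ?C" if "d \<in> D" for d unfolding \<phi>_def by (rule mult_carrier_mat[OF N J(1)[OF Dneg[OF that]]])
  have c\<phi>: "X * \<phi> d = \<phi> d * X" if X: "X \<in> ?C" "X * A = A * X" and d: "d \<in> D" for X d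
    unfolding \<phi>_def by (rule commute_mult_mat[OF X(1) N J(1)[OF Dneg[OF d]] cN[OF X] cJ[OF X Dneg[OF d]]])
  have \<phi>A: "\<phi> d * A = A * \<phi> d" if "d \<in> D" for d using c\<phi>[OF A refl that] by simp
  have \<phi>N: "\<phi> d * ?N (- d) = ?N d" if d: "d \<in> D" for d
    unfolding \<phi>_def using J(2)[OF Dneg[OF d]] N[of d]
    by (simp add: assoc_mult_mat[OF N J(1)[OF Dneg[OF d]] N])
  have \<phi>inv: "\<phi> d * \<phi> (- d) = 1\<^sub>m l" if d: "d \<in> D" for d
  proof -
    have "\<phi> d * \<phi> (- d) = \<phi> d * ?N (- d) * J d" unfolding \<phi>_def[of "- d"]
      using assoc_mult_mat[OF \<phi>C[OF d] N J(1)[OF d]] by simp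
    then show ?thesis using \<phi>N[OF d] J(3)[OF d] by simp
  qed
  have dD: "b - a \<in> D" if "(a, b) \<in> \<E>" for a b using that unfolding D_def by blast
  define Y where "Y = {X \<in> ?C. X * A = A * X}"
  have "\<exists>R. R 0 = 1\<^sub>m l \<and> (\<forall>z\<in>\<V>. R z \<in> Y) \<and> (\<forall>a b. (a, b) \<in> \<E> \<longrightarrow> R b = R a * \<phi> (b - a))"
  proof (rule edge_section[where e = "\<lambda>a b X. X * \<phi> (b - a)" and Y = Y and p = 0 and y = "1\<^sub>m l"])
    fix a b X assume ab: "(a, b) \<in> \<E>" and X: "X \<in> Y"
    note d = dD[OF ab]
    have XC: "X \<in> ?C" "A * X = X * A" using X by (auto simp: Y_def)
    have "A * (X * \<phi> (b - a)) = (X * \<phi> (b - a)) * A"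
      by (rule commute_mult_mat[OF A XC(1) \<phi>C[OF d] XC(2) \<phi>A[OF d, symmetric]])
    then show "X * \<phi> (b - a) \<in> Y" using XC \<phi>C[OF d] by (simp add: Y_def)
    have "\<phi> (b - a) * \<phi> (a - b) = 1\<^sub>m l" using \<phi>inv[OF d] by simp
    then show "X * \<phi> (b - a) * \<phi> (a - b) = X"
      using assoc_mult_mat[OF XC(1) \<phi>C[OF d] \<phi>C[OF dD[OF ledges_sym[OF ab]]]] XC(1) by simp
  next
    fix T assume T: "T \<in> \<Lambda>"
    obtain q u v where n: "nondeg u v" "T = rh q u v" using T by (elim tileE)
    note sides = tile_edges[OF n(1), of q, folded n(2), OF T]
    have D: "u \<in> D" "v \<in> D" using dD[OF sides(1)] dD[OF sides(2)] by simp_all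
    have "X * \<phi> u * \<phi> v = X * \<phi> v * \<phi> u" if "X \<in> Y" for X
      using that assoc_mult_mat[of X l l "\<phi> u" l "\<phi> v" l] assoc_mult_mat[of X l l "\<phi> v" l "\<phi> u" l] \<phi>C D
        c\<phi>[OF \<phi>C[OF D(1)] \<phi>A[OF D(1)] D(2)] by (simp add: Y_def)
    then show "\<exists>q u v. nondeg u v \<and> T = rh q u v \<and> (\<forall>y\<in>Y. y * \<phi> (q + u - q) * \<phi> (q + u + v - (q + u)) =
        y * \<phi> (q + v - q) * \<phi> (q + u + v - (q + v)))"
      using n by (intro exI[of _ q] exI[of _ u] exI[of _ v]) simp
  next
    show "0 \<in> \<V>" by (rule zero_lvert)
    show "1\<^sub>m l \<in> Y" using A by (simp add: Y_def)
  qed blast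
  then obtain R where R: "R 0 = 1\<^sub>m l" "\<And>z. z \<in> \<V> \<Longrightarrow> R z \<in> Y" "\<And>a b. (a, b) \<in> \<E> \<Longrightarrow> R b = R a * \<phi> (b - a)"
    by blast
  have RC: "R z \<in> ?C" "R z * A = A * R z" if "z \<in> \<V>" for z using R(2)[OF that] by (auto simp: Y_def)
  have shift: "mat_shift l l R (\<lambda>z. R z * A)"
  proof (rule mat_shift_affine[OF A, THEN iffD2], rule RC(1), assumption, intro allI impI)
    fix a b assume ab: "(a, b) \<in> \<E>"
    have L: "a \<in> \<V>" using ledges_lverts[OF ab] by blast
    show "R b * ?N (a - b) = R a * ?N (b - a)"
      unfolding R(3)[OF ab] using assoc_mult_mat[OF RC(1)[OF L] \<phi>C[OF dD[OF ab]] N, of "a - b"] \<phi>N[OF dD[OF ab]] by simp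
  qed
  \<comment> \<open>The Cauchy-Riemann equation for the factors: after multiplication with the invertible matrix \<open>M\<close> only polynomials
    in \<open>A\<close> are left, and their coefficients cancel.\<close>
  have rel: "(u - v) \<cdot>\<^sub>m (1\<^sub>m l - \<phi> u * \<phi> v) + (u + v) \<cdot>\<^sub>m (\<phi> u - \<phi> v) = 0\<^sub>m l l" (is "?Z = _")
    if D: "u \<in> D" "v \<in> D" for u v
  proof -
    define M where "M = ?N (- u) * ?N (- v)"
    define M' where "M' = J (- v) * J (- u)"
    have MC: "M \<in> ?C" "M' \<in> ?C" unfolding M_def M'_def
      by (rule mult_carrier_mat[OF N N], rule mult_carrier_mat[OF J(1)[OF Dneg[OF D(2)]] J(1)[OF Dneg[OF D(1)]]])
    have MM: "M * M' = 1\<^sub>m l"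
    proof -
      have "M * M' = ?N (- u) * (?N (- v) * (J (- v) * J (- u)))"
        unfolding M_def M'_def by (rule assoc_mult_mat) (rule N J(1)[OF Dneg[OF D(2)]] mult_carrier_mat[OF J(1)[OF Dneg[OF D(2)]] J(1)[OF Dneg[OF D(1)]]])+
      also have "?N (- v) * (J (- v) * J (- u)) = J (- u)"
        using assoc_mult_mat[OF N J(1)[OF Dneg[OF D(2)]] J(1)[OF Dneg[OF D(1)]], of "- v"] J(3)[OF Dneg[OF D(2)]] J(1)[OF Dneg[OF D(1)]] by simp
      finally show ?thesis using J(3)[OF Dneg[OF D(1)]] by simp
    qed
    note P = \<phi>C[OF D(1)] and Q = \<phi>C[OF D(2)]
    have PM: "\<phi> u * M = ?N u * ?N (- v)"
      unfolding M_def using assoc_mult_mat[OF P N N, of "- u" "- v"] \<phi>N[OF D(1)] by simp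
    have QM: "\<phi> v * M = ?N v * ?N (- u)"
    proof -
      have "M = ?N (- v) * ?N (- u)" unfolding M_def by (rule cN[OF N NA])
      then show ?thesis using assoc_mult_mat[OF Q N N, of "- v" "- u"] \<phi>N[OF D(2)] by simp
    qed
    have PQM: "\<phi> u * \<phi> v * M = ?N u * ?N v"
    proof -
      have "\<phi> u * \<phi> v * M = \<phi> u * (?N v * ?N (- u))" using assoc_mult_mat[OF P Q MC(1)] QM by simp
      also have "?N v * ?N (- u) = ?N (- u) * ?N v" by (rule cN[OF N NA])
      also have "\<phi> u * (?N (- u) * ?N v) = ?N u * ?N v" using assoc_mult_mat[OF P N N, of "- u" v] \<phi>N[OF D(1)] by simp
      finally show ?thesis .
    qed
    have PQ: "\<phi> u * \<phi> v \<in> ?C" by (rule mult_carrier_mat[OF P Q])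
    have Z: "?Z \<in> ?C" by (intro add_carrier_mat smult_carrier_mat minus_carrier_mat Q)
    have "?Z * M = (u - v) \<cdot>\<^sub>m (M - \<phi> u * \<phi> v * M) + (u + v) \<cdot>\<^sub>m (\<phi> u * M - \<phi> v * M)"
    proof -
      have "?Z * M = ((u - v) \<cdot>\<^sub>m (1\<^sub>m l - \<phi> u * \<phi> v)) * M + ((u + v) \<cdot>\<^sub>m (\<phi> u - \<phi> v)) * M"
        by (rule add_mult_distrib_mat) (use P Q PQ MC in auto)
      also have "((u - v) \<cdot>\<^sub>m (1\<^sub>m l - \<phi> u * \<phi> v)) * M = (u - v) \<cdot>\<^sub>m ((1\<^sub>m l - \<phi> u * \<phi> v) * M)"
        by (rule mult_smult_assoc_mat) (use P Q PQ MC in auto)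
      also have "(1\<^sub>m l - \<phi> u * \<phi> v) * M = M - \<phi> u * \<phi> v * M"
        using minus_mult_distrib_mat[OF one_carrier_mat PQ MC(1)] MC(1) by simp
      also have "((u + v) \<cdot>\<^sub>m (\<phi> u - \<phi> v)) * M = (u + v) \<cdot>\<^sub>m ((\<phi> u - \<phi> v) * M)"
        by (rule mult_smult_assoc_mat) (use P Q PQ MC in auto)
      also have "(\<phi> u - \<phi> v) * M = \<phi> u * M - \<phi> v * M"
        by (rule minus_mult_distrib_mat[OF P Q MC(1)])
      finally show ?thesis .
    qed
    also have "\<dots> = 0\<^sub>m l l"
      unfolding PQM PM QM unfolding M_def affine_mat_prod[OF A]
    proof (rule eq_matI)
      fix i j assume "i < dim_row (0\<^sub>m l l :: complex mat)" "j < dim_col (0\<^sub>m l l :: complex mat)"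
      then have ij: "i < l" "j < l" by auto
      define A2 where "A2 = A * A"
      have A2: "A2 \<in> ?C" unfolding A2_def by (rule mult_carrier_mat[OF A A])
      show "((u - v) \<cdot>\<^sub>m (1\<^sub>m l + ((- u + - v + 2) / 2) \<cdot>\<^sub>m A + ((- u + 1) * (- v + 1) / 4) \<cdot>\<^sub>m (A * A) -
          (1\<^sub>m l + ((u + v + 2) / 2) \<cdot>\<^sub>m A + ((u + 1) * (v + 1) / 4) \<cdot>\<^sub>m (A * A))) +
        (u + v) \<cdot>\<^sub>m (1\<^sub>m l + ((u + - v + 2) / 2) \<cdot>\<^sub>m A + ((u + 1) * (- v + 1) / 4) \<cdot>\<^sub>m (A * A) -
          (1\<^sub>m l + ((v + - u + 2) / 2) \<cdot>\<^sub>m A + ((v + 1) * (- u + 1) / 4) \<cdot>\<^sub>m (A * A)))) $$ (i, j) = 0\<^sub>m l l $$ (i, j)"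
        unfolding A2_def[symmetric] using ij A A2 carrier_matD[OF A] carrier_matD[OF A2]
        by simp (simp add: field_simps)
    qed (use A in auto)
    finally have ZM: "?Z * M = 0\<^sub>m l l" .
    have "?Z = ?Z * (M * M')" unfolding MM by (rule right_mult_one_mat[OF Z, symmetric])
    also have "\<dots> = ?Z * M * M'" by (rule assoc_mult_mat[OF Z MC, symmetric])
    also have "\<dots> = 0\<^sub>m l l" unfolding ZM by (rule left_mult_zero_mat[OF MC(2)])
    finally show ?thesis .
  qed
  have "face_analytic (\<lambda>z. R z $$ (i, j))" if ij: "i < l" "j < l" for i j
    unfolding face_analytic_def
  proof (intro allI impI)
    fix q u v assume n: "nondeg u v" and T: "rh q u v \<in> \<Lambda>"
    note sides = tile_edges[OF n T]
    have D: "u \<in> D" "v \<in> D" using dD[OF sides(1)] dD[OF sides(2)] by simp_all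
    note P = \<phi>C[OF D(1)] and Q = \<phi>C[OF D(2)]
    have X: "R q \<in> ?C" using RC ledges_lverts[OF sides(1)] by blast
    have R1: "R (q + u) = R q * \<phi> u" "R (q + v) = R q * \<phi> v" "R (q + u + v) = R q * (\<phi> u * \<phi> v)"
      using R(3)[OF sides(1)] R(3)[OF sides(2)] R(3)[OF sides(3)] assoc_mult_mat[OF X P Q] by simp_all
    have PQ: "\<phi> u * \<phi> v \<in> ?C" by (rule mult_carrier_mat[OF P Q])
    have "R q * ((u - v) \<cdot>\<^sub>m (1\<^sub>m l - \<phi> u * \<phi> v) + (u + v) \<cdot>\<^sub>m (\<phi> u - \<phi> v)) =
      (u - v) \<cdot>\<^sub>m (R q - R (q + u + v)) + (u + v) \<cdot>\<^sub>m (R (q + u) - R (q + v))"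
    proof -
      have "R q * ((u - v) \<cdot>\<^sub>m (1\<^sub>m l - \<phi> u * \<phi> v) + (u + v) \<cdot>\<^sub>m (\<phi> u - \<phi> v)) =
        R q * ((u - v) \<cdot>\<^sub>m (1\<^sub>m l - \<phi> u * \<phi> v)) + R q * ((u + v) \<cdot>\<^sub>m (\<phi> u - \<phi> v))"
        by (rule mult_add_distrib_mat[OF X]) (use P Q PQ in auto)
      also have "R q * ((u - v) \<cdot>\<^sub>m (1\<^sub>m l - \<phi> u * \<phi> v)) = (u - v) \<cdot>\<^sub>m (R q * (1\<^sub>m l - \<phi> u * \<phi> v))"
        by (rule mult_smult_distrib[OF X]) (use P Q PQ in auto)
      also have "R q * ((u + v) \<cdot>\<^sub>m (\<phi> u - \<phi> v)) = (u + v) \<cdot>\<^sub>m (R q * (\<phi> u - \<phi> v))"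
        by (rule mult_smult_distrib[OF X]) (use P Q PQ in auto)
      also have "R q * (1\<^sub>m l - \<phi> u * \<phi> v) = R q - R (q + u + v)"
        unfolding R1 using mult_minus_distrib_mat[OF X one_carrier_mat PQ] X by simp
      also have "R q * (\<phi> u - \<phi> v) = R (q + u) - R (q + v)"
        unfolding R1 by (rule mult_minus_distrib_mat[OF X P Q])
      finally show ?thesis .
    qed
    then have 0: "(u - v) \<cdot>\<^sub>m (R q - R (q + u + v)) + (u + v) \<cdot>\<^sub>m (R (q + u) - R (q + v)) = 0\<^sub>m l l"
      unfolding rel[OF D] using X by simp
    have C: "R (q + u) \<in> ?C" "R (q + v) \<in> ?C" "R (q + u + v) \<in> ?C" unfolding R1
      by (rule mult_carrier_mat[OF X P], rule mult_carrier_mat[OF X Q], rule mult_carrier_mat[OF X PQ])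
    have "((u - v) \<cdot>\<^sub>m (R q - R (q + u + v)) + (u + v) \<cdot>\<^sub>m (R (q + u) - R (q + v))) $$ (i, j) =
      (u - v) * (R q $$ (i, j) - R (q + u + v) $$ (i, j)) + (u + v) * (R (q + u) $$ (i, j) - R (q + v) $$ (i, j))"
      using C X ij carrier_matD[OF C(1)] carrier_matD[OF C(2)] carrier_matD[OF C(3)] carrier_matD[OF X] by simp
    then show "(R q $$ (i, j) - R (q + u + v) $$ (i, j)) * (u - v) + (R (q + u) $$ (i, j) - R (q + v) $$ (i, j)) * (u + v) = 0"
      unfolding 0 using ij by (simp add: mult.commute)
  qed
  then have DA: "(\<lambda>z\<in>\<V>. R z $$ (i, j)) \<in> DA \<Lambda>" if "i < l" "j < l" for i j
    using face_analytic_DA that by blast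
  define R' where "R' = (\<lambda>z\<in>\<V>. R z)"
  have R': "R' z = R z" if "z \<in> \<V>" for z using that by (simp add: R'_def)
  show thesis
  proof (rule that[of R'])
    have "(\<lambda>z\<in>\<V>. R' z $$ (i, j)) = (\<lambda>z\<in>\<V>. R z $$ (i, j))" for i j
      by (rule restrict_ext) (simp add: R')
    then show "R' \<in> DA_mat \<Lambda> l l" using DA RC(1) by (simp add: DA_mat_def R'_def)
    show "R' 0 = 1\<^sub>m l" using R(1) R'[OF zero_lvert] by simp
    show "mat_shift l l R' (\<lambda>z. R' z * A)"
      unfolding mat_shift_def
    proof (intro allI impI)
      fix i j assume "i < l" "j < l"
      then have "shift_eq (\<lambda>z. R z $$ (i, j)) (\<lambda>z. (R z * A) $$ (i, j))" using shift by (simp add: mat_shift_def)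
      then show "shift_eq (\<lambda>z. R' z $$ (i, j)) (\<lambda>z. (R' z * A) $$ (i, j))"
        by (rule shift_eq_cong[THEN iffD1, rotated 2]) (simp_all add: R')
    qed
  qed (use R' RC(2) in simp)
qed

lemma conv_poly_resolvent:
  assumes A: "A \<in> carrier_mat l l" and g: "g \<in> DA_mat \<Lambda> l l"
  shows "conv_poly_left \<Lambda> l l [1\<^sub>m l, - A] g = (\<lambda>z\<in>\<V>. g z - A * Zplus_mat \<Lambda> g z)"
    and "conv_poly_right \<Lambda> l l g [1\<^sub>m l, - A] = (\<lambda>z\<in>\<V>. g z - Zplus_mat \<Lambda> g z * A)"
proof -
  have mA: "- A \<in> carrier_mat l l" using A by simp
  have "mat l l (\<lambda>ij. \<Sum>n<length [1\<^sub>m l, - A]. ([1\<^sub>m l, - A] ! n * (Zplus_mat \<Lambda> ^^ n) g z) $$ ij) = g z - A * Zplus_mat \<Lambda> g z"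
    "mat l l (\<lambda>ij. \<Sum>n<length [1\<^sub>m l, - A]. ((Zplus_mat \<Lambda> ^^ n) g z * [1\<^sub>m l, - A] ! n) $$ ij) = g z - Zplus_mat \<Lambda> g z * A"
    if z: "z \<in> \<V>" for z
  proof -
    note c = DA_mat_carrier[OF g z] Zplus_mat_carrier[OF g z]
    have C: "A * Zplus_mat \<Lambda> g z \<in> carrier_mat l l" "Zplus_mat \<Lambda> g z * A \<in> carrier_mat l l"
      by (rule mult_carrier_mat[OF A c(2)], rule mult_carrier_mat[OF c(2) A])
    have m: "- A * Zplus_mat \<Lambda> g z = - (A * Zplus_mat \<Lambda> g z)" "Zplus_mat \<Lambda> g z * - A = - (Zplus_mat \<Lambda> g z * A)"
      using A c by (auto intro: uminus_mult_left_mat uminus_mult_right_mat)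
    show "mat l l (\<lambda>ij. \<Sum>n<length [1\<^sub>m l, - A]. ([1\<^sub>m l, - A] ! n * (Zplus_mat \<Lambda> ^^ n) g z) $$ ij) = g z - A * Zplus_mat \<Lambda> g z"
      "mat l l (\<lambda>ij. \<Sum>n<length [1\<^sub>m l, - A]. ((Zplus_mat \<Lambda> ^^ n) g z * [1\<^sub>m l, - A] ! n) $$ ij) = g z - Zplus_mat \<Lambda> g z * A"
      using c carrier_matD[OF c(1)] carrier_matD[OF C(1)] carrier_matD[OF C(2)] C
      by (auto intro!: eq_matI simp: m lessThan_Suc simp del: index_mult_mat)
  qed
  then show "conv_poly_left \<Lambda> l l [1\<^sub>m l, - A] g = (\<lambda>z\<in>\<V>. g z - A * Zplus_mat \<Lambda> g z)"
    "conv_poly_right \<Lambda> l l g [1\<^sub>m l, - A] = (\<lambda>z\<in>\<V>. g z - Zplus_mat \<Lambda> g z * A)"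
    unfolding conv_poly_left_def conv_poly_right_def by (auto intro!: restrict_ext)
qed

text \<open>Both \<open>R - Z\<^sub>+ R * A\<close> and \<open>R - A * Z\<^sub>+ R\<close> are constant, because \<open>R\<close> and the subtracted term satisfy the same edge
  equation; at 0 they are the identity matrix.  A left inverse satisfies the transport law and
  is therefore unique.\<close>

lemma DA_resolvent:
  assumes A: "A \<in> carrier_mat l l" and S: "S_set \<Lambda> \<inter> spectrum A = {}"
  shows "DA_resolvent \<Lambda> l A \<in> DA_mat \<Lambda> l l"
    and "DA_resolvent \<Lambda> l A 0 = 1\<^sub>m l"
    and "mat_shift l l (DA_resolvent \<Lambda> l A) (\<lambda>z. DA_resolvent \<Lambda> l A z * A)"
    and "\<And>z. z \<in> \<V> \<Longrightarrow> DA_resolvent \<Lambda> l A z = 1\<^sub>m l + Zplus_mat \<Lambda> (DA_resolvent \<Lambda> l A) z * A"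
proof -
  obtain R where R: "R \<in> DA_mat \<Lambda> l l" "R 0 = 1\<^sub>m l" "mat_shift l l R (\<lambda>z. R z * A)"
    "\<And>z. z \<in> \<V> \<Longrightarrow> R z * A = A * R z" using resolvent_exists[OF A S] by blast
  note RC = DA_mat_carrier[OF R(1)] and ZC = Zplus_mat_carrier[OF R(1)]
  have minus0: "P - 0\<^sub>m l l = P" if "P \<in> carrier_mat l l" for P :: "complex mat"
    using that by (intro eq_matI) auto
  have right: "R z - 1\<^sub>m l = Zplus_mat \<Lambda> R z * A" if z: "z \<in> \<V>" for z
  proof -
    have "mat_shift l l (\<lambda>z. Zplus_mat \<Lambda> R z * A) (\<lambda>z. R z * A)"
      by (rule mat_shift_mult_right[OF mat_shift_Zplus[OF R(1)] ZC RC A])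
    then have "R z - R 0 = Zplus_mat \<Lambda> R z * A - Zplus_mat \<Lambda> R 0 * A"
      by (rule mat_shift_same_increment[OF R(3) _ z RC mult_carrier_mat[OF ZC A]])
    then show ?thesis
      unfolding Zplus_mat_zero[OF R(1)] R(2) left_mult_zero_mat[OF A] minus0[OF mult_carrier_mat[OF ZC[OF z] A]] .
  qed
  have left: "R z - 1\<^sub>m l = A * Zplus_mat \<Lambda> R z" if z: "z \<in> \<V>" for z
  proof -
    have s1: "mat_shift l l (\<lambda>z. A * Zplus_mat \<Lambda> R z) (\<lambda>z. A * R z)"
      by (rule mat_shift_mult_left[OF mat_shift_Zplus[OF R(1)] ZC RC A])
    have s2: "mat_shift l l R (\<lambda>z. A * R z)"
      using R(3) shift_eq_cong[of "\<lambda>z. R z $$ (i, j)" "\<lambda>z. R z $$ (i, j)" "\<lambda>z. (R z * A) $$ (i, j)" "\<lambda>z. (A * R z) $$ (i, j)" for i j] R(4)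
      unfolding mat_shift_def by simp
    have "R z - R 0 = A * Zplus_mat \<Lambda> R z - A * Zplus_mat \<Lambda> R 0"
      by (rule mat_shift_same_increment[OF s2 s1 z RC mult_carrier_mat[OF A ZC]])
    then show ?thesis
      unfolding Zplus_mat_zero[OF R(1)] R(2) right_mult_zero_mat[OF A] minus0[OF mult_carrier_mat[OF A ZC[OF z]]] .
  qed
  have swap: "X - Q = P" if X: "X \<in> carrier_mat l l" "P \<in> carrier_mat l l" "Q \<in> carrier_mat l l" and e: "X - P = Q"
    for X P Q :: "complex mat"
  proof (rule eq_matI)
    fix i j assume "i < dim_row P" "j < dim_col P"
    then have ij: "i < l" "j < l" using X by auto
    have "X $$ (i, j) - P $$ (i, j) = Q $$ (i, j)" using arg_cong[OF e, of "\<lambda>M. M $$ (i, j)"] ij X by simp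
    then show "(X - Q) $$ (i, j) = P $$ (i, j)" using ij X by (simp add: algebra_simps)
  qed (use X in auto)
  have shuffle: "X - P = 1\<^sub>m l \<longleftrightarrow> X - 1\<^sub>m l = P" if "X \<in> carrier_mat l l" "P \<in> carrier_mat l l" for X P :: "complex mat"
    using swap[OF that one_carrier_mat] swap[OF that(1) one_carrier_mat that(2)] by blast
  have "DA_resolvent \<Lambda> l A = R"
    unfolding DA_resolvent_def
  proof (rule the_equality)
    have "(\<lambda>z\<in>\<V>. R z - A * Zplus_mat \<Lambda> R z) = (\<lambda>z\<in>\<V>. 1\<^sub>m l)"
      by (rule restrict_ext) (use shuffle[OF RC mult_carrier_mat[OF A ZC]] left in blast)
    moreover have "(\<lambda>z\<in>\<V>. R z - Zplus_mat \<Lambda> R z * A) = (\<lambda>z\<in>\<V>. 1\<^sub>m l)"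
      by (rule restrict_ext) (use shuffle[OF RC mult_carrier_mat[OF ZC A]] right in blast)
    ultimately show "R \<in> DA_mat \<Lambda> l l \<and> conv_poly_left \<Lambda> l l [1\<^sub>m l, - A] R = (\<lambda>z\<in>\<V>. 1\<^sub>m l) \<and>
        conv_poly_right \<Lambda> l l R [1\<^sub>m l, - A] = (\<lambda>z\<in>\<V>. 1\<^sub>m l)"
      using R(1) conv_poly_resolvent[OF A R(1)] by simp
  next
    fix g assume g': "g \<in> DA_mat \<Lambda> l l \<and> conv_poly_left \<Lambda> l l [1\<^sub>m l, - A] g = (\<lambda>z\<in>\<V>. 1\<^sub>m l) \<and>
        conv_poly_right \<Lambda> l l g [1\<^sub>m l, - A] = (\<lambda>z\<in>\<V>. 1\<^sub>m l)"
    then have g: "g \<in> DA_mat \<Lambda> l l" by blast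
    note gC = DA_mat_carrier[OF g] and ZgC = Zplus_mat_carrier[OF g]
    have e: "(\<lambda>z\<in>\<V>. g z - Zplus_mat \<Lambda> g z * A) = (\<lambda>z\<in>\<V>. 1\<^sub>m l)"
      using g' conv_poly_resolvent(2)[OF A g] by simp
    have "g z - Zplus_mat \<Lambda> g z * A = 1\<^sub>m l" if "z \<in> \<V>" for z using fun_cong[OF e, of z] that by simp
    then have gr: "g z - 1\<^sub>m l = Zplus_mat \<Lambda> g z * A" if "z \<in> \<V>" for z
      using shuffle[OF gC[OF that] mult_carrier_mat[OF ZgC[OF that] A]] that by blast
    have "mat_shift l l (\<lambda>z. Zplus_mat \<Lambda> g z * A) (\<lambda>z. g z * A)"
      by (rule mat_shift_mult_right[OF mat_shift_Zplus[OF g] ZgC gC A])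
    then have gs: "mat_shift l l g (\<lambda>z. g z * A)"
      unfolding mat_shift_def
    proof (intro allI impI)
      fix i j assume *: "\<forall>i<l. \<forall>j<l. shift_eq (\<lambda>z. (Zplus_mat \<Lambda> g z * A) $$ (i, j)) (\<lambda>z. (g z * A) $$ (i, j))" and ij: "i < l" "j < l"
      have "(Zplus_mat \<Lambda> g z * A) $$ (i, j) = g z $$ (i, j) - 1\<^sub>m l $$ (i, j)" if "z \<in> \<V>" for z
        unfolding gr[OF that, symmetric] using gC[OF that] ij by simp
      then have "shift_eq (\<lambda>z. g z $$ (i, j) - 1\<^sub>m l $$ (i, j)) (\<lambda>z. (g z * A) $$ (i, j))"
        using * ij shift_eq_cong[of "\<lambda>z. (Zplus_mat \<Lambda> g z * A) $$ (i, j)" "\<lambda>z. g z $$ (i, j) - 1\<^sub>m l $$ (i, j)"] by blast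
      then show "shift_eq (\<lambda>z. g z $$ (i, j)) (\<lambda>z. (g z * A) $$ (i, j))" by (simp add: shift_eq_def)
    qed
    have "g 0 - 1\<^sub>m l = 0\<^sub>m l l" using gr[OF zero_lvert] A by (simp add: Zplus_mat_zero[OF g])
    then have "g 0 - 0\<^sub>m l l = 1\<^sub>m l" by (rule swap[OF gC[OF zero_lvert] one_carrier_mat zero_carrier_mat])
    then have g0: "g 0 = 1\<^sub>m l" unfolding minus0[OF gC[OF zero_lvert]] .
    have "g z = R z" if "z \<in> \<V>" for z
      by (rule mat_shift_unique[OF A S gC gs RC R(3) _ that]) (simp_all add: g0 R(2))
    then show "g = R" using extensionalityI[OF DA_mat_extensional[OF g] DA_mat_extensional[OF R(1)]] by blast
  qed
  moreover have "R z = 1\<^sub>m l + Zplus_mat \<Lambda> R z * A" if z: "z \<in> \<V>" for z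
    unfolding right[OF z, symmetric] using RC[OF z] by (intro eq_matI) auto
  ultimately show "DA_resolvent \<Lambda> l A \<in> DA_mat \<Lambda> l l" "DA_resolvent \<Lambda> l A 0 = 1\<^sub>m l"
    "mat_shift l l (DA_resolvent \<Lambda> l A) (\<lambda>z. DA_resolvent \<Lambda> l A z * A)"
    "\<And>z. z \<in> \<V> \<Longrightarrow> DA_resolvent \<Lambda> l A z = 1\<^sub>m l + Zplus_mat \<Lambda> (DA_resolvent \<Lambda> l A) z * A"
    using R by simp_all
qed

end

section \<open>Invariant spaces and realizations\<close>

lemmas DA_vec_space_simps = DA_vec_space_def partial_object.simps monoid.simps ring.simps module.simps

lemma DA_vec_carrier: "x \<in> DA_vec \<Lambda> m \<Longrightarrow> z \<in> lverts \<Lambda> \<Longrightarrow> x z \<in> carrier_vec m"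
  and DA_vec_entry: "x \<in> DA_vec \<Lambda> m \<Longrightarrow> i < m \<Longrightarrow> (\<lambda>z\<in>lverts \<Lambda>. x z $ i) \<in> DA \<Lambda>"
  and DA_vec_extensional: "x \<in> DA_vec \<Lambda> m \<Longrightarrow> x \<in> extensional (lverts \<Lambda>)"
  by (auto simp: DA_vec_def PiE_def)

lemma sum_split_nat: "(\<Sum>p\<in>{0..<n + l}. g p) = (\<Sum>p\<in>{0..<n}. g p) + (\<Sum>p\<in>{0..<l}. g (p + n))"
  for g :: "nat \<Rightarrow> 'a::comm_monoid_add"
  using sum.atLeastLessThan_concat[of 0 n "n + l" g] sum.shift_bounds_nat_ivl[of g 0 n l] by (simp add: add.commute)

context rhombic_plane_lattice
begin

lemma mat_shift_DA:
  assumes "mat_shift m n H G" "\<And>z. z \<in> \<V> \<Longrightarrow> G z \<in> carrier_mat m n"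
  shows "(\<lambda>z\<in>\<V>. G z) \<in> DA_mat \<Lambda> m n"
proof -
  have "(\<lambda>z\<in>\<V>. (\<lambda>z\<in>\<V>. G z) z $$ (i, j)) \<in> DA \<Lambda>" if ij: "i < m" "j < n" for i j
  proof (rule shift_eq_DA(1)[where h = "\<lambda>z. H z $$ (i, j)"])
    have "shift_eq (\<lambda>z. H z $$ (i, j)) (\<lambda>z. G z $$ (i, j))" using assms(1) ij by (simp add: mat_shift_def)
    then show "shift_eq (\<lambda>z. H z $$ (i, j)) (\<lambda>z\<in>\<V>. (\<lambda>z\<in>\<V>. G z) z $$ (i, j))"
      by (rule shift_eq_cong[THEN iffD1, rotated 2]) simp_all
  qed simp
  then show ?thesis using assms(2) by (simp add: DA_mat_def)
qed

lemma mat_shift_vec: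
  assumes s: "mat_shift m k H (\<lambda>z. H z * A)" and H: "\<And>z. z \<in> \<V> \<Longrightarrow> H z \<in> carrier_mat m k"
    and A: "A \<in> carrier_mat k k" and w: "w \<in> carrier_vec k" and i: "i < m"
  shows "shift_eq (\<lambda>z. (H z *\<^sub>v w) $ i) (\<lambda>z. (H z *\<^sub>v (A *\<^sub>v w)) $ i)"
proof -
  have HA: "H z * A \<in> carrier_mat m k" if "z \<in> \<V>" for z by (rule mult_carrier_mat[OF H[OF that] A])
  have "shift_eq (\<lambda>z. \<Sum>p\<in>{0..<k}. w $ p * H z $$ (i, p)) (\<lambda>z. \<Sum>p\<in>{0..<k}. w $ p * (H z * A) $$ (i, p))"
    by (intro shift_eq_sum shift_eq_cmult) (use s i in \<open>auto simp: mat_shift_def\<close>)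
  then show ?thesis
  proof (rule shift_eq_cong[THEN iffD1, rotated 2])
    fix z assume z: "z \<in> \<V>"
    show "(\<Sum>p\<in>{0..<k}. w $ p * H z $$ (i, p)) = (H z *\<^sub>v w) $ i"
      using mult_mat_vec_entry[OF H[OF z] w i] by (simp only: mult.commute)
    have "H z *\<^sub>v (A *\<^sub>v w) = (H z * A) *\<^sub>v w" by (rule assoc_mult_mat_vec[OF H[OF z] A w, symmetric])
    then show "(\<Sum>p\<in>{0..<k}. w $ p * (H z * A) $$ (i, p)) = (H z *\<^sub>v (A *\<^sub>v w)) $ i"
      using mult_mat_vec_entry[OF HA[OF z] w i] by (simp only: mult.commute)
  qed
qed

lemma Zminus_vec_column:
  assumes s: "mat_shift m k H (\<lambda>z. H z * A)" and H: "\<And>z. z \<in> \<V> \<Longrightarrow> H z \<in> carrier_mat m k"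
    and A: "A \<in> carrier_mat k k" and w: "w \<in> carrier_vec k"
  shows "Zminus_vec \<Lambda> (\<lambda>z\<in>\<V>. H z *\<^sub>v w) = (\<lambda>z\<in>\<V>. H z *\<^sub>v (A *\<^sub>v w))"
  unfolding Zminus_vec_def
proof (rule restrict_ext)
  fix z assume z: "z \<in> \<V>"
  have Hw: "H z *\<^sub>v w \<in> carrier_vec m" "H z *\<^sub>v (A *\<^sub>v w) \<in> carrier_vec m"
    by (rule mult_mat_vec_carrier[OF H[OF z] w], rule mult_mat_vec_carrier[OF H[OF z] mult_mat_vec_carrier[OF A w]])
  have "Zminus \<Lambda> (\<lambda>y\<in>\<V>. (\<lambda>z\<in>\<V>. H z *\<^sub>v w) y $ i) = (\<lambda>y\<in>\<V>. (H y *\<^sub>v (A *\<^sub>v w)) $ i)"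
    if i: "i < m" for i
  proof (rule Zminus_eqI)
    show "shift_eq (\<lambda>y\<in>\<V>. (\<lambda>z\<in>\<V>. H z *\<^sub>v w) y $ i) (\<lambda>y\<in>\<V>. (H y *\<^sub>v (A *\<^sub>v w)) $ i)"
      by (rule shift_eq_cong[THEN iffD1, OF _ _ mat_shift_vec[OF s H A w i]]) simp_all
  qed simp
  then have e: "Zminus \<Lambda> (\<lambda>y\<in>\<V>. (\<lambda>z\<in>\<V>. H z *\<^sub>v w) y $ i) z = (H z *\<^sub>v (A *\<^sub>v w)) $ i" if "i < m" for i
    using z that by simp
  show "vec (dim_vec ((\<lambda>z\<in>\<V>. H z *\<^sub>v w) z)) (\<lambda>i. Zminus \<Lambda> (\<lambda>y\<in>\<V>. (\<lambda>z\<in>\<V>. H z *\<^sub>v w) y $ i) z) =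
      H z *\<^sub>v (A *\<^sub>v w)"
  proof (rule eq_vecI)
    fix i assume "i < dim_vec (H z *\<^sub>v (A *\<^sub>v w))"
    then have i: "i < m" using carrier_vecD[OF Hw(2)] by simp
    then show "vec (dim_vec ((\<lambda>z\<in>\<V>. H z *\<^sub>v w) z)) (\<lambda>i. Zminus \<Lambda> (\<lambda>y\<in>\<V>. (\<lambda>z\<in>\<V>. H z *\<^sub>v w) y $ i) z) $ i
        = (H z *\<^sub>v (A *\<^sub>v w)) $ i"
      using e[OF i] z carrier_vecD[OF Hw(1)] by (simp del: index_mult_mat_vec)
  qed (use z carrier_vecD[OF Hw(1)] carrier_vecD[OF Hw(2)] in \<open>simp del: dim_mult_mat_vec\<close>)
qed

lemma DA_sum:
  assumes "finite I" "\<And>p. p \<in> I \<Longrightarrow> h p \<in> DA \<Lambda>"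
  shows "(\<lambda>z\<in>\<V>. \<Sum>p\<in>I. c p * h p z) \<in> DA \<Lambda>"
  using assms
proof (induction I rule: finite_induct)
  case empty
  show ?case unfolding sum.empty by (rule DA_zero)
next
  case (insert p I)
  let ?s = "\<lambda>z\<in>\<V>. \<Sum>p\<in>I. c p * h p z"
  have "(\<lambda>z\<in>\<V>. c p * h p z + 1 * ?s z) \<in> DA \<Lambda>"
    using insert by (intro DA_combine) auto
  moreover have "(\<lambda>z\<in>\<V>. c p * h p z + 1 * ?s z) = (\<lambda>z\<in>\<V>. \<Sum>p\<in>insert p I. c p * h p z)"
    by (rule restrict_ext) (simp add: insert.hyps)
  ultimately show ?case by (simp only:)
qed

lemma column_in_DA_vec:
  assumes H: "H \<in> DA_mat \<Lambda> m k" and w: "w \<in> carrier_vec k"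
  shows "(\<lambda>z\<in>\<V>. H z *\<^sub>v w) \<in> DA_vec \<Lambda> m"
proof -
  note HC = DA_mat_carrier[OF H]
  have "(\<lambda>z\<in>\<V>. (\<lambda>z\<in>\<V>. H z *\<^sub>v w) z $ i) \<in> DA \<Lambda>" if i: "i < m" for i
  proof -
    have "(\<lambda>z\<in>\<V>. \<Sum>p\<in>{0..<k}. w $ p * (\<lambda>z\<in>\<V>. H z $$ (i, p)) z) \<in> DA \<Lambda>"
      by (rule DA_sum) (simp, rule DA_mat_entry[OF H i], simp)
    moreover have "(\<lambda>z\<in>\<V>. \<Sum>p\<in>{0..<k}. w $ p * (\<lambda>z\<in>\<V>. H z $$ (i, p)) z)
        = (\<lambda>z\<in>\<V>. (\<lambda>z\<in>\<V>. H z *\<^sub>v w) z $ i)"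
    proof (rule restrict_ext)
      fix z assume z: "z \<in> \<V>"
      show "(\<Sum>p\<in>{0..<k}. w $ p * (\<lambda>z\<in>\<V>. H z $$ (i, p)) z) = (\<lambda>z\<in>\<V>. H z *\<^sub>v w) z $ i"
        using z mult_mat_vec_entry[OF HC[OF z] w i] by (simp add: mult.commute del: index_mult_mat_vec)
    qed
    ultimately show ?thesis by simp
  qed
  then show ?thesis using mult_mat_vec_carrier[OF HC w] by (simp add: DA_vec_def)
qed

text \<open>The column space is the image of \<open>\<complex>\<^sup>k\<close> under a linear map.\<close>

lemma finite_dim_column_space:
  assumes H: "H \<in> DA_mat \<Lambda> m k"
  shows "finite_dim_subspace \<Lambda> m (column_space \<Lambda> k H)"
proof -
  let ?V = "DA_vec_space \<Lambda> m" and ?M = "column_space \<Lambda> k H"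
  let ?W = "?V\<lparr>carrier := ?M\<rparr>"
  note HC = DA_mat_carrier[OF H]
  define T where "T w = (\<lambda>z\<in>\<V>. H z *\<^sub>v w)" for w
  have TM: "T w \<in> ?M" if "w \<in> carrier_vec k" for w using that unfolding column_space_def T_def by blast
  have MT: "\<exists>w\<in>carrier_vec k. x = T w" if "x \<in> ?M" for x using that unfolding column_space_def T_def by blast
  have Tadd: "T (v + w) = (\<lambda>z\<in>\<V>. T v z + T w z)" if "v \<in> carrier_vec k" "w \<in> carrier_vec k" for v w
    unfolding T_def by (rule restrict_ext) (simp add: mult_add_distrib_mat_vec[OF HC that])
  have Tsmult: "T (c \<cdot>\<^sub>v w) = (\<lambda>z\<in>\<V>. c \<cdot>\<^sub>v T w z)" if "w \<in> carrier_vec k" for c w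
    unfolding T_def by (rule restrict_ext) (simp add: mult_mat_vec[OF HC that])
  have T0: "T (0\<^sub>v k) = (\<lambda>z\<in>\<V>. 0\<^sub>v m)"
    unfolding T_def
  proof (rule restrict_ext)
    fix z assume z: "z \<in> \<V>"
    show "H z *\<^sub>v 0\<^sub>v k = 0\<^sub>v m" using HC[OF z] by (intro eq_vecI) auto
  qed
  note vs = vectorspace_DA_vec_space[of \<Lambda> m]
  have md: "module class_ring ?V" using vs by (simp add: vectorspace_def)
  have "submodule class_ring ?M ?V"
  proof (rule submodule.intro[OF md], unfold DA_vec_space_simps)
    show "?M \<subseteq> DA_vec \<Lambda> m" using column_in_DA_vec[OF H] by (auto simp: column_space_def)
    fix x y assume "x \<in> ?M" "y \<in> ?M"
    then obtain v w where vw: "v \<in> carrier_vec k" "w \<in> carrier_vec k" "x = T v" "y = T w" using MT by metis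
    then show "(\<lambda>z\<in>\<V>. x z + y z) \<in> ?M" using Tadd[OF vw(1,2)] TM[of "v + w"] by simp
  next
    show "(\<lambda>z\<in>\<V>. 0\<^sub>v m) \<in> ?M" using T0 TM[of "0\<^sub>v k"] by simp
  next
    fix c :: complex and x assume "x \<in> ?M"
    then obtain w where w: "w \<in> carrier_vec k" "x = T w" using MT by metis
    then show "(\<lambda>z\<in>\<V>. c \<cdot>\<^sub>v x z) \<in> ?M" using Tsmult[OF w(1)] TM[of "c \<cdot>\<^sub>v w"] by simp
  qed
  then have sub: "VectorSpace.subspace class_ring ?M ?V" using vs by (intro VectorSpace.subspace.intro)
  have vsW: "vectorspace class_ring ?W" by (rule vectorspace.subspace_is_vs[OF vs sub])
  interpret U: vec_space "TYPE(complex)" k .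
  have hom: "T \<in> module_hom class_ring (module_vec TYPE(complex) k) ?W"
    unfolding module_hom_def using TM Tadd Tsmult by (auto simp: DA_vec_space_def module_vec_simps)
  interpret lm: linear_map class_ring "module_vec TYPE(complex) k" ?W T
  proof (intro linear_map.intro mod_hom.intro mod_hom_axioms.intro)
    show "vectorspace class_ring (module_vec TYPE(complex) k)" by (rule vec_vs)
    show "vectorspace class_ring ?W" by (rule vsW)
    show "module class_ring (module_vec TYPE(complex) k)" by (rule vec_module)
    show "module class_ring ?W" using vsW by (simp add: vectorspace_def)
    show "T \<in> module_hom class_ring (module_vec TYPE(complex) k) ?W" by (rule hom)
  qed
  have "vectorspace.fin_dim class_ring ?W"
  proof (rule lm.surj_fin_dim)
    show "vectorspace.fin_dim class_ring (module_vec TYPE(complex) k)" by (rule U.fin_dim)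
    show "T ` carrier (module_vec TYPE(complex) k) = carrier ?W"
      using TM MT by (auto simp: module_vec_simps)
  qed
  then show ?thesis using sub by (simp add: finite_dim_subspace_def)
qed

text \<open>The columns of \<open>H\<close> form a basis of \<open>M\<close>.  This replaces abstract finite-dimensional spaces by matrix functions, and the
  last conclusion keeps the linear independence of the basis.\<close>

lemma finite_dim_subspace_columns:
  assumes "finite_dim_subspace \<Lambda> m M"
  obtains k H where "H \<in> DA_mat \<Lambda> m k" "M = column_space \<Lambda> k H"
    "\<And>w. w \<in> carrier_vec k \<Longrightarrow> (\<And>z. z \<in> \<V> \<Longrightarrow> H z *\<^sub>v w = 0\<^sub>v m) \<Longrightarrow> w = 0\<^sub>v k"
proof -
  let ?V = "DA_vec_space \<Lambda> m"
  let ?W = "?V\<lparr>carrier := M\<rparr>"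
  have sub: "VectorSpace.subspace class_ring M ?V" and fd: "vectorspace.fin_dim class_ring ?W"
    using assms by (auto simp: finite_dim_subspace_def)
  interpret W: vectorspace class_ring ?W
    by (rule vectorspace.subspace_is_vs[OF vectorspace_DA_vec_space sub])
  have Wc: "carrier ?W = M" "zero ?W = (\<lambda>z\<in>\<V>. 0\<^sub>v m)"
    "\<And>f g. add ?W f g = (\<lambda>z\<in>\<V>. f z + g z)" "\<And>c f. module.smult ?W c f = (\<lambda>z\<in>\<V>. c \<cdot>\<^sub>v f z)"
    by (simp_all add: DA_vec_space_def)
  have "M \<subseteq> carrier ?V" using sub unfolding VectorSpace.subspace_def submodule_def by blast
  then have MV: "x \<in> DA_vec \<Lambda> m" if "x \<in> M" for x using that by (auto simp: DA_vec_space_def)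
  obtain \<beta> where \<beta>: "finite \<beta>" "W.basis \<beta>" using W.finite_basis_exists[OF fd] by blast
  have \<beta>M: "\<beta> \<subseteq> M" and span: "W.span \<beta> = M" and indep: "\<not> W.lin_dep \<beta>"
    using \<beta>(2) unfolding W.basis_def Wc by auto
  have closed: "W.lincomb a A \<in> M" if "A \<subseteq> M" for a :: "(complex \<Rightarrow> complex vec) \<Rightarrow> complex" and A
    using W.lincomb_closed[of A a] that unfolding Wc by (simp add: class_ring_simps)
  have entry: "W.lincomb a A z $ i = (\<Sum>x\<in>A. a x * x z $ i)"
    if "finite A" "A \<subseteq> M" "z \<in> \<V>" "i < m" for a A z i
    using that(1,2)
  proof (induction A rule: finite_induct)
    case empty
    then show ?case using that(3,4) by (simp add: W.lincomb_def Wc)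
  next
    case (insert x A)
    have "W.lincomb a (insert x A) = (\<lambda>z\<in>\<V>. (\<lambda>z\<in>\<V>. a x \<cdot>\<^sub>v x z) z + W.lincomb a A z)"
      using W.lincomb_insert2[of A a x] insert unfolding Wc by (simp add: class_ring_simps)
    moreover have "x z \<in> carrier_vec m" "W.lincomb a A z \<in> carrier_vec m"
      using DA_vec_carrier[OF MV that(3)] closed[of A a] insert.prems by auto
    ultimately show ?case using insert that(3,4) by simp
  qed
  obtain es where es: "set es = \<beta>" "distinct es" using finite_distinct_list[OF \<beta>(1)] by blast
  define k where "k = length es"
  define H where "H = (\<lambda>z\<in>\<V>. mat m k (\<lambda>(i, j). (es ! j) z $ i))"
  have esM: "es ! j \<in> M" if "j < k" for j using that es(1) \<beta>M by (auto simp: k_def)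
  have HC: "H z \<in> carrier_mat m k" if "z \<in> \<V>" for z using that by (simp add: H_def)
  have HDA: "H \<in> DA_mat \<Lambda> m k"
  proof -
    have "(\<lambda>z\<in>\<V>. H z $$ (i, j)) = (\<lambda>z\<in>\<V>. (es ! j) z $ i)" if "i < m" "j < k" for i j
      by (rule restrict_ext) (use that in \<open>simp add: H_def\<close>)
    then show ?thesis using DA_vec_entry[OF MV[OF esM]] HC by (simp add: DA_mat_def H_def)
  qed
  have comb: "W.lincomb a \<beta> = (\<lambda>z\<in>\<V>. H z *\<^sub>v w)"
    if w: "w \<in> carrier_vec k" and aw: "\<And>j. j < k \<Longrightarrow> a (es ! j) = w $ j" for a w
  proof (rule extensionalityI)
    show "W.lincomb a \<beta> \<in> extensional \<V>" by (rule DA_vec_extensional[OF MV[OF closed[OF \<beta>M]]])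
    fix z assume z: "z \<in> \<V>"
    have c: "W.lincomb a \<beta> z \<in> carrier_vec m" by (rule DA_vec_carrier[OF MV[OF closed[OF \<beta>M]] z])
    have "W.lincomb a \<beta> z = H z *\<^sub>v w"
    proof (rule eq_vecI)
      fix i assume "i < dim_vec (H z *\<^sub>v w)"
      then have i: "i < m" using HC[OF z] by simp
      have "W.lincomb a \<beta> z $ i = (\<Sum>x\<in>\<beta>. a x * x z $ i)" by (rule entry[OF \<beta>(1) \<beta>M z i])
      also have "\<dots> = (\<Sum>j\<in>{0..<k}. a (es ! j) * (es ! j) z $ i)"
      proof -
        have "{0..<k} = {..<length es}" by (auto simp: k_def)
        then have "bij_betw ((!) es) {0..<k} \<beta>" by (rule bij_betw_nth[OF es(2) _ es(1)[symmetric]])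
        then show ?thesis by (rule sum.reindex_bij_betw[symmetric])
      qed
      also have "\<dots> = (\<Sum>j\<in>{0..<k}. H z $$ (i, j) * w $ j)"
        by (rule sum.cong) (use aw i z in \<open>simp_all add: H_def mult.commute\<close>)
      also have "\<dots> = (H z *\<^sub>v w) $ i" by (rule mult_mat_vec_entry[OF HC[OF z] w i, symmetric])
      finally show "W.lincomb a \<beta> z $ i = (H z *\<^sub>v w) $ i" .
    qed (use c HC[OF z] in auto)
    then show "W.lincomb a \<beta> z = (\<lambda>z\<in>\<V>. H z *\<^sub>v w) z" using z by simp
  qed simp
  have pick: "\<exists>a. \<forall>j<k. a (es ! j) = w $ j" for w :: "complex vec"
  proof (intro exI allI impI)
    fix j assume "j < k"
    then show "(\<lambda>x. w $ (THE j. j < k \<and> es ! j = x)) (es ! j) = w $ j"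
      using es(2) by (auto simp: k_def nth_eq_iff_index_eq intro!: arg_cong[of _ _ "($) w"] the_equality)
  qed
  have "M = column_space \<Lambda> k H"
  proof
    show "M \<subseteq> column_space \<Lambda> k H"
    proof
      fix x assume "x \<in> M"
      then obtain a where a: "x = W.lincomb a \<beta>"
        using W.finite_span[OF \<beta>(1)] \<beta>M span unfolding Wc by blast
      have "x = (\<lambda>z\<in>\<V>. H z *\<^sub>v vec k (\<lambda>j. a (es ! j)))" unfolding a by (rule comb) simp_all
      then show "x \<in> column_space \<Lambda> k H" unfolding column_space_def by auto
    qed
    show "column_space \<Lambda> k H \<subseteq> M"
    proof
      fix x assume "x \<in> column_space \<Lambda> k H"
      then obtain w where w: "w \<in> carrier_vec k" "x = (\<lambda>z\<in>\<V>. H z *\<^sub>v w)" unfolding column_space_def by blast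
      obtain a where "\<forall>j<k. a (es ! j) = w $ j" using pick by blast
      then have "x = W.lincomb a \<beta>" using comb[OF w(1)] w(2) by simp
      then show "x \<in> M" using closed[OF \<beta>M] by simp
    qed
  qed
  moreover have "w = 0\<^sub>v k" if w: "w \<in> carrier_vec k" and 0: "\<And>z. z \<in> \<V> \<Longrightarrow> H z *\<^sub>v w = 0\<^sub>v m" for w
  proof (rule eq_vecI)
    fix j assume "j < dim_vec (0\<^sub>v k :: complex vec)"
    then have j: "j < k" by simp
    obtain a where a: "\<forall>j<k. a (es ! j) = w $ j" using pick by blast
    have "W.lincomb a \<beta> = (\<lambda>z\<in>\<V>. H z *\<^sub>v w)" using comb[OF w] a by simp
    also have "\<dots> = zero ?W" unfolding Wc by (rule restrict_ext) (rule 0)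
    finally have l0: "W.lincomb a \<beta> = zero ?W" .
    show "w $ j = 0\<^sub>v k $ j"
    proof (rule ccontr)
      assume "w $ j \<noteq> 0\<^sub>v k $ j"
      then have "a (es ! j) \<noteq> 0" using a j by simp
      moreover have "es ! j \<in> \<beta>" using es(1) j by (auto simp: k_def)
      ultimately have "W.lin_dep \<beta>"
        unfolding W.lin_dep_def using \<beta>(1) l0 by (intro exI[of _ \<beta>] exI[of _ a] exI[of _ "es ! j"]) (simp add: class_ring_simps)
      then show False using indep by blast
    qed
  qed (use w in auto)
  ultimately show thesis using that HDA by blast
qed

text \<open>With \<open>H = [f, C R]\<close> one has \<open>Z\<^sub>- H = H A'\<close> for the block matrix \<open>A' = [[0, 0], [B, A]]\<close>.\<close>

lemma rational_imp_invariant_space: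
  assumes f: "f \<in> DA_mat \<Lambda> m n" and r: "rational_DA \<Lambda> m n f"
  shows "\<exists>M. finite_dim_subspace \<Lambda> m M \<and> Zminus_vec \<Lambda> ` M \<subseteq> M \<and> column_space \<Lambda> n f \<subseteq> M"
proof -
  obtain l A B C D where A: "A \<in> carrier_mat l l" and B: "B \<in> carrier_mat l n" and C: "C \<in> carrier_mat m l"
    and D: "D \<in> carrier_mat m n" and S: "S_set \<Lambda> \<inter> spectrum A = {}"
    and fz: "\<And>z. z \<in> \<V> \<Longrightarrow> f z = D + C * Zplus_mat \<Lambda> (DA_resolvent \<Lambda> l A) z * B"
    using r unfolding rational_DA_def by blast
  define R where "R = DA_resolvent \<Lambda> l A"
  note R = DA_resolvent[OF A S, folded R_def]
  note RC = DA_mat_carrier[OF R(1)] and ZC = Zplus_mat_carrier[OF R(1)] and fC = DA_mat_carrier[OF f]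
  have CR: "C * R z \<in> carrier_mat m l" and CZ: "C * Zplus_mat \<Lambda> R z \<in> carrier_mat m l"
    and CZB: "C * Zplus_mat \<Lambda> R z * B \<in> carrier_mat m n" if z: "z \<in> \<V>" for z
    by (rule mult_carrier_mat[OF C RC[OF z]] mult_carrier_mat[OF C ZC[OF z]]
      mult_carrier_mat[OF mult_carrier_mat[OF C ZC[OF z]] B])+
  have s1: "mat_shift m l (\<lambda>z. C * Zplus_mat \<Lambda> R z) (\<lambda>z. C * R z)"
    by (rule mat_shift_mult_left[OF mat_shift_Zplus[OF R(1)] ZC RC C])
  have s2: "mat_shift m n (\<lambda>z. C * Zplus_mat \<Lambda> R z * B) (\<lambda>z. C * R z * B)"
    by (rule mat_shift_mult_right[OF s1 CZ CR B])
  have s3: "mat_shift m l (\<lambda>z. C * R z) (\<lambda>z. C * (R z * A))"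
    by (rule mat_shift_mult_left[OF R(3) RC mult_carrier_mat[OF RC A] C])
  have CRDA: "(\<lambda>z\<in>\<V>. C * R z) \<in> DA_mat \<Lambda> m l" by (rule mat_shift_DA[OF s1 CR])
  define H where "H = (\<lambda>z\<in>\<V>. mat m (n + l) (\<lambda>(i, j). if j < n then f z $$ (i, j) else (C * R z) $$ (i, j - n)))"
  define A' where "A' = mat (n + l) (n + l) (\<lambda>(p, q). if p < n then 0 else if q < n then B $$ (p - n, q) else A $$ (p - n, q - n))"
  have HC: "H z \<in> carrier_mat m (n + l)" if "z \<in> \<V>" for z using that by (simp add: H_def)
  have AC: "A' \<in> carrier_mat (n + l) (n + l)" by (simp add: A'_def)
  have HDA: "H \<in> DA_mat \<Lambda> m (n + l)"
  proof -
    have "(\<lambda>z\<in>\<V>. H z $$ (i, j)) \<in> DA \<Lambda>" if ij: "i < m" "j < n + l" for i j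
    proof (cases "j < n")
      case True
      have "(\<lambda>z\<in>\<V>. H z $$ (i, j)) = (\<lambda>z\<in>\<V>. f z $$ (i, j))"
        by (rule restrict_ext) (use ij True in \<open>simp add: H_def\<close>)
      then show ?thesis using DA_mat_entry[OF f ij(1) True] by simp
    next
      case False
      then have j: "j - n < l" using ij by simp
      have "(\<lambda>z\<in>\<V>. H z $$ (i, j)) = (\<lambda>z\<in>\<V>. (\<lambda>z\<in>\<V>. C * R z) z $$ (i, j - n))"
        by (rule restrict_ext) (use ij False in \<open>simp add: H_def del: index_mult_mat\<close>)
      then show ?thesis using DA_mat_entry[OF CRDA ij(1) j] by simp
    qed
    then show ?thesis using HC by (simp add: DA_mat_def H_def)
  qed
  have HA: "(H z * A') $$ (i, j) = (if j < n then (C * R z * B) $$ (i, j) else (C * (R z * A)) $$ (i, j - n))"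
    if z: "z \<in> \<V>" and ij: "i < m" "j < n + l" for z i j
  proof -
    have "(H z * A') $$ (i, j) = (\<Sum>p\<in>{0..<n + l}. H z $$ (i, p) * A' $$ (p, j))"
      by (rule mat_mult_entry[OF HC[OF z] AC ij])
    also have "\<dots> = (\<Sum>p\<in>{0..<l}. (C * R z) $$ (i, p) * (if j < n then B $$ (p, j) else A $$ (p, j - n)))"
      unfolding sum_split_nat using z ij by (cases "j < n") (simp_all add: H_def A'_def del: index_mult_mat)
    also have "\<dots> = (if j < n then (C * R z * B) $$ (i, j) else (C * (R z * A)) $$ (i, j - n))"
    proof (cases "j < n")
      case True
      then show ?thesis using mat_mult_entry[OF CR[OF z] B ij(1) True] by (simp del: index_mult_mat)
    next
      case False
      then have j: "j - n < l" using ij by simp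
      have "C * (R z * A) = C * R z * A" by (rule assoc_mult_mat[OF C RC[OF z] A, symmetric])
      then show ?thesis using mat_mult_entry[OF CR[OF z] A ij(1) j] False by (simp del: index_mult_mat)
    qed
    finally show ?thesis .
  qed
  have shift: "mat_shift m (n + l) H (\<lambda>z. H z * A')"
    unfolding mat_shift_def
  proof (intro allI impI)
    fix i j assume ij: "i < m" "j < n + l"
    show "shift_eq (\<lambda>z. H z $$ (i, j)) (\<lambda>z. (H z * A') $$ (i, j))"
    proof (cases "j < n")
      case True
      have "shift_eq (\<lambda>z. (C * Zplus_mat \<Lambda> R z * B) $$ (i, j)) (\<lambda>z. (C * R z * B) $$ (i, j))"
        using s2 ij True by (simp add: mat_shift_def)
      then have "shift_eq (\<lambda>z. D $$ (i, j) + (C * Zplus_mat \<Lambda> R z * B) $$ (i, j)) (\<lambda>z. (C * R z * B) $$ (i, j))"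
        by (simp add: shift_eq_def)
      then show ?thesis
      proof (rule shift_eq_cong[THEN iffD1, rotated 2])
        fix z assume z: "z \<in> \<V>"
        have "f z $$ (i, j) = D $$ (i, j) + (C * Zplus_mat \<Lambda> R z * B) $$ (i, j)"
          unfolding fz[OF z, folded R_def] using carrier_matD[OF CZB[OF z]] ij(1) True by (intro index_add_mat) simp_all
        then show "D $$ (i, j) + (C * Zplus_mat \<Lambda> R z * B) $$ (i, j) = H z $$ (i, j)"
          using z ij True by (simp add: H_def del: index_mult_mat)
        show "(C * R z * B) $$ (i, j) = (H z * A') $$ (i, j)" using HA[OF z ij] True by simp
      qed
    next
      case False
      then have "j - n < l" using ij by simp
      then have "shift_eq (\<lambda>z. (C * R z) $$ (i, j - n)) (\<lambda>z. (C * (R z * A)) $$ (i, j - n))"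
        using s3 ij by (simp add: mat_shift_def)
      then show ?thesis
        by (rule shift_eq_cong[THEN iffD1, rotated 2]) (use HA ij False in \<open>simp_all add: H_def del: index_mult_mat\<close>)
    qed
  qed
  have "Zminus_vec \<Lambda> ` column_space \<Lambda> (n + l) H \<subseteq> column_space \<Lambda> (n + l) H"
  proof (rule image_subsetI)
    fix x assume "x \<in> column_space \<Lambda> (n + l) H"
    then obtain w where w: "w \<in> carrier_vec (n + l)" "x = (\<lambda>z\<in>\<V>. H z *\<^sub>v w)" unfolding column_space_def by blast
    have "Zminus_vec \<Lambda> x = (\<lambda>z\<in>\<V>. H z *\<^sub>v (A' *\<^sub>v w))"
      unfolding w(2) by (rule Zminus_vec_column[OF shift HC AC w(1)])
    then show "Zminus_vec \<Lambda> x \<in> column_space \<Lambda> (n + l) H"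
      unfolding column_space_def using AC w(1) by (auto intro!: exI[of _ "A' *\<^sub>v w"])
  qed
  moreover have "column_space \<Lambda> n f \<subseteq> column_space \<Lambda> (n + l) H"
  proof
    fix x assume "x \<in> column_space \<Lambda> n f"
    then obtain w where w: "w \<in> carrier_vec n" "x = (\<lambda>z\<in>\<V>. f z *\<^sub>v w)" unfolding column_space_def by blast
    define w' where "w' = vec (n + l) (\<lambda>p. if p < n then w $ p else 0)"
    have w': "w' \<in> carrier_vec (n + l)" by (simp add: w'_def)
    have "x = (\<lambda>z\<in>\<V>. H z *\<^sub>v w')"
      unfolding w(2)
    proof (rule restrict_ext)
      fix z assume z: "z \<in> \<V>"
      show "f z *\<^sub>v w = H z *\<^sub>v w'"
      proof (rule eq_vecI)
        fix i assume "i < dim_vec (H z *\<^sub>v w')"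
        then have i: "i < m" using HC[OF z] by simp
        have "(H z *\<^sub>v w') $ i = (\<Sum>p\<in>{0..<n}. f z $$ (i, p) * w $ p)"
          unfolding mult_mat_vec_entry[OF HC[OF z] w' i] sum_split_nat using z i by (simp add: H_def w'_def del: index_mult_mat)
        then show "(f z *\<^sub>v w) $ i = (H z *\<^sub>v w') $ i" using mult_mat_vec_entry[OF fC[OF z] w(1) i] by simp
      qed (use fC[OF z] HC[OF z] in auto)
    qed
    then show "x \<in> column_space \<Lambda> (n + l) H" unfolding column_space_def using w' by blast
  qed
  ultimately show ?thesis using finite_dim_column_space[OF HDA] by blast
qed

text \<open>If \<open>Z\<^sub>- H = H A\<close> and \<open>f = H W\<close> for a basis \<open>H\<close> of \<open>M\<close>, then \<open>H = C R\<close> with \<open>C = H 0\<close> and the resolvent \<open>R\<close> of \<open>A\<close>, and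
  \<open>f = C (1 + Z\<^sub>+ R * A) W\<close> is a realization.\<close>

lemma invariant_space_imp_rational:
  assumes f: "f \<in> DA_mat \<Lambda> m n" and ev: "\<forall>t\<in>S_set \<Lambda>. \<not> Zminus_eigenvalue \<Lambda> t"
    and M: "finite_dim_subspace \<Lambda> m M" "Zminus_vec \<Lambda> ` M \<subseteq> M" "column_space \<Lambda> n f \<subseteq> M"
  shows "rational_DA \<Lambda> m n f"
proof -
  obtain k H where H: "H \<in> DA_mat \<Lambda> m k" and MH: "M = column_space \<Lambda> k H"
    and inj: "\<And>w. w \<in> carrier_vec k \<Longrightarrow> (\<And>z. z \<in> \<V> \<Longrightarrow> H z *\<^sub>v w = 0\<^sub>v m) \<Longrightarrow> w = 0\<^sub>v k"
    using finite_dim_subspace_columns[OF M(1)] by metis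
  note HC = DA_mat_carrier[OF H] and fC = DA_mat_carrier[OF f]
  have cols: "\<exists>W\<in>carrier_mat k c. \<forall>z\<in>\<V>. \<forall>i<m. \<forall>j<c. (H z * W) $$ (i, j) = x j z $ i"
    if x: "\<And>j. j < c \<Longrightarrow> x j \<in> M" for x c
  proof -
    have "\<exists>w. w \<in> carrier_vec k \<and> x j = (\<lambda>z\<in>\<V>. H z *\<^sub>v w)" if "j < c" for j
      using x[OF that] unfolding MH column_space_def by blast
    then obtain w where w: "\<And>j. j < c \<Longrightarrow> w j \<in> carrier_vec k" "\<And>j. j < c \<Longrightarrow> x j = (\<lambda>z\<in>\<V>. H z *\<^sub>v w j)"
      by metis
    define W where "W = mat k c (\<lambda>(p, j). w j $ p)"
    have W: "W \<in> carrier_mat k c" by (simp add: W_def)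
    have "(H z * W) $$ (i, j) = x j z $ i" if z: "z \<in> \<V>" and ij: "i < m" "j < c" for z i j
    proof -
      have "x j z $ i = (\<Sum>p\<in>{0..<k}. H z $$ (i, p) * w j $ p)"
        using w(2)[OF ij(2)] z mult_mat_vec_entry[OF HC[OF z] w(1)[OF ij(2)] ij(1)] by simp
      then show ?thesis unfolding mat_mult_entry[OF HC[OF z] W ij] using ij by (simp add: W_def)
    qed
    then show ?thesis using W by blast
  qed
  define e where "e j = (\<lambda>z\<in>\<V>. H z *\<^sub>v unit_vec k j)" for j
  have eM: "e j \<in> M" for j unfolding MH column_space_def e_def by auto
  have e_entry: "e j z $ i = H z $$ (i, j)" if "z \<in> \<V>" "i < m" "j < k" for j z i
    using mult_mat_vec_entry[OF HC[OF that(1)] unit_vec_carrier that(2)] that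
    by (simp add: e_def unit_vec_def if_distrib sum.If_cases del: index_mult_mat_vec cong: if_cong)
  have "Zminus_vec \<Lambda> (e j) \<in> M" for j using M(2) eM by blast
  then obtain A where A: "A \<in> carrier_mat k k"
    and HA: "\<And>z i j. z \<in> \<V> \<Longrightarrow> i < m \<Longrightarrow> j < k \<Longrightarrow> (H z * A) $$ (i, j) = Zminus_vec \<Lambda> (e j) z $ i"
    using cols[of k "\<lambda>j. Zminus_vec \<Lambda> (e j)"] by blast
  have shift: "mat_shift m k H (\<lambda>z. H z * A)"
    unfolding mat_shift_def
  proof (intro allI impI)
    fix i j assume ij: "i < m" "j < k"
    let ?h = "\<lambda>z\<in>\<V>. e j z $ i"
    have he: "?h = (\<lambda>z\<in>\<V>. H z $$ (i, j))" by (rule restrict_ext) (use e_entry ij in simp)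
    have "face_analytic ?h" unfolding he by (rule DA_face_analytic[OF DA_mat_entry[OF H ij]])
    then obtain g where g: "g \<in> extensional \<V>" "shift_eq ?h g" by (rule shift_eq_solvable)
    have "Zminus \<Lambda> ?h = g" by (rule Zminus_eqI[OF g])
    then have "Zminus_vec \<Lambda> (e j) z $ i = g z" if "z \<in> \<V>" for z
      using that HC[OF that] ij by (simp add: Zminus_vec_def e_def)
    then show "shift_eq (\<lambda>z. H z $$ (i, j)) (\<lambda>z. (H z * A) $$ (i, j))"
      by (intro shift_eq_cong[THEN iffD1, OF _ _ g(2)]) (use HA ij he e_entry in auto)
  qed
  have S: "S_set \<Lambda> \<inter> spectrum A = {}"
  proof (rule ccontr)
    assume "S_set \<Lambda> \<inter> spectrum A \<noteq> {}"
    then obtain t where t: "t \<in> S_set \<Lambda>" "eigenvalue A t" by (auto simp: spectrum_def)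
    then obtain v where v: "v \<in> carrier_vec k" "v \<noteq> 0\<^sub>v k" "A *\<^sub>v v = t \<cdot>\<^sub>v v"
      using A unfolding eigenvalue_def eigenvector_def by auto
    obtain z0 where z0: "z0 \<in> \<V>" "H z0 *\<^sub>v v \<noteq> 0\<^sub>v m" using inj[OF v(1)] v(2) by blast
    obtain i where i: "i < m" "(H z0 *\<^sub>v v) $ i \<noteq> 0"
    proof -
      have "dim_vec (H z0 *\<^sub>v v) = m" using HC[OF z0(1)] by simp
      then show thesis using z0(2) that by (metis eq_vecI index_zero_vec(1) index_zero_vec(2))
    qed
    let ?x = "\<lambda>z\<in>\<V>. (H z *\<^sub>v v) $ i"
    have "shift_eq (\<lambda>z. (H z *\<^sub>v v) $ i) (\<lambda>z. (H z *\<^sub>v (A *\<^sub>v v)) $ i)"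
      by (rule mat_shift_vec[OF shift HC A v(1) i(1)])
    moreover have "(H z *\<^sub>v (A *\<^sub>v v)) $ i = t * (H z *\<^sub>v v) $ i" if "z \<in> \<V>" for z
      unfolding v(3) mult_mat_vec[OF HC[OF that] v(1)] using HC[OF that] i(1) by (simp del: index_mult_mat_vec)
    ultimately have "shift_eq ?x (\<lambda>z\<in>\<V>. t * ?x z)"
      by (intro shift_eq_cong[THEN iffD1, of "\<lambda>z. (H z *\<^sub>v v) $ i" ?x "\<lambda>z. (H z *\<^sub>v (A *\<^sub>v v)) $ i"]) simp_all
    then have "Zminus \<Lambda> ?x = (\<lambda>z\<in>\<V>. t * ?x z)" by (intro Zminus_eqI) simp_all
    moreover have "?x \<in> DA \<Lambda>"
    proof -
      have "(\<lambda>z\<in>\<V>. (\<lambda>z\<in>\<V>. H z *\<^sub>v v) z $ i) = ?x" by (rule restrict_ext) simp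
      then show ?thesis using DA_vec_entry[OF column_in_DA_vec[OF H v(1)] i(1)] by simp
    qed
    moreover have "?x \<noteq> (\<lambda>z\<in>\<V>. 0)"
    proof
      assume "?x = (\<lambda>z\<in>\<V>. 0)"
      from fun_cong[OF this, of z0] show False using z0(1) i(2) by simp
    qed
    ultimately have "Zminus_eigenvalue \<Lambda> t" unfolding Zminus_eigenvalue_def by blast
    then show False using ev t(1) by blast
  qed
  define R where "R = DA_resolvent \<Lambda> k A"
  note R = DA_resolvent[OF A S, folded R_def]
  note RC = DA_mat_carrier[OF R(1)] and ZC = Zplus_mat_carrier[OF R(1)]
  define C where "C = H 0"
  have C: "C \<in> carrier_mat m k" unfolding C_def by (rule HC[OF zero_lvert])
  have HR: "H z = C * R z" if z: "z \<in> \<V>" for z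
  proof (rule mat_shift_unique[OF A S HC shift mult_carrier_mat[OF C RC] _ _ z])
    have "mat_shift m k (\<lambda>z. C * R z) (\<lambda>z. C * (R z * A))"
      by (rule mat_shift_mult_left[OF R(3) RC mult_carrier_mat[OF RC A] C])
    then show "mat_shift m k (\<lambda>z. C * R z) (\<lambda>z. C * R z * A)"
      unfolding mat_shift_def
    proof (intro allI impI)
      fix i j assume "\<forall>i<m. \<forall>j<k. shift_eq (\<lambda>z. (C * R z) $$ (i, j)) (\<lambda>z. (C * (R z * A)) $$ (i, j))" "i < m" "j < k"
      then have "shift_eq (\<lambda>z. (C * R z) $$ (i, j)) (\<lambda>z. (C * (R z * A)) $$ (i, j))" by blast
      then show "shift_eq (\<lambda>z. (C * R z) $$ (i, j)) (\<lambda>z. (C * R z * A) $$ (i, j))"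
        by (rule shift_eq_cong[THEN iffD1, rotated 2]) (simp_all only: assoc_mult_mat[OF C RC A])
    qed
    show "H 0 = C * R 0" unfolding R(2) C_def using HC[OF zero_lvert] by simp
  qed
  have "(\<lambda>z\<in>\<V>. f z *\<^sub>v unit_vec n j) \<in> M" for j
    by (rule subsetD[OF M(3)], unfold column_space_def, rule CollectI)
      (rule exI[of _ "unit_vec n j"], rule conjI[OF refl unit_vec_carrier])
  then obtain W where W: "W \<in> carrier_mat k n"
    and HW: "\<And>z i j. z \<in> \<V> \<Longrightarrow> i < m \<Longrightarrow> j < n \<Longrightarrow> (H z * W) $$ (i, j) = (\<lambda>z\<in>\<V>. f z *\<^sub>v unit_vec n j) z $ i"
    using cols[of n "\<lambda>j. \<lambda>z\<in>\<V>. f z *\<^sub>v unit_vec n j"] by blast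
  have fW: "f z = H z * W" if z: "z \<in> \<V>" for z
  proof (rule eq_matI)
    note c = mult_carrier_mat[OF HC[OF z] W]
    fix i j assume "i < dim_row (H z * W)" "j < dim_col (H z * W)"
    then have ij: "i < m" "j < n" using carrier_matD[OF c] by auto
    have "(H z * W) $$ (i, j) = (f z *\<^sub>v unit_vec n j) $ i" using HW[OF z ij] z by simp
    also have "\<dots> = f z $$ (i, j)"
      using mult_mat_vec_entry[OF fC[OF z] unit_vec_carrier ij(1)] ij
      by (simp add: unit_vec_def if_distrib sum.If_cases del: index_mult_mat_vec cong: if_cong)
    finally show "f z $$ (i, j) = (H z * W) $$ (i, j)" by simp
  qed (use fC[OF z] carrier_matD[OF mult_carrier_mat[OF HC[OF z] W]] in auto)
  have real: "f z = C * W + C * Zplus_mat \<Lambda> R z * (A * W)" if z: "z \<in> \<V>" for z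
  proof -
    note ZA = mult_carrier_mat[OF ZC[OF z] A]
    have "f z = (C * (1\<^sub>m k + Zplus_mat \<Lambda> R z * A)) * W" unfolding fW[OF z] HR[OF z] R(4)[OF z, symmetric] by (rule refl)
    also have "C * (1\<^sub>m k + Zplus_mat \<Lambda> R z * A) = C * 1\<^sub>m k + C * (Zplus_mat \<Lambda> R z * A)"
      by (rule mult_add_distrib_mat[OF C one_carrier_mat ZA])
    also have "C * 1\<^sub>m k = C" by (rule right_mult_one_mat[OF C])
    also have "C * (Zplus_mat \<Lambda> R z * A) = (C * Zplus_mat \<Lambda> R z) * A" by (rule assoc_mult_mat[OF C ZC[OF z] A, symmetric])
    also have "(C + C * Zplus_mat \<Lambda> R z * A) * W = C * W + C * Zplus_mat \<Lambda> R z * A * W"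
      by (rule add_mult_distrib_mat[OF C mult_carrier_mat[OF mult_carrier_mat[OF C ZC[OF z]] A] W])
    also have "C * Zplus_mat \<Lambda> R z * A * W = C * Zplus_mat \<Lambda> R z * (A * W)"
      by (rule assoc_mult_mat[OF mult_carrier_mat[OF C ZC[OF z]] A W])
    finally show ?thesis .
  qed
  show ?thesis
    unfolding rational_DA_def
  proof (intro exI conjI ballI)
    show "A \<in> carrier_mat k k" "A * W \<in> carrier_mat k n" "C \<in> carrier_mat m k" "C * W \<in> carrier_mat m n"
      by (rule A, rule mult_carrier_mat[OF A W], rule C, rule mult_carrier_mat[OF C W])
    show "S_set \<Lambda> \<inter> spectrum A = {}" by (rule S)
    fix z assume "z \<in> \<V>"
    then show "f z = C * W + C * Zplus_mat \<Lambda> (DA_resolvent \<Lambda> k A) z * (A * W)" using real by (simp only: R_def)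
  qed
qed

end

theorem theorem5p12:
  fixes \<Lambda> :: "complex set set"
    and m n :: nat
    and f :: "complex \<Rightarrow> complex mat"
  assumes "rhombic_lattice \<Lambda>"
    and "\<forall>t\<in>S_set \<Lambda>. \<not> Zminus_eigenvalue \<Lambda> t"
    and "f \<in> DA_mat \<Lambda> m n"
  shows "rational_DA \<Lambda> m n f \<longleftrightarrow>
    (\<exists>M. finite_dim_subspace \<Lambda> m M \<and> Zminus_vec \<Lambda> ` M \<subseteq> M \<and> column_space \<Lambda> n f \<subseteq> M)"
proof -
  interpret rhombic_plane_lattice \<Lambda> by standard (rule assms(1))
  show ?thesis
    using rational_imp_invariant_space[OF assms(3)] invariant_space_imp_rational[OF assms(3,2)] by blast
qed

end
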